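(* Let $X=\mathbb{A}^9_{\mathbb{R}}$ be the affine space of pairs $(v,A)$, where $v$ is a column vector of length $3$ and $A$ is a symmetric $3\times3$ matrix over $\mathbb{R}$, and let the real algebraic group $G=\operatorname{SO}_3$ act on $X$ by $R\cdot(v,A)=(Rv,RAR^t)$. Let $$X_0=\{(v,A)\in X: A\text{ has distinct eigenvalues}\}\subseteq X,$$ and let $\Delta\in\mathbb{R}[X]^G$ be the discriminant of the characteristic polynomial of $A$. Then the algebraic quotient $$X_0/\!/G=\operatorname{Spec}(\mathbb{R}[X_0]^G)=\operatorname{Spec}(\mathbb{R}[X]^G[\Delta^{-1}])$$ is a geometric quotient of $X_0$ by $G$, and therefore a geometric rational quotient for the action of $G$ on $X$.
   Context: The space $X$ is the Bloch matrix model $B\mathscr{L}_S$ of the variety of symmetrically mixed states of two qubits: the pair $(v,A)$ stands for the $4\times4$ matrix $\begin{pmatrix}1 & v^t \\ v & A\end{pmatrix}$. $X_0$ is the open subscheme $\{\Delta\ne0\}$ of $X$. For an affine variety $X$ over a field $k$ of characteristic zero with an action of a reductive $k$-group $G$, the algebraic quotient $X/\!/G$ is $\operatorname{Spec}(k[X]^G)$. A geometric quotient of $X$ by $G$ is a $k$-variety $Y$ with a $k$-morphism $f:X\to Y$ such that (i) $f$ is open, constant on $G$-orbits, and induces a bijection $X(\bar k)/G(\bar k)\leftrightarrow Y(\bar k)$, where $\bar k$ is an algebraically closed field containing $k$; and (ii) for every open $V\subseteq Y$ the natural morphism $k[V]\to k[f^{-1}(V)]^G$ is an isomorphism. A geometric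 rational quotient of $X$ by $G$ is a geometric quotient of the form $Y=U/G$ where $U\subseteq X$ is an open dense $G$-invariant subset. Here $k=\mathbb{R}$, $\bar k=\mathbb{C}$, and the morphism $X_0\to X_0/\!/G$ is the one induced by $\mathbb{R}[X_0]^G\subseteq\mathbb{R}[X_0]$. *)

theory Defs
  imports
    "HOL-Analysis.Analysis"
    "HOL-Algebra.Algebraic_Closure_Type"
    "HOL-Algebra.Generated_Rings"
    "HOL-Library.Poly_Mapping"
begin

section \<open>Spectra of commutative rings\<close>

definition Spec :: "'a ring \<Rightarrow> 'a set set"
  where "Spec A = {p. primeideal p A}"

text \<open>The closed sets are the sets \<open>V(I) = {p. I \<subseteq> p}\<close>.\<close>

definition zariski_open :: "'a ring \<Rightarrow> 'a set set \<Rightarrow> bool"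
  where "zariski_open A W \<longleftrightarrow> (\<exists>I \<subseteq> carrier A. W = {p \<in> Spec A. \<not> I \<subseteq> p})"

definition zariski :: "'a ring \<Rightarrow> 'a set topology"
  where "zariski A = topology (zariski_open A)"

lemma istopology_zariski_open: "istopology (zariski_open A)"
  unfolding istopology_def
proof (intro conjI allI impI)
  fix S T assume "zariski_open A S" "zariski_open A T"
  then obtain I J where I: "I \<subseteq> carrier A" "S = {p \<in> Spec A. \<not> I \<subseteq> p}"
    and J: "J \<subseteq> carrier A" "T = {p \<in> Spec A. \<not> J \<subseteq> p}"
    by (auto simp: zariski_open_def)
  define K where "K = {i \<otimes>\<^bsub>A\<^esub> j | i j. i \<in> I \<and> j \<in> J} \<inter> carrier A"
  have "\<not> K \<subseteq> p \<longleftrightarrow> \<not> I \<subseteq> p \<and> \<not> J \<subseteq> p" if "p \<in> Spec A" for p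
  proof -
    interpret primeideal p A using that by (simp add: Spec_def)
    show ?thesis
    proof
      assume "\<not> K \<subseteq> p"
      then obtain i j where ij: "i \<in> I" "j \<in> J" "i \<otimes>\<^bsub>A\<^esub> j \<notin> p" by (auto simp: K_def)
      then have "i \<notin> p" "j \<notin> p" using I(1) J(1) I_l_closed I_r_closed by blast+
      with ij show "\<not> I \<subseteq> p \<and> \<not> J \<subseteq> p" by blast
    next
      assume "\<not> I \<subseteq> p \<and> \<not> J \<subseteq> p"
      then obtain i j where ij: "i \<in> I" "j \<in> J" "i \<notin> p" "j \<notin> p" by blast
      then have c: "i \<in> carrier A" "j \<in> carrier A" using I(1) J(1) by blast+
      then have "i \<otimes>\<^bsub>A\<^esub> j \<notin> p" using ij I_prime by blast
      moreover have "i \<otimes>\<^bsub>A\<^esub> j \<in> K" using ij c by (auto simp: K_def)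
      ultimately show "\<not> K \<subseteq> p" by blast
    qed
  qed
  then have "S \<inter> T = {p \<in> Spec A. \<not> K \<subseteq> p}" using I J by auto
  moreover have "K \<subseteq> carrier A" by (simp add: K_def)
  ultimately show "zariski_open A (S \<inter> T)" unfolding zariski_open_def by blast
next
  fix \<K> assume "\<forall>K\<in>\<K>. zariski_open A K"
  then obtain I where I: "\<And>K. K \<in> \<K> \<Longrightarrow> I K \<subseteq> carrier A \<and> K = {p \<in> Spec A. \<not> I K \<subseteq> p}"
    unfolding zariski_open_def by metis
  have "\<Union>\<K> = {p \<in> Spec A. \<not> (\<Union>K\<in>\<K>. I K) \<subseteq> p}"
  proof (intro equalityI subsetI)
    fix p assume "p \<in> \<Union>\<K>"
    then obtain K where "K \<in> \<K>" "p \<in> K" by blast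
    then have "p \<in> {p \<in> Spec A. \<not> I K \<subseteq> p}" using I[of K] by blast
    with \<open>K \<in> \<K>\<close> show "p \<in> {p \<in> Spec A. \<not> (\<Union>K\<in>\<K>. I K) \<subseteq> p}" by blast
  next
    fix p assume "p \<in> {p \<in> Spec A. \<not> (\<Union>K\<in>\<K>. I K) \<subseteq> p}"
    then obtain K where "K \<in> \<K>" "p \<in> {p \<in> Spec A. \<not> I K \<subseteq> p}" by blast
    then have "p \<in> K" using I[of K] by blast
    with \<open>K \<in> \<K>\<close> show "p \<in> \<Union>\<K>" by blast
  qed
  moreover have "(\<Union>K\<in>\<K>. I K) \<subseteq> carrier A" using I by blast
  ultimately show "zariski_open A (\<Union>\<K>)" unfolding zariski_open_def by blast
qed

lemma openin_zariski: "openin (zariski A) W \<longleftrightarrow> zariski_open A W"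
  by (simp add: zariski_def istopology_zariski_open topology_inverse')

text \<open>The element \<open>a/s\<close> of the localization \<open>A\<^sub>p\<close>, as the class of all pairs equivalent to \<open>(a, s)\<close>.\<close>

definition frac :: "'a ring \<Rightarrow> 'a set \<Rightarrow> 'a \<Rightarrow> 'a \<Rightarrow> ('a \<times> 'a) set"
  where "frac A p a s =
    {(b, t). b \<in> carrier A \<and> t \<in> carrier A - p \<and>
       (\<exists>u \<in> carrier A - p. u \<otimes>\<^bsub>A\<^esub> (a \<otimes>\<^bsub>A\<^esub> t) = u \<otimes>\<^bsub>A\<^esub> (b \<otimes>\<^bsub>A\<^esub> s))}"

text \<open>The unions below are taken over equal sets: they choose representatives.\<close>

definition stalk :: "'a ring \<Rightarrow> 'a set \<Rightarrow> ('a \<times> 'a) set ring"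
  where "stalk A p = \<lparr>
    carrier = {frac A p a s | a s. a \<in> carrier A \<and> s \<in> carrier A - p},
    mult = (\<lambda>x y. \<Union>(a, s)\<in>x. \<Union>(b, t)\<in>y. frac A p (a \<otimes>\<^bsub>A\<^esub> b) (s \<otimes>\<^bsub>A\<^esub> t)),
    one = frac A p \<one>\<^bsub>A\<^esub> \<one>\<^bsub>A\<^esub>,
    zero = frac A p \<zero>\<^bsub>A\<^esub> \<one>\<^bsub>A\<^esub>,
    add = (\<lambda>x y. \<Union>(a, s)\<in>x. \<Union>(b, t)\<in>y.
             frac A p (a \<otimes>\<^bsub>A\<^esub> t \<oplus>\<^bsub>A\<^esub> b \<otimes>\<^bsub>A\<^esub> s) (s \<otimes>\<^bsub>A\<^esub> t))\<rparr>"

definition stalk_max :: "'a ring \<Rightarrow> 'a set \<Rightarrow> ('a \<times> 'a) set set"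
  where "stalk_max A p = {frac A p a s | a s. a \<in> p \<and> s \<in> carrier A - p}"

type_synonym 'a local_section = "'a set \<Rightarrow> ('a \<times> 'a) set"

text \<open>The sections over \<open>W\<close> of the structure sheaf of \<open>Spec A\<close>: functions with values in the
  stalks that are locally given by a single fraction.\<close>

definition sections :: "'a ring \<Rightarrow> 'a set set \<Rightarrow> 'a local_section set"
  where "sections A W =
    {s \<in> (\<Pi>\<^sub>E p\<in>W. carrier (stalk A p)).
       \<forall>p\<in>W. \<exists>N. openin (zariski A) N \<and> p \<in> N \<and> N \<subseteq> W \<and>
         (\<exists>a\<in>carrier A. \<exists>f\<in>carrier A. \<forall>q\<in>N. f \<notin> q \<and> s q = frac A q a f)}"

definition section_ring :: "'a ring \<Rightarrow> 'a set set \<Rightarrow> 'a local_section ring"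
  where "section_ring A W = \<lparr>
    carrier = sections A W,
    mult = (\<lambda>s t. \<lambda>p\<in>W. s p \<otimes>\<^bsub>stalk A p\<^esub> t p),
    one = (\<lambda>p\<in>W. \<one>\<^bsub>stalk A p\<^esub>),
    zero = (\<lambda>p\<in>W. \<zero>\<^bsub>stalk A p\<^esub>),
    add = (\<lambda>s t. \<lambda>p\<in>W. s p \<oplus>\<^bsub>stalk A p\<^esub> t p)\<rparr>"

definition frac_section :: "'a ring \<Rightarrow> 'a set set \<Rightarrow> 'a \<Rightarrow> 'a \<Rightarrow> 'a local_section"
  where "frac_section A W a f = (\<lambda>p\<in>W. frac A p a f)"


section \<open>Morphisms to affine schemes\<close>

text \<open>For an open \<open>U \<subseteq> Spec A\<close>, a ring homomorphism \<open>\<phi>\<close> from \<open>B\<close> to the sections over \<open>U\<close>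
  induces a morphism \<open>U \<rightarrow> Spec B\<close>. On points it sends \<open>p\<close> to the preimage of the maximal ideal
  of the stalk at \<open>p\<close>; a section locally given by \<open>b/c\<close> is pulled back to \<open>\<phi>(b)/\<phi>(c)\<close>.\<close>

definition to_Spec :: "'a ring \<Rightarrow> 'b ring \<Rightarrow> ('b \<Rightarrow> 'a local_section) \<Rightarrow> 'a set \<Rightarrow> 'b set"
  where "to_Spec A B \<phi> p = {b \<in> carrier B. \<phi> b p \<in> stalk_max A p}"

definition to_Spec_vimage ::
  "'a ring \<Rightarrow> 'b ring \<Rightarrow> 'a set set \<Rightarrow> ('b \<Rightarrow> 'a local_section) \<Rightarrow> 'b set set \<Rightarrow> 'a set set"
  where "to_Spec_vimage A B U \<phi> V = {p \<in> U. to_Spec A B \<phi> p \<in> V}"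

definition pullback ::
  "'a ring \<Rightarrow> 'b ring \<Rightarrow> 'a set set \<Rightarrow> ('b \<Rightarrow> 'a local_section) \<Rightarrow> 'b set set \<Rightarrow> 'b local_section \<Rightarrow> 'a local_section"
  where "pullback A B U \<phi> V t =
    (\<lambda>p\<in>to_Spec_vimage A B U \<phi> V. \<Union>(b, c)\<in>t (to_Spec A B \<phi> p).
       \<phi> b p \<otimes>\<^bsub>stalk A p\<^esub> inv\<^bsub>stalk A p\<^esub> \<phi> c p)"


section \<open>Affine real varieties\<close>

text \<open>An \<open>\<real>\<close>-algebra is a commutative ring \<open>B\<close> with a structure homomorphism \<open>\<iota>\<close>. Varieties are
  integral; affine schemes are automatically separated.\<close>

definition real_algebra :: "'b ring \<Rightarrow> (real \<Rightarrow> 'b) \<Rightarrow> bool"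
  where "real_algebra B \<iota> \<longleftrightarrow> cring B \<and> \<iota> \<in> ring_hom (ring_of_type_algebra :: real ring) B"

definition affine_real_variety :: "'b ring \<Rightarrow> (real \<Rightarrow> 'b) \<Rightarrow> bool"
  where "affine_real_variety B \<iota> \<longleftrightarrow> real_algebra B \<iota> \<and> domain B \<and>
    (\<exists>S. finite S \<and> S \<subseteq> carrier B \<and> generate_ring B (S \<union> range \<iota>) = carrier B)"

text \<open>The \<open>\<complex>\<close>-points of \<open>Spec B\<close> over \<open>\<real>\<close>, as homomorphisms of \<open>\<real>\<close>-algebras from \<open>B\<close> to \<open>\<complex>\<close>.\<close>

definition complex_points :: "'b ring \<Rightarrow> (real \<Rightarrow> 'b) \<Rightarrow> ('b \<Rightarrow> complex) set"
  where "complex_points B \<iota> =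
    {\<psi> \<in> ring_hom B (ring_of_type_algebra :: complex ring) \<inter> extensional (carrier B).
       \<forall>r. \<psi> (\<iota> r) = complex_of_real r}"


section \<open>The space of pairs and the action of the special orthogonal group\<close>

datatype coord = V1 | V2 | V3 | A11 | A12 | A13 | A22 | A23 | A33

type_synonym real_poly = "(coord \<Rightarrow>\<^sub>0 nat) \<Rightarrow>\<^sub>0 real"

definition Var :: "coord \<Rightarrow> real_poly"
  where "Var c = Poly_Mapping.single (Poly_Mapping.single c 1) 1"

definition Const :: "real \<Rightarrow> real_poly"
  where "Const r = Poly_Mapping.single 0 r"

abbreviation RX :: "real_poly ring"
  where "RX \<equiv> ring_of_type_algebra"

type_synonym point = "(complex^3) \<times> (complex^3^3)"

definition X_points :: "point set"
  where "X_points = {(v, A). transpose A = A}"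

primrec coord_value :: "coord \<Rightarrow> point \<Rightarrow> complex" where
  "coord_value V1 x = fst x $ 1"
| "coord_value V2 x = fst x $ 2"
| "coord_value V3 x = fst x $ 3"
| "coord_value A11 x = snd x $ 1 $ 1"
| "coord_value A12 x = snd x $ 1 $ 2"
| "coord_value A13 x = snd x $ 1 $ 3"
| "coord_value A22 x = snd x $ 2 $ 2"
| "coord_value A23 x = snd x $ 2 $ 3"
| "coord_value A33 x = snd x $ 3 $ 3"

definition eval_at :: "point \<Rightarrow> real_poly \<Rightarrow> complex"
  where "eval_at x P =
    (\<Sum>m\<in>Poly_Mapping.keys P. complex_of_real (Poly_Mapping.lookup P m) *
       (\<Prod>c\<in>Poly_Mapping.keys m. coord_value c x ^ Poly_Mapping.lookup m c))"

definition SO3 :: "(complex^3^3) set"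
  where "SO3 = {g. rotation_matrix g}"

definition act :: "complex^3^3 \<Rightarrow> point \<Rightarrow> point"
  where "act g x = (g *v fst x, g ** snd x ** transpose g)"

definition orbit :: "point \<Rightarrow> point set"
  where "orbit x = (\<lambda>g. act g x) ` SO3"

text \<open>For \<open>U \<subseteq> Spec RX\<close> the set \<open>U(\<complex>)\<close>: a complex point lies on the point of \<open>Spec RX\<close>
  consisting of the real polynomials vanishing there.\<close>

definition points_of :: "real_poly set set \<Rightarrow> point set"
  where "points_of U = {x \<in> X_points. {P. eval_at x P = 0} \<in> U}"

definition section_value :: "real_poly local_section \<Rightarrow> point \<Rightarrow> complex"
  where "section_value s x =
    the_elem ((\<lambda>(a, f). eval_at x a / eval_at x f) ` s {P. eval_at x P = 0})"

definition G_stable :: "real_poly set set \<Rightarrow> bool"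
  where "G_stable U \<longleftrightarrow> (\<forall>g\<in>SO3. \<forall>x\<in>points_of U. act g x \<in> points_of U)"

definition poly_invariants :: "real_poly set"
  where "poly_invariants = {P. \<forall>g\<in>SO3. \<forall>x\<in>X_points. eval_at (act g x) P = eval_at x P}"

definition invariant_ring :: "real_poly set set \<Rightarrow> real_poly local_section ring"
  where "invariant_ring W = (section_ring RX W)\<lparr>carrier :=
    {s \<in> sections RX W. \<forall>g\<in>SO3. \<forall>x\<in>points_of W. section_value s (act g x) = section_value s x}\<rparr>"

definition const_section :: "real_poly set set \<Rightarrow> real \<Rightarrow> real_poly local_section"
  where "const_section W r = frac_section RX W (Const r) 1"


section \<open>Geometric quotients\<close>

text \<open>The \<open>\<complex>\<close>-point of \<open>Spec B\<close> to which the morphism given by \<open>\<phi>\<close> sends \<open>x\<close>.\<close>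

definition quotient_point ::
  "'b ring \<Rightarrow> ('b \<Rightarrow> real_poly local_section) \<Rightarrow> point \<Rightarrow> 'b \<Rightarrow> complex"
  where "quotient_point B \<phi> x = (\<lambda>b\<in>carrier B. section_value (\<phi> b) x)"

text \<open>\<open>Spec B\<close>, with the morphism \<open>U \<rightarrow> Spec B\<close> given by \<open>\<phi>\<close>, is a geometric quotient of the
  \<open>G\<close>-stable open subscheme \<open>U\<close> of \<open>X = Spec RX\<close>. Only affine targets are considered.\<close>

definition geometric_quotient ::
  "real_poly set set \<Rightarrow> 'b ring \<Rightarrow> (real \<Rightarrow> 'b) \<Rightarrow> ('b \<Rightarrow> real_poly local_section) \<Rightarrow> bool"
  where "geometric_quotient U B \<iota> \<phi> \<longleftrightarrow>
    openin (zariski RX) U \<and> G_stable U \<and>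
    affine_real_variety B \<iota> \<and>
    \<phi> \<in> ring_hom B (section_ring RX U) \<and> (\<forall>r. \<phi> (\<iota> r) = const_section U r) \<and>
    open_map (subtopology (zariski RX) U) (zariski B) (to_Spec RX B \<phi>) \<and>
    (\<forall>g\<in>SO3. \<forall>x\<in>points_of U. quotient_point B \<phi> (act g x) = quotient_point B \<phi> x) \<and>
    bij_betw (\<lambda>S. the_elem (quotient_point B \<phi> ` S)) (orbit ` points_of U) (complex_points B \<iota>) \<and>
    (\<forall>V. openin (zariski B) V \<longrightarrow>
       pullback RX B U \<phi> V \<in>
         ring_iso (section_ring B V) (invariant_ring (to_Spec_vimage RX B U \<phi> V)))"

definition geometric_rational_quotient ::
  "real_poly set set \<Rightarrow> 'b ring \<Rightarrow> (real \<Rightarrow> 'b) \<Rightarrow> ('b \<Rightarrow> real_poly local_section) \<Rightarrow> bool"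
  where "geometric_rational_quotient U B \<iota> \<phi> \<longleftrightarrow>
    openin (zariski RX) U \<and> zariski RX closure_of U = Spec RX \<and> G_stable U \<and>
    geometric_quotient U B \<iota> \<phi>"


section \<open>The discriminant\<close>

definition charpoly :: "'a::comm_ring_1^'n^'n \<Rightarrow> 'a poly"
  where "charpoly A = det (\<chi> i j. (if i = j then [:0, 1:] else 0) - [:A $ i $ j:])"

text \<open>The discriminant of a monic cubic \<open>T\<^sup>3 + bT\<^sup>2 + cT + d\<close>.\<close>

definition cubic_discriminant :: "'a::comm_ring_1 poly \<Rightarrow> 'a"
  where "cubic_discriminant p =
    (let b = Polynomial.coeff p 2; c = Polynomial.coeff p 1; d = Polynomial.coeff p 0
     in b^2 * c^2 - 4 * c^3 - 4 * b^3 * d - 27 * d^2 + 18 * b * c * d)"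

definition generic_matrix :: "real_poly^3^3"
  where "generic_matrix = vector
    [vector [Var A11, Var A12, Var A13],
     vector [Var A12, Var A22, Var A23],
     vector [Var A13, Var A23, Var A33]]"

definition Discr :: real_poly
  where "Discr = cubic_discriminant (charpoly generic_matrix)"

definition X0 :: "real_poly set set"
  where "X0 = {p \<in> Spec RX. Discr \<notin> p}"

definition eigenvalues :: "complex^'n^'n \<Rightarrow> complex set"
  where "eigenvalues A = {c. \<exists>w. w \<noteq> 0 \<and> A *v w = c *s w}"

end

theory Submission
  imports Defs
begin

text \<open>Over the locus of distinct eigenvalues every pair \<open>(v, A)\<close> is a rotation of a pair with \<open>A\<close>
  diagonal, and such pairs meet each orbit in an orbit of the finite group of signed permutation
  matrices. Averaging over this group and Lagrange interpolation in the eigenvalues show that, up to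
  powers of \<open>\<Delta>\<close>, the invariants are generated by the traces \<open>tr A\<^sup>n\<close>, the moments
  \<open>v\<^sup>t A\<^sup>n v\<close> and \<open>det (v, A v, A\<^sup>2 v)\<close>. These separate orbits and take all values allowed by the
  relations, which gives the bijection on complex points. For scheme points, \<open>h\<close> satisfies on each
  translate of the slice a monic polynomial whose coefficients, the elementary symmetric functions of
  the values of \<open>h\<close> over the finite group, are invariants up to powers of \<open>\<Delta>\<close>. If none of these
  lies outside \<open>p\<close>, some power of \<open>h\<close> lies in \<open>p\<close>; if one of them lies outside a prime \<open>q\<close> of the
  invariant ring, then \<open>q\<close> is the trace of a prime avoiding \<open>h\<close>. This makes the quotient map open
  and surjective.\<close>

section \<open>Evaluation of polynomials\<close>

text \<open>The group is infinite and acts on complex points, while a prime ideal of the real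
  polynomial ring can be neither moved by a complex rotation nor averaged over the group. Both
  difficulties are met on real triples \<open>(g, v, l)\<close>: a rotation, a vector and three
  distinct eigenvalues. The map to the point \<open>g (v, diag l)\<close> is a quotient by the 24
  signed permutation matrices of determinant one, the rotations of a cube, and polynomial identities
  may be tested on its image. One averaging argument is run over two coefficient rings: fractions of
  the chosen invariants, where the odd functions come from the coordinates of \<open>v\<close> in
  the eigenbasis, and fractions of all polynomials, where they come from the entries of the
  eigenvectors. The first takes functions on the slice down to invariants, the second takes
  functions on group times slice down to polynomials. The link between them is interpolation: for a
  variable rotation \<open>g\<close>, the value of \<open>h\<close> at \<open>g x\<close> is a
  combination of its values at finitely many fixed rotations of \<open>x\<close>, with coefficients
  polynomial in the entries of \<open>g\<close>.\<close>

instance coord :: finite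
proof
  have "c \<in> {V1, V2, V3, A11, A12, A13, A22, A23, A33}" for c by (cases c) simp_all
  then show "finite (UNIV :: coord set)"
    by (metis finite.emptyI finite_insert finite_subset subsetI)
qed

text \<open>Polymorphic in the field, so that identities are tested at real points and orbits
  studied at complex ones with the same rules. The product runs over all coordinates, which makes
  multiplicativity a matter of adding exponents.\<close>

definition evl :: "(coord \<Rightarrow> 'a::real_field) \<Rightarrow> real_poly \<Rightarrow> 'a"
  where "evl f P = (\<Sum>m\<in>Poly_Mapping.keys P. of_real (Poly_Mapping.lookup P m) *
    (\<Prod>c\<in>UNIV. f c ^ Poly_Mapping.lookup m c))"

lemma eval_at_evl: "eval_at x = evl (\<lambda>c. coord_value c x)"
proof -
  have "(\<Prod>c\<in>Poly_Mapping.keys m. coord_value c x ^ Poly_Mapping.lookup m c) =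
    (\<Prod>c\<in>UNIV. coord_value c x ^ Poly_Mapping.lookup m c)" for m
    by (rule prod.mono_neutral_left) (auto simp: in_keys_iff)
  then show ?thesis by (auto simp: eval_at_def evl_def fun_eq_iff)
qed

lemma evl_superset:
  assumes "finite S" "Poly_Mapping.keys P \<subseteq> S"
  shows "evl f P = (\<Sum>m\<in>S. of_real (Poly_Mapping.lookup P m) *
    (\<Prod>c\<in>UNIV. f c ^ Poly_Mapping.lookup m c))"
  unfolding evl_def by (rule sum.mono_neutral_left) (use assms in \<open>auto simp: in_keys_iff\<close>)

lemma evl_add [simp]: "evl f (P + Q) = evl f P + evl f Q"
proof -
  let ?S = "Poly_Mapping.keys P \<union> Poly_Mapping.keys Q"
  have "Poly_Mapping.keys (P + Q) \<subseteq> ?S" by (rule keys_add)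
  then show ?thesis
    by (simp add: evl_superset[of ?S] lookup_add algebra_simps sum.distrib)
qed

lemma evl_single [simp]:
  "evl f (Poly_Mapping.single m r) = of_real r * (\<Prod>c\<in>UNIV. f c ^ Poly_Mapping.lookup m c)"
  by (cases "r = 0") (auto simp: evl_def)

lemma evl_zero [simp]: "evl f 0 = 0" by (simp add: evl_def)

lemma evl_one [simp]: "evl f 1 = 1"
  using evl_single[of f 0 1] by simp

lemma poly_mapping_add_induct:
  assumes s: "\<And>m r. Q (Poly_Mapping.single m r)" and a: "\<And>P P'. Q P \<Longrightarrow> Q P' \<Longrightarrow> Q (P + P')"
  shows "Q (P :: 'a \<Rightarrow>\<^sub>0 'b::comm_monoid_add)"
proof (induction P rule: update_induct)
  case const
  then show ?case using s[of _ 0] by simp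
next
  case (update f a b)
  then have "Poly_Mapping.update a b f = f + Poly_Mapping.single a b"
    by (intro poly_mapping_eqI) (auto simp: lookup_update lookup_add lookup_single in_keys_iff when_def)
  then show ?case using update s a by metis
qed

lemma evl_mult [simp]: "evl f (P * Q) = evl f P * evl f Q"
proof (induction P rule: poly_mapping_add_induct)
  case (1 m r)
  show ?case
    by (induction Q rule: poly_mapping_add_induct)
      (auto simp: mult_single lookup_add power_add prod.distrib algebra_simps)
next
  case (2 P P')
  then show ?case by (simp add: algebra_simps)
qed

lemma evl_Const [simp]: "evl f (Const r) = of_real r" by (simp add: Const_def)

lemma evl_Var [simp]: "evl f (Var c) = f c"
proof -
  have "(\<Prod>d\<in>UNIV. f d ^ Poly_Mapping.lookup (Poly_Mapping.single c 1) d) = (\<Prod>d\<in>{c}. f d)"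
    by (rule prod.mono_neutral_cong_right) (auto simp: lookup_single when_def)
  then show ?thesis by (simp add: Var_def)
qed

lemma evl_uminus [simp]: "evl f (- P) = - evl f P"
  using evl_add[of f P "- P"] by (simp add: add_eq_0_iff)

lemma evl_diff [simp]: "evl f (P - Q) = evl f P - evl f Q"
  using evl_add[of f "P - Q" Q] by simp

lemma evl_power [simp]: "evl f (P ^ n) = evl f P ^ n" by (induction n) auto

lemma evl_sum [simp]: "evl f (sum P I) = (\<Sum>i\<in>I. evl f (P i))"
  by (induction I rule: infinite_finite_induct) auto

lemma evl_prod [simp]: "evl f (prod P I) = (\<Prod>i\<in>I. evl f (P i))"
  by (induction I rule: infinite_finite_induct) auto

lemma evl_numeral [simp]: "evl f (numeral n) = numeral n"
proof -
  have "evl f (of_nat k) = of_nat k" for k by (induction k) auto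
  from this[of "numeral n"] show ?thesis by simp
qed

lemma evl_of_real: "evl (\<lambda>c. of_real (f c)) P = of_real (evl f P)"
  by (simp add: evl_def)

lemma Const_0 [simp]: "Const 0 = 0" and Const_1 [simp]: "Const 1 = 1"
  and Const_add: "Const (r + s) = Const r + Const s" and Const_mult: "Const (r * s) = Const r * Const s"
  by (auto simp: Const_def single_add mult_single)

text \<open>A property stable under sums and products need only be checked on constants and
  coordinates; \<open>evl_line\<close>, \<open>TT_evl\<close> and \<open>HF_ev\<close> rest on
  this.\<close>

lemma real_poly_induct [case_names const var add mult]:
  assumes c: "\<And>r. Q (Const r)" and v: "\<And>c. Q (Var c)"
    and a: "\<And>P P'. Q P \<Longrightarrow> Q P' \<Longrightarrow> Q (P + P')" and m: "\<And>P P'. Q P \<Longrightarrow> Q P' \<Longrightarrow> Q (P * P')"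
  shows "Q P"
proof (induction P rule: poly_mapping_add_induct)
  case (1 k r)
  have "Q (Poly_Mapping.single k 1)"
  proof (induction k rule: poly_mapping_add_induct)
    case (1 c n)
    show ?case
    proof (induction n)
      case 0
      then show ?case using c[of 1] by simp
    next
      case (Suc n)
      have "Poly_Mapping.single (Poly_Mapping.single c (Suc n)) (1::real) =
        Poly_Mapping.single (Poly_Mapping.single c n) 1 * Var c"
        by (simp add: Var_def mult_single flip: single_add)
      then show ?case using Suc v m by metis
    qed
  next
    case (2 k k')
    have "Poly_Mapping.single (k + k') (1::real) = Poly_Mapping.single k 1 * Poly_Mapping.single k' 1"
      by (simp add: mult_single)
    then show ?case using 2 m by metis
  qed
  moreover have "Poly_Mapping.single k r = Const r * Poly_Mapping.single k 1"
    by (simp add: Const_def mult_single)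
  ultimately show ?case using c m by metis
next
  case (2 P P')
  then show ?case using a by blast
qed

lemma restrict_UNIV [simp]: "restrict f UNIV = f"
  by (simp add: restrict_def)

text \<open>Induction on the variables. Freezing all of them but \<open>w\<close> leaves a real
  polynomial in one variable that vanishes everywhere, so its coefficients vanish, and these are
  sums of the same shape over \<open>V\<close>. Only exponents on \<open>V\<close> are visible,
  hence the injectivity of restriction.\<close>

lemma monomials_independent:
  fixes a :: "('v \<Rightarrow> nat) \<Rightarrow> real"
  assumes "finite V" "finite M" "inj_on (\<lambda>m. restrict m V) M"
    and "\<And>x. (\<Sum>m\<in>M. a m * (\<Prod>v\<in>V. x v ^ m v)) = 0" and "m \<in> M"
  shows "a m = 0"
  using assms
proof (induction V arbitrary: M m rule: finite_induct)
  case empty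
  then have "M = {m}" by (auto simp: inj_on_def)
  then show ?case using empty by simp
next
  case (insert w V)
  define N where "N = (\<Sum>m\<in>M. m w)"
  have N: "m w \<le> N" if "m \<in> M" for m
    unfolding N_def by (rule member_le_sum) (use that insert in auto)
  define k where "k = m w"
  define M' where "M' = {m \<in> M. m w = k}"
  have "(\<Sum>m\<in>M'. a m * (\<Prod>v\<in>V. x v ^ m v)) = 0" for x
  proof -
    define C where "C j = (\<Sum>m\<in>{m\<in>M. m w = j}. a m * (\<Prod>v\<in>V. x v ^ m v))" for j
    have "(\<Sum>j\<le>N. C j * t ^ j) = 0" for t
    proof -
      define y where "y = x(w := t)"
      have y: "(\<Prod>v\<in>insert w V. y v ^ m v) = t ^ m w * (\<Prod>v\<in>V. x v ^ m v)" for m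
      proof -
        have "(\<Prod>v\<in>V. y v ^ m v) = (\<Prod>v\<in>V. x v ^ m v)"
          by (rule prod.cong) (use insert in \<open>auto simp: y_def\<close>)
        then show ?thesis using insert by (simp add: y_def)
      qed
      have "(\<Sum>j\<le>N. C j * t ^ j) = (\<Sum>j\<le>N. \<Sum>m\<in>{m\<in>M. m w = j}. a m * (\<Prod>v\<in>insert w V. y v ^ m v))"
        unfolding C_def sum_distrib_right y by (intro sum.cong) auto
      also have "\<dots> = (\<Sum>m\<in>M. a m * (\<Prod>v\<in>insert w V. y v ^ m v))"
        by (rule sum.group) (use N insert in auto)
      finally show ?thesis using insert by simp
    qed
    then have "C k = 0" using polyfun_eq_0[of C N] N insert.prems by (auto simp: k_def)
    then show ?thesis by (simp add: C_def M'_def)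
  qed
  moreover have "inj_on (\<lambda>m. restrict m V) M'"
  proof (rule inj_onI)
    fix m m' assume mm: "m \<in> M'" "m' \<in> M'" "restrict m V = restrict m' V"
    have "m v = m' v" if "v \<in> V" for v
      using fun_cong[OF mm(3), of v] that by simp
    then have "restrict m (insert w V) v = restrict m' (insert w V) v" for v
      using mm by (auto simp: M'_def restrict_def)
    then have "restrict m (insert w V) = restrict m' (insert w V)" by blast
    then show "m = m'" using inj_onD[OF insert.prems(2), of m m'] mm by (auto simp: M'_def)
  qed
  moreover have "finite M'" "m \<in> M'" using insert.prems by (auto simp: M'_def k_def)
  ultimately show ?case using insert.IH[of M' m] by blast
qed

lemma real_poly_zero:
  fixes P :: real_poly
  assumes "\<And>f :: coord \<Rightarrow> real. evl f P = 0"
  shows "P = 0"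
proof (rule poly_mapping_eqI)
  fix m
  let ?L = "Poly_Mapping.lookup :: (coord \<Rightarrow>\<^sub>0 nat) \<Rightarrow> _" and ?K = "Poly_Mapping.keys P"
  \<comment> \<open>Carries the coefficients over from finitely supported exponents to plain
    functions; \<open>lookup\<close> is injective.\<close>
  define a where "a n = Poly_Mapping.lookup P (THE m. ?L m = n)" for n
  have a: "a (?L m) = Poly_Mapping.lookup P m" for m
    by (simp add: a_def poly_mapping.lookup_inject)
  have "a n = 0" if "n \<in> ?L ` ?K" for n
  proof (rule monomials_independent[of UNIV "?L ` ?K"])
    show "(\<Sum>m\<in>?L ` ?K. a m * (\<Prod>v\<in>UNIV. x v ^ m v)) = 0" for x
      using assms[of x]
      by (simp add: evl_def sum.reindex inj_on_def poly_mapping.lookup_inject a)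
  qed (use that in \<open>auto simp: inj_on_def restrict_UNIV\<close>)
  then show "Poly_Mapping.lookup P m = Poly_Mapping.lookup 0 m"
    using a[of m] by (cases "m \<in> ?K") (auto simp: in_keys_iff)
qed

lemma real_poly_eqI:
  assumes "\<And>f :: coord \<Rightarrow> real. evl f P = evl f Q"
  shows "P = Q"
  using real_poly_zero[of "P - Q"] assms by auto

text \<open>Reduces statements in nine variables to polynomials in one variable, along the line
  through two chosen points.\<close>

lemma evl_line: "\<exists>p. \<forall>t. evl (\<lambda>c. f c + t * (g c - f c)) P = poly p t"
proof (induction P rule: real_poly_induct)
  case (const r)
  then show ?case by (intro exI[of _ "[:of_real r:]"]) auto
next
  case (var c)
  then show ?case by (intro exI[of _ "[:f c, g c - f c:]"]) auto
next
  case (add P P')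
  then obtain p q where "\<forall>t. evl (\<lambda>c. f c + t * (g c - f c)) P = poly p t"
    "\<forall>t. evl (\<lambda>c. f c + t * (g c - f c)) P' = poly q t" by auto
  then show ?case by (intro exI[of _ "p + q"]) auto
next
  case (mult P P')
  then obtain p q where "\<forall>t. evl (\<lambda>c. f c + t * (g c - f c)) P = poly p t"
    "\<forall>t. evl (\<lambda>c. f c + t * (g c - f c)) P' = poly q t" by auto
  then show ?case by (intro exI[of _ "p * q"]) auto
qed


text \<open>On the line from a point where \<open>P\<close> does not vanish to one where
  \<open>Q\<close> does not, both restrict to nonzero polynomials in one variable, seen at the
  parameters 0 and 1.\<close>

lemma real_poly_no_zero_divisors:
  fixes P Q :: real_poly
  assumes "P * Q = 0" shows "P = 0 \<or> Q = 0"
proof (rule ccontr)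
  assume "\<not> (P = 0 \<or> Q = 0)"
  then obtain f g :: "coord \<Rightarrow> real" where fg: "evl f P \<noteq> 0" "evl g Q \<noteq> 0" using real_poly_zero by metis
  obtain p q where pq: "\<And>t. evl (\<lambda>c. f c + t * (g c - f c)) P = poly p t"
    "\<And>t. evl (\<lambda>c. f c + t * (g c - f c)) Q = poly q t" using evl_line[of f g] by metis
  have "poly (p * q) t = 0" for t
    using arg_cong[OF assms, of "evl (\<lambda>c. f c + t * (g c - f c))"] pq[of t] by simp
  then have "p * q = 0" using poly_all_0_iff_0 by blast
  moreover have "poly p 0 \<noteq> 0" "poly q 1 \<noteq> 0" using pq(1)[of 0] pq(2)[of 1] fg by auto
  ultimately show False by auto
qed

lemma RX_simps [simp]: "carrier RX = UNIV" "a \<otimes>\<^bsub>RX\<^esub> b = a * b" "a \<oplus>\<^bsub>RX\<^esub> b = a + b"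
  "\<one>\<^bsub>RX\<^esub> = 1" "\<zero>\<^bsub>RX\<^esub> = 0"
  by (auto simp: ring_of_type_algebra_def)

lemma domain_RX: "domain RX"
proof (rule domain.intro)
  show "cring RX" by (rule cring_from_type_algebra)
  show "domain_axioms RX"
  proof (rule domain_axioms.intro)
    show "\<one>\<^bsub>RX\<^esub> \<noteq> \<zero>\<^bsub>RX\<^esub>" by simp
    show "a = \<zero>\<^bsub>RX\<^esub> \<or> b = \<zero>\<^bsub>RX\<^esub>" if "a \<otimes>\<^bsub>RX\<^esub> b = \<zero>\<^bsub>RX\<^esub>" for a b
      using that unfolding RX_simps by (rule real_poly_no_zero_divisors)
  qed
qed

section \<open>Prime ideals and fractions\<close>

text \<open>Krull's argument. Zorn gives an ideal \<open>p\<close> maximal among those that contain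
  \<open>I\<close> and miss \<open>M\<close>. If \<open>a\<close> and \<open>b\<close> lie outside
  \<open>p\<close>, both enlarged ideals meet \<open>M\<close>; the product of the two common
  elements is in \<open>M\<close>, and would be in \<open>p\<close> if \<open>a \<otimes> b\<close>
  were.\<close>

lemma (in cring) prime_avoidance:
  assumes I: "ideal I R" and M: "M \<subseteq> carrier R" "\<one> \<in> M"
    "\<And>a b. a \<in> M \<Longrightarrow> b \<in> M \<Longrightarrow> a \<otimes> b \<in> M" and disj: "I \<inter> M = {}"
  shows "\<exists>p. primeideal p R \<and> I \<subseteq> p \<and> p \<inter> M = {}"
proof -
  define \<A> where "\<A> = {J. ideal J R \<and> I \<subseteq> J \<and> J \<inter> M = {}}"
  have "\<exists>p\<in>\<A>. \<forall>Y\<in>\<A>. p \<subseteq> Y \<longrightarrow> Y = p"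
  proof (rule subset_Zorn_nonempty)
    show "\<A> \<noteq> {}" using I disj by (auto simp: \<A>_def)
    fix C assume C: "C \<noteq> {}" "subset.chain \<A> C"
    have "subset.chain {J. ideal J R} C"
      using C(2) unfolding pred_on.chain_def by (auto simp: \<A>_def)
    from chain_Union_is_ideal[OF this] C show "\<Union>C \<in> \<A>"
      unfolding pred_on.chain_def by (auto simp: \<A>_def)
  qed
  then obtain p where p: "p \<in> \<A>" and max: "\<And>Y. Y \<in> \<A> \<Longrightarrow> p \<subseteq> Y \<Longrightarrow> Y = p" by blast
  interpret p: ideal p R using p by (simp add: \<A>_def)
  have ex: "\<exists>x\<in>p. \<exists>r\<in>carrier R. x \<oplus> r \<otimes> a \<in> M" if a: "a \<in> carrier R" "a \<notin> p" for a
  proof -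
    have id: "ideal (p <+>\<^bsub>R\<^esub> PIdl a) R"
      using add_ideals[OF p.ideal_axioms cgenideal_ideal[OF a(1)]] .
    have mem: "y \<in> p <+>\<^bsub>R\<^esub> PIdl a \<longleftrightarrow> (\<exists>x\<in>p. \<exists>r\<in>carrier R. y = x \<oplus> r \<otimes> a)" for y
      by (auto simp: set_add_def' cgenideal_def)
    have sub: "p \<subseteq> p <+>\<^bsub>R\<^esub> PIdl a"
    proof
      fix x assume x: "x \<in> p"
      have "x = x \<oplus> \<zero> \<otimes> a" using x a p.Icarr by simp
      then show "x \<in> p <+>\<^bsub>R\<^esub> PIdl a" using x zero_closed unfolding mem by blast
    qed
    have "a = \<zero> \<oplus> \<one> \<otimes> a" using a by simp
    then have "a \<in> p <+>\<^bsub>R\<^esub> PIdl a" using p.zero_closed one_closed unfolding mem by blast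
    then have "p <+>\<^bsub>R\<^esub> PIdl a \<noteq> p" using a by metis
    then have "p <+>\<^bsub>R\<^esub> PIdl a \<notin> \<A>" using max[OF _ sub] by metis
    then have "(p <+>\<^bsub>R\<^esub> PIdl a) \<inter> M \<noteq> {}" using id sub p unfolding \<A>_def by blast
    then obtain y where "y \<in> p <+>\<^bsub>R\<^esub> PIdl a" "y \<in> M" by auto
    then show ?thesis unfolding mem by auto
  qed
  have "primeideal p R"
  proof (rule primeidealI[OF p.ideal_axioms is_cring])
    show "carrier R \<noteq> p" using p M by (auto simp: \<A>_def)
    fix a b assume ab: "a \<in> carrier R" "b \<in> carrier R" "a \<otimes> b \<in> p"
    show "a \<in> p \<or> b \<in> p"
    proof (rule ccontr)
      assume "\<not> (a \<in> p \<or> b \<in> p)"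
      then have nin: "a \<notin> p" "b \<notin> p" by auto
      obtain x r where xr: "x \<in> p" "r \<in> carrier R" "x \<oplus> r \<otimes> a \<in> M" using ex[OF ab(1) nin(1)] by auto
      obtain y s where ys: "y \<in> p" "s \<in> carrier R" "y \<oplus> s \<otimes> b \<in> M" using ex[OF ab(2) nin(2)] by auto
      note xy = xr ys
      then have c: "x \<in> carrier R" "y \<in> carrier R" using p.Icarr by auto
      have "(x \<oplus> r \<otimes> a) \<otimes> (y \<oplus> s \<otimes> b) = x \<otimes> (y \<oplus> s \<otimes> b) \<oplus> ((r \<otimes> a) \<otimes> y \<oplus> (r \<otimes> s) \<otimes> (a \<otimes> b))"
        using c xy(2,5) ab(1,2) by algebra
      also have "\<dots> \<in> p"
        by (intro p.a_closed p.I_r_closed[OF xy(1)] p.I_l_closed[OF xy(4)] p.I_l_closed[OF ab(3)]) (use xy c ab in auto)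
      finally show False using M(3)[OF xy(3,6)] p by (auto simp: \<A>_def)
    qed
  qed
  then show ?thesis using p by (auto simp: \<A>_def)
qed

lemma (in primeideal) one_notin: "\<one> \<notin> I"
proof
  assume "\<one> \<in> I"
  then have "carrier R \<subseteq> I" using I_l_closed[of \<one>] by fastforce
  then show False using I_notcarr a_subset by blast
qed

lemma (in primeideal) mult_notin:
  "a \<in> carrier R - I \<Longrightarrow> b \<in> carrier R - I \<Longrightarrow> a \<otimes> b \<in> carrier R - I"
  using I_prime by blast

lemma (in primeideal) pow_notin: "a \<in> carrier R - I \<Longrightarrow> a [^] (n::nat) \<in> carrier R - I"
  by (induction n) (use one_notin mult_notin in auto)

text \<open>A wrapper of \<open>domain\<close>, interpreted both for the polynomial ring and for the
  ring of invariant sections. In a domain the extra factor \<open>u\<close> in \<open>frac\<close>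
  cancels.\<close>

locale domain_ring = "domain" R for R :: "'a ring" (structure)
begin

lemma frac_eq:
  assumes p: "p \<in> Spec R" and "a \<in> carrier R" "s \<in> carrier R - p"
  shows "frac R p a s = {(b, t). b \<in> carrier R \<and> t \<in> carrier R - p \<and> a \<otimes> t = b \<otimes> s}"
proof -
  interpret p: primeideal p R using p by (simp add: Spec_def)
  have "a \<otimes> t = b \<otimes> s" if "u \<in> carrier R - p" "u \<otimes> (a \<otimes> t) = u \<otimes> (b \<otimes> s)"
    "b \<in> carrier R" "t \<in> carrier R" for b t u
  proof -
    have "u \<noteq> \<zero>" using that(1) p.zero_closed by blast
    then show ?thesis using m_lcancel[of u "a \<otimes> t" "b \<otimes> s"] that assms by auto
  qed
  moreover have "\<one> \<in> carrier R - p" using p.one_notin by simp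
  ultimately show ?thesis unfolding frac_def using assms by fastforce
qed

lemma frac_mem:
  assumes "p \<in> Spec R" "a \<in> carrier R" "s \<in> carrier R - p"
  shows "(a, s) \<in> frac R p a s"
  using assms by (simp add: frac_eq)

lemma notin_zero:
  assumes "p \<in> Spec R" "s \<in> carrier R - p" shows "s \<noteq> \<zero>"
proof -
  interpret p: primeideal p R using assms by (simp add: Spec_def)
  show ?thesis using assms p.zero_closed by blast
qed

lemma frac_eqI:
  assumes p: "p \<in> Spec R" and as: "a \<in> carrier R" "s \<in> carrier R - p"
    and bt: "b \<in> carrier R" "t \<in> carrier R - p" and eq: "a \<otimes> t = b \<otimes> s"
  shows "frac R p a s = frac R p b t"
proof -
  have "a \<otimes> u = c \<otimes> s \<longleftrightarrow> b \<otimes> u = c \<otimes> t" if cu: "c \<in> carrier R" "u \<in> carrier R" for c u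
  proof -
    have st: "s \<noteq> \<zero>" "t \<noteq> \<zero>" "s \<in> carrier R" "t \<in> carrier R" using as bt p notin_zero by auto
    have "a \<otimes> u = c \<otimes> s \<longleftrightarrow> t \<otimes> (a \<otimes> u) = t \<otimes> (c \<otimes> s)"
      using st as cu by (simp add: m_lcancel)
    also have "t \<otimes> (a \<otimes> u) = u \<otimes> (a \<otimes> t)" using st(3,4) as cu by algebra
    also have "\<dots> = s \<otimes> (b \<otimes> u)" unfolding eq using st(3,4) as bt cu by algebra
    also have "t \<otimes> (c \<otimes> s) = s \<otimes> (c \<otimes> t)" using st(3,4) as cu by algebra
    also have "s \<otimes> (b \<otimes> u) = s \<otimes> (c \<otimes> t) \<longleftrightarrow> b \<otimes> u = c \<otimes> t"
      using st bt cu by (simp add: m_lcancel)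
    finally show ?thesis .
  qed
  then show ?thesis using assms by (auto simp: frac_eq)
qed

lemma frac_eq_iff:
  assumes p: "p \<in> Spec R" and as: "a \<in> carrier R" "s \<in> carrier R - p"
    and bt: "b \<in> carrier R" "t \<in> carrier R - p"
  shows "frac R p a s = frac R p b t \<longleftrightarrow> a \<otimes> t = b \<otimes> s"
proof
  assume "frac R p a s = frac R p b t"
  then have "(b, t) \<in> frac R p a s" using frac_mem assms by simp
  then show "a \<otimes> t = b \<otimes> s" using assms by (simp add: frac_eq)
qed (rule frac_eqI[OF assms])

lemma frac_in_stalk:
  "a \<in> carrier R \<Longrightarrow> s \<in> carrier R - p \<Longrightarrow> frac R p a s \<in> carrier (stalk R p)"
  by (auto simp: stalk_def)

lemma stalk_elem:
  assumes "x \<in> carrier (stalk R p)"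
  obtains a s where "a \<in> carrier R" "s \<in> carrier R - p" "x = frac R p a s"
  using assms by (auto simp: stalk_def)

lemma UN_frac_const:
  assumes "p \<in> Spec R" "a \<in> carrier R" "s \<in> carrier R - p"
    and "\<And>b t. b \<in> carrier R \<Longrightarrow> t \<in> carrier R - p \<Longrightarrow> a \<otimes> t = b \<otimes> s \<Longrightarrow> F b t = C"
  shows "(\<Union>(b, t)\<in>frac R p a s. F b t) = C"
proof -
  have "(a, s) \<in> frac R p a s" using frac_mem assms by simp
  moreover have "F b t = C" if "(b, t) \<in> frac R p a s" for b t
    using that assms by (auto simp: frac_eq)
  ultimately show ?thesis by fast
qed

lemma stalk_mult:
  assumes p: "p \<in> Spec R" and as: "a \<in> carrier R" "s \<in> carrier R - p"
    and bt: "b \<in> carrier R" "t \<in> carrier R - p"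
  shows "frac R p a s \<otimes>\<^bsub>stalk R p\<^esub> frac R p b t = frac R p (a \<otimes> b) (s \<otimes> t)"
proof -
  interpret p: primeideal p R using p by (simp add: Spec_def)
  have "(\<Union>(a, s)\<in>frac R p a s. \<Union>(b, t)\<in>frac R p b t. frac R p (a \<otimes> b) (s \<otimes> t)) =
    frac R p (a \<otimes> b) (s \<otimes> t)"
  proof (intro UN_frac_const assms)
    fix a' s' b' t'
    assume h: "a' \<in> carrier R" "s' \<in> carrier R - p" "a \<otimes> s' = a' \<otimes> s"
      "b' \<in> carrier R" "t' \<in> carrier R - p" "b \<otimes> t' = b' \<otimes> t"
    have car: "a \<in> carrier R" "s \<in> carrier R" "b \<in> carrier R" "t \<in> carrier R"
        "a' \<in> carrier R" "s' \<in> carrier R" "b' \<in> carrier R" "t' \<in> carrier R"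
        using as bt h(1,2,4,5) by auto
    show "frac R p (a' \<otimes> b') (s' \<otimes> t') = frac R p (a \<otimes> b) (s \<otimes> t)"
    proof (rule frac_eqI)
      have "a' \<otimes> b' \<otimes> (s \<otimes> t) = (a' \<otimes> s) \<otimes> (b' \<otimes> t)" using car by algebra
      also have "\<dots> = (a \<otimes> s') \<otimes> (b \<otimes> t')" using h by simp
      also have "\<dots> = a \<otimes> b \<otimes> (s' \<otimes> t')" using car by algebra
      finally show "a' \<otimes> b' \<otimes> (s \<otimes> t) = a \<otimes> b \<otimes> (s' \<otimes> t')" .
    qed (use p car p.mult_notin as(2) bt(2) h(2,5) in simp_all)
  qed
  then show ?thesis by (simp add: stalk_def)
qed

lemma stalk_add:
  assumes p: "p \<in> Spec R" and as: "a \<in> carrier R" "s \<in> carrier R - p"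
    and bt: "b \<in> carrier R" "t \<in> carrier R - p"
  shows "frac R p a s \<oplus>\<^bsub>stalk R p\<^esub> frac R p b t = frac R p (a \<otimes> t \<oplus> b \<otimes> s) (s \<otimes> t)"
proof -
  interpret p: primeideal p R using p by (simp add: Spec_def)
  have "(\<Union>(a, s)\<in>frac R p a s. \<Union>(b, t)\<in>frac R p b t. frac R p (a \<otimes> t \<oplus> b \<otimes> s) (s \<otimes> t)) =
    frac R p (a \<otimes> t \<oplus> b \<otimes> s) (s \<otimes> t)"
  proof (intro UN_frac_const assms)
    fix a' s' b' t'
    assume h: "a' \<in> carrier R" "s' \<in> carrier R - p" "a \<otimes> s' = a' \<otimes> s"
      "b' \<in> carrier R" "t' \<in> carrier R - p" "b \<otimes> t' = b' \<otimes> t"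
    have car: "a \<in> carrier R" "s \<in> carrier R" "b \<in> carrier R" "t \<in> carrier R"
        "a' \<in> carrier R" "s' \<in> carrier R" "b' \<in> carrier R" "t' \<in> carrier R"
        using as bt h(1,2,4,5) by auto
    show "frac R p (a' \<otimes> t' \<oplus> b' \<otimes> s') (s' \<otimes> t') = frac R p (a \<otimes> t \<oplus> b \<otimes> s) (s \<otimes> t)"
    proof (rule frac_eqI)
      have "(a' \<otimes> t' \<oplus> b' \<otimes> s') \<otimes> (s \<otimes> t) = (a' \<otimes> s) \<otimes> (t \<otimes> t') \<oplus> (b' \<otimes> t) \<otimes> (s \<otimes> s')"
        using car by algebra
      also have "\<dots> = (a \<otimes> s') \<otimes> (t \<otimes> t') \<oplus> (b \<otimes> t') \<otimes> (s \<otimes> s')" using h by simp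
      also have "\<dots> = (a \<otimes> t \<oplus> b \<otimes> s) \<otimes> (s' \<otimes> t')" using car by algebra
      finally show "(a' \<otimes> t' \<oplus> b' \<otimes> s') \<otimes> (s \<otimes> t) = (a \<otimes> t \<oplus> b \<otimes> s) \<otimes> (s' \<otimes> t')" .
    qed (use p car p.mult_notin as(2) bt(2) h(2,5) in simp_all)
  qed
  then show ?thesis by (simp add: stalk_def)
qed

lemma stalk_one: "\<one>\<^bsub>stalk R p\<^esub> = frac R p \<one> \<one>" and stalk_zero: "\<zero>\<^bsub>stalk R p\<^esub> = frac R p \<zero> \<one>"
  by (simp_all add: stalk_def)

lemma stalk_inv:
  assumes p: "p \<in> Spec R" and as: "a \<in> carrier R - p" "s \<in> carrier R - p"
  shows "inv\<^bsub>stalk R p\<^esub> frac R p a s = frac R p s a"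
proof -
  interpret p: primeideal p R using p by (simp add: Spec_def)
  have one: "\<one> \<in> carrier R - p" using p.one_notin by simp
  show ?thesis unfolding m_inv_def
  proof (rule the_equality)
    have "frac R p (a \<otimes> s) (s \<otimes> a) = frac R p \<one> \<one>"
      by (rule frac_eqI) (use as p one p.mult_notin m_comm in auto)
    then show "frac R p s a \<in> carrier (stalk R p) \<and>
      frac R p a s \<otimes>\<^bsub>stalk R p\<^esub> frac R p s a = \<one>\<^bsub>stalk R p\<^esub> \<and>
      frac R p s a \<otimes>\<^bsub>stalk R p\<^esub> frac R p a s = \<one>\<^bsub>stalk R p\<^esub>"
      using as p by (simp add: stalk_mult stalk_one frac_in_stalk m_comm)
    fix y assume y: "y \<in> carrier (stalk R p) \<and>
      frac R p a s \<otimes>\<^bsub>stalk R p\<^esub> y = \<one>\<^bsub>stalk R p\<^esub> \<and> y \<otimes>\<^bsub>stalk R p\<^esub> frac R p a s = \<one>\<^bsub>stalk R p\<^esub>"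
    then obtain b t where bt: "b \<in> carrier R" "t \<in> carrier R - p" "y = frac R p b t"
      by (meson stalk_elem)
    have "frac R p (a \<otimes> b) (s \<otimes> t) = frac R p \<one> \<one>"
      using y bt as p by (simp add: stalk_mult stalk_one)
    then have "a \<otimes> b \<otimes> \<one> = \<one> \<otimes> (s \<otimes> t)"
      using frac_eq_iff[OF p, of "a \<otimes> b" "s \<otimes> t" \<one> \<one>] as bt one p.mult_notin by auto
    then have "b \<otimes> a = s \<otimes> t" using as bt by (simp add: m_comm)
    then show "y = frac R p s a" unfolding bt(3) by (intro frac_eqI) (use p as bt in auto)
  qed
qed

lemma stalk_max_iff:
  assumes p: "p \<in> Spec R" and as: "a \<in> carrier R" "s \<in> carrier R - p"
  shows "frac R p a s \<in> stalk_max R p \<longleftrightarrow> a \<in> p"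
proof
  interpret p: primeideal p R using p by (simp add: Spec_def)
  assume "frac R p a s \<in> stalk_max R p"
  then obtain b t where bt: "b \<in> p" "t \<in> carrier R - p" "frac R p a s = frac R p b t"
    by (auto simp: stalk_max_def)
  then have "a \<otimes> t = b \<otimes> s" using frac_eq_iff[OF p as, of b t] p.Icarr by blast
  moreover have "b \<otimes> s \<in> p" using bt as p.I_r_closed by blast
  ultimately show "a \<in> p" using p.I_prime[of a t] as bt by auto
qed (use as in \<open>auto simp: stalk_max_def\<close>)

section \<open>The generic point and sections over basic open sets\<close>

lemma zero_in_Spec: "{\<zero>} \<in> Spec R"
  using zeroprimeideal by (simp add: Spec_def)

lemma zero_in_open:
  assumes "openin (zariski R) N" "p \<in> N" shows "{\<zero>} \<in> N"
proof -
  obtain I where I: "I \<subseteq> carrier R" "N = {p \<in> Spec R. \<not> I \<subseteq> p}"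
    using assms(1) by (auto simp: openin_zariski zariski_open_def)
  interpret p: primeideal p R using assms(2) I by (simp add: Spec_def)
  show ?thesis using assms(2) I zero_in_Spec p.zero_closed by auto
qed

lemma open_subset_Spec: "openin (zariski R) N \<Longrightarrow> N \<subseteq> Spec R"
  by (auto simp: openin_zariski zariski_open_def)

lemma openin_basic: "f \<in> carrier R \<Longrightarrow> openin (zariski R) {p \<in> Spec R. f \<notin> p}"
  unfolding openin_zariski zariski_open_def by (intro exI[of _ "{f}"]) auto

lemma open_basic_subset:
  assumes "openin (zariski R) N" "p \<in> N"
  shows "\<exists>f\<in>carrier R. f \<notin> p \<and> {q \<in> Spec R. f \<notin> q} \<subseteq> N"
proof -
  obtain I where I: "I \<subseteq> carrier R" "N = {p \<in> Spec R. \<not> I \<subseteq> p}"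
    using assms(1) by (auto simp: openin_zariski zariski_open_def)
  then obtain f where "f \<in> I" "f \<notin> p" using assms by blast
  then show ?thesis using I by blast
qed

text \<open>The generic point lies in every nonempty open set, so the germ there determines the section.\<close>

lemma section_generic:
  assumes U: "U \<noteq> {}" and s: "s \<in> sections R U"
  obtains a0 f0 where "a0 \<in> carrier R" "f0 \<in> carrier R" "f0 \<noteq> \<zero>"
    "\<And>p. p \<in> U \<Longrightarrow> \<exists>N. openin (zariski R) N \<and> p \<in> N \<and> N \<subseteq> U \<and>
      (\<exists>a\<in>carrier R. \<exists>f\<in>carrier R. a \<otimes> f0 = a0 \<otimes> f \<and> (\<forall>q\<in>N. f \<notin> q \<and> s q = frac R q a f))"
proof -
  have loc: "\<exists>N. openin (zariski R) N \<and> p \<in> N \<and> N \<subseteq> U \<and>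
         (\<exists>a\<in>carrier R. \<exists>f\<in>carrier R. \<forall>q\<in>N. f \<notin> q \<and> s q = frac R q a f)" if "p \<in> U" for p
    using s that by (auto simp: sections_def)
  obtain p0 where "p0 \<in> U" using U by blast
  from loc[OF this] obtain N0 a0 f0 where 0: "openin (zariski R) N0" "p0 \<in> N0"
    "a0 \<in> carrier R" "f0 \<in> carrier R" "\<forall>q\<in>N0. f0 \<notin> q \<and> s q = frac R q a0 f0" by blast
  have z0: "{\<zero>} \<in> N0" using zero_in_open 0 by blast
  then have f0: "f0 \<noteq> \<zero>" "s {\<zero>} = frac R {\<zero>} a0 f0" using bspec[OF 0(5) z0] by simp_all
  show thesis
  proof (rule that[OF 0(3,4) f0(1)])
    fix p assume "p \<in> U"
    from loc[OF this] obtain N a f where N: "openin (zariski R) N" "p \<in> N" "N \<subseteq> U"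
      "a \<in> carrier R" "f \<in> carrier R" "\<forall>q\<in>N. f \<notin> q \<and> s q = frac R q a f" by blast
    have z: "{\<zero>} \<in> N" using zero_in_open N by blast
    have "frac R {\<zero>} a f = frac R {\<zero>} a0 f0" using f0 bspec[OF N(6) z] by simp
    then have eq: "a \<otimes> f0 = a0 \<otimes> f"
      using frac_eq_iff[OF zero_in_Spec N(4) _ 0(3), of f f0] N(5) bspec[OF N(6) z] 0(4) f0(1) by simp
    show "\<exists>N. openin (zariski R) N \<and> p \<in> N \<and> N \<subseteq> U \<and>
      (\<exists>a\<in>carrier R. \<exists>f\<in>carrier R. a \<otimes> f0 = a0 \<otimes> f \<and> (\<forall>q\<in>N. f \<notin> q \<and> s q = frac R q a f))"
      by (intro exI[of _ N] conjI N bexI[of _ a] bexI[of _ f] eq)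
  qed
qed

text \<open>Let \<open>J\<close> be the ideal of denominators of the germ at the generic point. The
  local representation at a prime avoiding \<open>g\<close> provides an element of \<open>J\<close>
  outside that prime, so some power of \<open>g\<close> lies in \<open>J\<close>. This power is a
  denominator valid on the whole basic open set.\<close>

lemma section_on_basic:
  assumes U: "openin (zariski R) U" and s: "s \<in> sections R U" and g: "g \<in> carrier R"
    and sub: "{p \<in> Spec R. g \<notin> p} \<subseteq> U"
  obtains a n where "a \<in> carrier R" "\<And>p. p \<in> U \<Longrightarrow> g \<notin> p \<Longrightarrow> s p = frac R p a (g [^] (n::nat))"
proof (cases "U = {}")
  case True
  then show thesis using that[of \<zero> 0] by auto
next
  case False
  obtain a0 f0 where gen: "a0 \<in> carrier R" "f0 \<in> carrier R" "f0 \<noteq> \<zero>"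
    "\<And>p. p \<in> U \<Longrightarrow> \<exists>N. openin (zariski R) N \<and> p \<in> N \<and> N \<subseteq> U \<and>
      (\<exists>a\<in>carrier R. \<exists>f\<in>carrier R. a \<otimes> f0 = a0 \<otimes> f \<and> (\<forall>q\<in>N. f \<notin> q \<and> s q = frac R q a f))"
    using section_generic[OF False s] by metis
  define J where "J = {f \<in> carrier R. \<exists>a\<in>carrier R. a \<otimes> f0 = a0 \<otimes> f}"
  have J: "ideal J R"
  proof (rule idealI[OF ring_axioms])
    show "subgroup J (add_monoid R)"
    proof (rule add.subgroupI)
      show "J \<subseteq> carrier R" by (auto simp: J_def)
      have "\<zero> \<in> J" using gen by (auto simp: J_def intro!: bexI[of _ \<zero>])
      then show "J \<noteq> {}" by blast
      fix f assume "f \<in> J"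
      then obtain a where a: "a \<in> carrier R" "f \<in> carrier R" "a \<otimes> f0 = a0 \<otimes> f" by (auto simp: J_def)
      then have "(\<ominus> a) \<otimes> f0 = a0 \<otimes> (\<ominus> f)" using gen by (simp add: l_minus r_minus)
      then show "\<ominus> f \<in> J" using a unfolding J_def by blast
      fix f' assume "f' \<in> J"
      then obtain a' where a': "a' \<in> carrier R" "f' \<in> carrier R" "a' \<otimes> f0 = a0 \<otimes> f'" by (auto simp: J_def)
      then have "(a \<oplus> a') \<otimes> f0 = a0 \<otimes> (f \<oplus> f')" using a gen by (simp add: l_distr r_distr)
      then show "f \<oplus> f' \<in> J" using a a' unfolding J_def by blast
    qed
    fix f x assume fx: "f \<in> J" "x \<in> carrier R"
    then obtain a where a: "a \<in> carrier R" "f \<in> carrier R" "a \<otimes> f0 = a0 \<otimes> f" by (auto simp: J_def)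
    have "(x \<otimes> a) \<otimes> f0 = x \<otimes> (a0 \<otimes> f)" using a gen fx by (simp add: m_assoc)
    also have "\<dots> = a0 \<otimes> (x \<otimes> f)" using a gen fx by (simp add: m_lcomm)
    finally show "x \<otimes> f \<in> J" using a fx unfolding J_def by blast
    then show "f \<otimes> x \<in> J" using a fx by (simp add: m_comm)
  qed
  have "\<exists>n::nat. g [^] n \<in> J"
  proof (rule ccontr)
    assume no: "\<nexists>n::nat. g [^] n \<in> J"
    define M where "M = range (\<lambda>n::nat. g [^] n)"
    have "\<exists>p. primeideal p R \<and> J \<subseteq> p \<and> p \<inter> M = {}"
    proof (rule prime_avoidance[OF J])
      show "M \<subseteq> carrier R" using g by (auto simp: M_def)
      show "\<one> \<in> M" unfolding M_def by (rule range_eqI[of _ _ 0]) simp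
      show "a \<otimes> b \<in> M" if "a \<in> M" "b \<in> M" for a b
        using that g by (auto simp: M_def nat_pow_mult)
      show "J \<inter> M = {}" using no by (auto simp: M_def)
    qed
    then obtain p where p: "primeideal p R" "J \<subseteq> p" "p \<inter> M = {}" by blast
    have "g \<in> M" unfolding M_def by (rule range_eqI[of _ _ 1]) (use g in simp)
    then have "g \<notin> p" using p by blast
    then have "p \<in> U" using sub p by (auto simp: Spec_def)
    then obtain f where "f \<in> J" "f \<notin> p" using gen(4)[of p] unfolding J_def by blast
    then show False using p by blast
  qed
  then obtain n :: nat and a where a: "a \<in> carrier R" "a \<otimes> f0 = a0 \<otimes> g [^] n" by (auto simp: J_def)
  have "s p = frac R p a (g [^] n)" if p: "p \<in> U" "g \<notin> p" for p
  proof -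
    have Sp: "p \<in> Spec R" using p open_subset_Spec[OF U] by blast
    interpret p: primeideal p R using Sp by (simp add: Spec_def)
    obtain b f where b: "b \<in> carrier R" "f \<in> carrier R" "b \<otimes> f0 = a0 \<otimes> f" "f \<notin> p" "s p = frac R p b f"
      using gen(4)[OF p(1)] by blast
    have "f0 \<otimes> (b \<otimes> g [^] n) = (b \<otimes> f0) \<otimes> g [^] n" using gen(1,2) b(1,2) g nat_pow_closed[OF g, of n] by algebra
    also have "\<dots> = (a0 \<otimes> g [^] n) \<otimes> f" unfolding b(3) using gen(1,2) b(1,2) nat_pow_closed[OF g, of n] by algebra
    also have "\<dots> = f0 \<otimes> (a \<otimes> f)" unfolding a(2)[symmetric] using gen(1,2) b(1,2) a(1) by algebra
    finally have "b \<otimes> g [^] n = a \<otimes> f" using gen b a g m_lcancel[of f0] by auto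
    then show ?thesis unfolding b(5) by (intro frac_eqI Sp) (use b a g p p.pow_notin in auto)
  qed
  then show thesis using that a by blast
qed

lemma frac_section_in_sections:
  assumes "openin (zariski R) U" "a \<in> carrier R" "f \<in> carrier R" "\<And>p. p \<in> U \<Longrightarrow> f \<notin> p"
  shows "frac_section R U a f \<in> sections R U"
  unfolding sections_def frac_section_def
proof (intro CollectI conjI ballI)
  show "(\<lambda>p\<in>U. frac R p a f) \<in> (\<Pi>\<^sub>E p\<in>U. carrier (stalk R p))"
    using assms frac_in_stalk by auto
  fix p assume "p \<in> U"
  then show "\<exists>N. openin (zariski R) N \<and> p \<in> N \<and> N \<subseteq> U \<and>
    (\<exists>a'\<in>carrier R. \<exists>f'\<in>carrier R. \<forall>q\<in>N. f' \<notin> q \<and> (\<lambda>p\<in>U. frac R p a f) q = frac R q a' f')"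
    using assms by (intro exI[of _ U] conjI bexI[of _ a] bexI[of _ f]) auto
qed

end

unbundle no Formal_Power_Series.fps_syntax

section \<open>Symmetric matrices of size three\<close>

text \<open>The bilinear form also over the complex numbers, without conjugation, because the group
  is complex orthogonal. Nonzero isotropic vectors therefore exist.\<close>

definition dotp :: "'a::comm_ring_1^'n \<Rightarrow> 'a^'n \<Rightarrow> 'a"
  where "dotp u v = (\<Sum>i\<in>UNIV. u $ i * v $ i)"

definition diag :: "'a::zero^'n \<Rightarrow> 'a^'n^'n"
  where "diag l = (\<chi> i j. if i = j then l $ i else 0)"

primrec mpow :: "'a::semiring_1^'n^'n \<Rightarrow> nat \<Rightarrow> 'a^'n^'n" where
  "mpow A 0 = mat 1"
| "mpow A (Suc n) = A ** mpow A n"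

lemma dotp_matrix: "dotp (A *v u) v = dotp u (transpose A *v v)"
proof -
  have "dotp (A *v u) v = (\<Sum>i\<in>UNIV. \<Sum>j\<in>UNIV. A $ i $ j * u $ j * v $ i)"
    by (simp add: dotp_def matrix_vector_mult_def sum_distrib_right)
  also have "\<dots> = (\<Sum>j\<in>UNIV. \<Sum>i\<in>UNIV. A $ i $ j * u $ j * v $ i)" by (rule sum.swap)
  also have "\<dots> = dotp u (transpose A *v v)"
    by (simp add: dotp_def matrix_vector_mult_def transpose_def sum_distrib_left mult_ac)
  finally show ?thesis .
qed

lemma dotp_smult: "dotp (c *s u) v = c * dotp u v" "dotp u (c *s v) = c * dotp u v"
  by (simp_all add: dotp_def sum_distrib_left mult.assoc mult.left_commute)

lemma mult_diag: "(A ** diag l) $ i $ j = A $ i $ j * (l $ j :: 'a::comm_ring_1)"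
proof -
  have "(\<Sum>k\<in>UNIV. A $ i $ k * (if k = j then l $ k else 0)) = (\<Sum>k\<in>{j}. A $ i $ k * l $ k)"
    by (rule sum.mono_neutral_cong_right) auto
  then show ?thesis by (simp add: matrix_matrix_mult_def diag_def)
qed

lemma diag_mult: "(diag l ** A) $ i $ j = (l $ i :: 'a::comm_ring_1) * A $ i $ j"
proof -
  have "(\<Sum>k\<in>UNIV. (if i = k then l $ i else 0) * A $ k $ j) = (\<Sum>k\<in>{i}. l $ i * A $ k $ j)"
    by (rule sum.mono_neutral_cong_right) auto
  then show ?thesis by (simp add: matrix_matrix_mult_def diag_def)
qed

lemma conj_diag: "(g ** diag l ** transpose g) $ i $ j =
  (\<Sum>k\<in>UNIV. g $ i $ k * g $ j $ k * (l $ k :: 'a::comm_ring_1))"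
proof -
  have "(g ** diag l ** transpose g) $ i $ j = (\<Sum>k\<in>UNIV. (g ** diag l) $ i $ k * g $ j $ k)"
    by (simp add: matrix_matrix_mult_def transpose_def)
  then show ?thesis by (simp add: mult_diag mult_ac)
qed

lemma mpow_diag: "mpow (diag l) n = diag (\<chi> i. (l $ i :: 'a::comm_ring_1) ^ n)"
proof (induction n)
  case 0
  then show ?case by (simp add: vec_eq_iff diag_def mat_def)
next
  case (Suc n)
  then show ?case by (simp add: vec_eq_iff diag_mult) (simp add: diag_def)
qed

lemma mpow_conj:
  assumes g: "transpose g ** g = (mat 1 :: 'a::comm_ring_1^'n^'n)" "g ** transpose g = mat 1"
  shows "mpow (g ** A ** transpose g) n = g ** mpow A n ** transpose g"
proof (induction n)
  case 0
  then show ?case using g by simp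
next
  case (Suc n)
  have "mpow (g ** A ** transpose g) (Suc n) = g ** A ** (transpose g ** g) ** mpow A n ** transpose g"
    using Suc by (simp add: matrix_mul_assoc)
  then show ?case using g by (simp add: matrix_mul_assoc)
qed

lemma trace_conj:
  assumes g: "transpose g ** g = (mat 1 :: 'a::comm_ring_1^'n^'n)"
  shows "trace (g ** A ** transpose g) = trace A"
proof -
  have "trace (g ** A ** transpose g) = trace (transpose g ** (g ** A))" by (rule trace_mul_sym)
  then show ?thesis using g by (simp add: matrix_mul_assoc)
qed

section \<open>Characteristic polynomial and discriminant in size three\<close>

definition minors :: "'a::comm_ring_1^3^3 \<Rightarrow> 'a"
  where "minors A = A $ 1 $ 1 * A $ 2 $ 2 - A $ 1 $ 2 * A $ 2 $ 1 + A $ 1 $ 1 * A $ 3 $ 3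
    - A $ 1 $ 3 * A $ 3 $ 1 + A $ 2 $ 2 * A $ 3 $ 3 - A $ 2 $ 3 * A $ 3 $ 2"

text \<open>The discriminant of \<open>T^3 - a T^2 + b T - c\<close>: the arguments are the
  elementary symmetric functions of the roots.\<close>

definition disc3 :: "'a::comm_ring_1 \<Rightarrow> 'a \<Rightarrow> 'a \<Rightarrow> 'a"
  where "disc3 a b c = a^2 * b^2 - 4 * b^3 - 4 * a^3 * c - 27 * c^2 + 18 * a * b * c"

lemma trace_3: "trace (A :: 'a::comm_ring_1^3^3) = A $ 1 $ 1 + A $ 2 $ 2 + A $ 3 $ 3"
  by (simp add: trace_def sum_3)

lemma charpoly_3: "charpoly A = [:- det A, minors A, - trace A, (1 :: 'a::comm_ring_1):]"
  by (simp add: charpoly_def det_3 minors_def trace_3 algebra_simps)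

lemma cubic_discriminant_charpoly:
  "cubic_discriminant (charpoly A) = disc3 (trace A) (minors A) (det (A :: 'a::comm_ring_1^3^3))"
  by (simp add: charpoly_3 cubic_discriminant_def disc3_def Let_def numeral_2_eq_2 power3_eq_cube
      algebra_simps power2_eq_square)

text \<open>Newton's identities, here and in \<open>det_trace\<close>, put the discriminant into the
  algebra generated by the traces of powers.\<close>

lemma minors_trace: "2 * minors A = trace A ^ 2 - trace (mpow (A :: 'a::comm_ring_1^3^3) 2)"
  by (simp add: minors_def trace_3 numeral_2_eq_2 matrix_matrix_mult_def sum_3 mat_def algebra_simps)

lemma det_trace: "6 * det A = trace A ^ 3 - 3 * trace A * trace (mpow A 2) +
   2 * trace (mpow (A :: 'a::comm_ring_1^3^3) 3)"
  by (simp add: det_3 trace_3 numeral_2_eq_2 numeral_3_eq_3 matrix_matrix_mult_def sum_3 mat_def algebra_simps)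

lemma det_charmat: "det (mat t - A) = t ^ 3 - trace A * t ^ 2 + minors A * t - det (A :: 'a::comm_ring_1^3^3)"
  by (simp add: det_3 trace_3 minors_def mat_def algebra_simps power2_eq_square power3_eq_cube)

lemma disc3_roots:
  "disc3 (x + y + z) (x * y + y * z + z * x) (x * y * z) =
    ((x - y) * (y - z) * (z - (x :: 'a::comm_ring_1))) ^ 2"
  unfolding disc3_def by (simp add: algebra_simps power2_eq_square power3_eq_cube)

section \<open>Diagonalization by rotations\<close>

lemma eigenvector_iff:
  fixes A :: "'a::field^'n^'n"
  shows "(\<exists>w. w \<noteq> 0 \<and> A *v w = c *s w) \<longleftrightarrow> det (mat c - A) = 0"
proof -
  have "mat c *v w = c *s w" for w :: "'a^'n"
  proof -
    have "(\<Sum>j\<in>UNIV. (if i = j then c else 0) * w $ j) = (\<Sum>j\<in>{i}. c * w $ j)" for i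
      by (rule sum.mono_neutral_cong_right) auto
    then show ?thesis by (simp add: vec_eq_iff matrix_vector_mult_def mat_def)
  qed
  then have "(mat c - A) *v w = 0 \<longleftrightarrow> A *v w = c *s w" for w
    by (auto simp: matrix_vector_mult_diff_rdistrib)
  then have "(\<exists>w. w \<noteq> 0 \<and> A *v w = c *s w) \<longleftrightarrow> \<not> (\<exists>B. B ** (mat c - A) = mat 1)"
    unfolding matrix_left_invertible_ker by blast
  also have "(\<exists>B. B ** (mat c - A) = mat 1) \<longleftrightarrow> invertible (mat c - A)"
    unfolding invertible_def by (metis matrix_left_right_inverse)
  finally show ?thesis by (simp add: invertible_det_nz)
qed

text \<open>Factor \<open>T^3 - a T^2 + b T - c\<close> over the complex numbers and compare
  coefficients. Besides producing eigenvalues, this realises prescribed traces in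
  \<open>points_exist\<close>.\<close>

lemma cubic_roots:
  obtains x y z :: complex where "x + y + z = a" "x * y + y * z + z * x = b" "x * y * z = c"
proof -
  let ?p = "[:- c, b, - a, 1:]"
  have "\<exists>M. size M = Polynomial.degree ?p \<and>
    ?p = Polynomial.smult (Polynomial.coeff ?p (Polynomial.degree ?p)) (\<Prod>x\<in>#M. [:-x, 1:])"
    by (rule alg_closed_imp_factorization) simp
  then obtain M where M: "size M = 3" "?p = (\<Prod>x\<in>#M. [:-x, 1:])" by (auto simp: numeral_3_eq_3)
  obtain x N where x: "M = add_mset x N" using M(1) size_eq_Suc_imp_eq_union[of M 2] by auto
  obtain y K where y: "N = add_mset y K" using M(1) x size_eq_Suc_imp_eq_union[of N 1] by auto
  obtain z L where z: "K = add_mset z L" using M(1) x y size_eq_Suc_imp_eq_union[of K 0] by auto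
  have "L = {#}" using M(1) x y z by simp
  then have "?p = [:-x, 1:] * ([:-y, 1:] * [:-z, 1:])" using M(2) x y z by simp
  also have "\<dots> = [:- (x * y * z), x * y + y * z + z * x, - (x + y + z), 1:]"
    by (simp add: algebra_simps)
  finally show thesis using that[of x y z] by (metis neg_equal_iff_equal pCons_eq_iff)
qed

text \<open>Eigenvectors for distinct eigenvalues are orthogonal and independent. The remaining task
  is to scale each to length one, which needs a square root of \<open>dotp (w i) (w i)\<close>:
  available over the complex numbers always, over the reals by positivity.\<close>

lemma diagonalize_eigenvectors:
  fixes A :: "'a::real_field^3^3"
  assumes sym: "transpose A = A" and dist: "l $ 1 \<noteq> l $ 2" "l $ 2 \<noteq> l $ 3" "l $ 3 \<noteq> l $ 1"
    and w: "\<And>i. w i \<noteq> 0" "\<And>i. A *v w i = l $ i *s w i"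
    and sq: "\<And>i. \<exists>r. r * r = dotp (w i) (w i)"
  shows "\<exists>g. rotation_matrix g \<and> A = g ** diag l ** transpose g"
proof -
  have dist': "l $ i \<noteq> l $ j" if "i \<noteq> j" for i j
    using dist that exhaust_3[of i] exhaust_3[of j] by auto
  have orth: "dotp (w i) (w j) = 0" if "i \<noteq> j" for i j
  proof -
    have "l $ i * dotp (w i) (w j) = dotp (A *v w i) (w j)" by (simp add: w dotp_smult)
    also have "\<dots> = l $ j * dotp (w i) (w j)" by (subst dotp_matrix) (simp add: sym w dotp_smult)
    finally show ?thesis using dist'[OF that] by simp
  qed
  define P where "P = (\<chi> k i. w i $ k)"
  have AP: "A ** P = P ** diag l"
  proof -
    have "(A ** P) $ k $ i = (A *v w i) $ k" for k i
      by (simp add: P_def matrix_matrix_mult_def matrix_vector_mult_def)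
    then show ?thesis by (simp add: w(2) vec_eq_iff mult_diag P_def)
  qed
  \<comment> \<open>Applying \<open>A\<close> twice to a linear relation between eigenvectors gives
    three relations with Vandermonde coefficients, which force each term to vanish.\<close>
  have ker: "c = 0" if c: "P *v c = 0" for c
  proof -
    have c1: "P *v (diag l *v c) = 0"
      using arg_cong[OF c, of "\<lambda>v. A *v v"] by (simp add: matrix_vector_mul_assoc matrix_mul_assoc AP)
    have c2: "P *v (diag l *v (diag l *v c)) = 0"
      using arg_cong[OF c1, of "\<lambda>v. A *v v"] by (simp add: matrix_vector_mul_assoc matrix_mul_assoc AP)
    have d: "(diag l *v v) $ i = l $ i * v $ i" for v i
    proof -
      have "(\<Sum>j\<in>UNIV. (if i = j then l $ i else 0) * v $ j) = (\<Sum>j\<in>{i}. l $ i * v $ j)"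
        by (rule sum.mono_neutral_cong_right) auto
      then show ?thesis by (simp add: matrix_vector_mult_def diag_def)
    qed
    have Pv: "(P *v v) $ k = w 1 $ k * v $ 1 + w 2 $ k * v $ 2 + w 3 $ k * v $ 3" for v k
      by (simp add: matrix_vector_mult_def P_def sum_3)
    have e: "w 1 $ k * c $ 1 + w 2 $ k * c $ 2 + w 3 $ k * c $ 3 = 0"
      "w 1 $ k * (l $ 1 * c $ 1) + w 2 $ k * (l $ 2 * c $ 2) + w 3 $ k * (l $ 3 * c $ 3) = 0"
      "w 1 $ k * (l $ 1 * (l $ 1 * c $ 1)) + w 2 $ k * (l $ 2 * (l $ 2 * c $ 2)) +
        w 3 $ k * (l $ 3 * (l $ 3 * c $ 3)) = 0" for k
      using arg_cong[OF c, of "\<lambda>v. v $ k"] arg_cong[OF c1, of "\<lambda>v. v $ k"]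
        arg_cong[OF c2, of "\<lambda>v. v $ k"] by (simp_all add: Pv d)
    have "w 1 $ k * c $ 1 = 0" "w 2 $ k * c $ 2 = 0" "w 3 $ k * c $ 3 = 0" for k
    proof -
      have z: "u = 0" if "u + v + t = 0" "a * u + b * v + d * t = 0"
        "a * (a * u) + b * (b * v) + d * (d * t) = 0" "a \<noteq> b" "a \<noteq> d" for u v t a b d :: 'a
      proof -
        have "(a - b) * ((a - d) * u) = (a * (a * u) + b * (b * v) + d * (d * t))
           - (b + d) * (a * u + b * v + d * t) + b * d * (u + v + t)" by (simp add: algebra_simps)
        then show ?thesis using that by simp
      qed
      note e = e[of k]
      show "w 1 $ k * c $ 1 = 0"
        by (rule z[of _ "w 2 $ k * c $ 2" "w 3 $ k * c $ 3" "l $ 1" "l $ 2" "l $ 3"])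
          (use e dist in \<open>auto simp: mult_ac\<close>)
      show "w 2 $ k * c $ 2 = 0"
        by (rule z[of _ "w 1 $ k * c $ 1" "w 3 $ k * c $ 3" "l $ 2" "l $ 1" "l $ 3"])
          (use e dist in \<open>auto simp: add_ac mult_ac\<close>)
      show "w 3 $ k * c $ 3 = 0"
        by (rule z[of _ "w 1 $ k * c $ 1" "w 2 $ k * c $ 2" "l $ 3" "l $ 1" "l $ 2"])
          (use e dist in \<open>auto simp: add_ac mult_ac\<close>)
    qed
    then have "c $ 1 = 0 \<or> w 1 = 0" "c $ 2 = 0 \<or> w 2 = 0" "c $ 3 = 0 \<or> w 3 = 0"
      by (auto simp: vec_eq_iff)
    then have "c $ 1 = 0" "c $ 2 = 0" "c $ 3 = 0" using w(1) by auto
    then show "c = 0" by (simp add: vec_eq_iff forall_3)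
  qed
  then have "\<exists>B. B ** P = mat 1" unfolding matrix_left_invertible_ker by simp
  then obtain B where "B ** P = mat 1" by auto
  then have "P ** B = mat 1" using matrix_left_right_inverse[of B P] by simp
  then have "transpose (P ** B) = mat 1" by simp
  then have B: "transpose B ** transpose P = mat 1" by (simp only: matrix_transpose_mul)
  \<comment> \<open>An isotropic eigenvector would be orthogonal to all three eigenvectors, which
    form a basis, and so would be zero.\<close>
  have nz: "dotp (w i) (w i) \<noteq> 0" for i
  proof
    assume "dotp (w i) (w i) = 0"
    then have "dotp (w j) (w i) = 0" for j using orth by (cases "i = j") auto
    then have "transpose P *v w i = 0"
      by (simp add: vec_eq_iff matrix_vector_mult_def transpose_def P_def dotp_def)
    then have "transpose B *v (transpose P *v w i) = 0" by simp
    then have "w i = 0" unfolding matrix_vector_mul_assoc B by simp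
    then show False using w by blast
  qed
  define G where "G r = (\<chi> k i. w i $ k / r i)" for r :: "3 \<Rightarrow> 'a"
  have G: "orthogonal_matrix (G r) \<and> A = G r ** diag l ** transpose (G r)"
    if r: "\<And>i. r i * r i = dotp (w i) (w i)" for r
  proof -
    have "(transpose (G r) ** G r) $ i $ j = dotp (w i) (w j) / (r i * r j)" for i j
      by (simp add: matrix_matrix_mult_def transpose_def G_def dotp_def sum_divide_distrib)
    then have "transpose (G r) ** G r = mat 1"
      using orth nz by (auto simp: vec_eq_iff mat_def r)
    then have o: "orthogonal_matrix (G r)"
      unfolding orthogonal_matrix_def using matrix_left_right_inverse[of "transpose (G r)" "G r"] by simp
    have "A ** G r = G r ** diag l"
    proof -
      have "(A ** G r) $ k $ i = (A *v w i) $ k / r i" for k i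
        by (simp add: G_def matrix_matrix_mult_def matrix_vector_mult_def sum_divide_distrib)
      then show ?thesis by (simp add: w(2) vec_eq_iff mult_diag G_def)
    qed
    then have "A ** (G r ** transpose (G r)) = G r ** diag l ** transpose (G r)"
      by (simp add: matrix_mul_assoc)
    then show ?thesis using o by (simp add: orthogonal_matrix_def)
  qed
  obtain r where r: "\<And>i. r i * r i = dotp (w i) (w i)" using choice[of "\<lambda>i r. r * r = dotp (w i) (w i)"] sq by blast
  \<comment> \<open>Either square root may be taken; changing one of them flips one column and hence
    the sign of the determinant.\<close>
  define r' where "r' = r(1 := - r 1)"
  have r': "r' i * r' i = dotp (w i) (w i)" for i using r by (simp add: r'_def)
  have "det (G r') = - det (G r)"
    by (simp add: det_3 G_def r'_def)
  moreover have "det (G r) * det (G r) = 1"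
  proof -
    have "det (G r ** transpose (G r)) = 1" using G[OF r] by (simp add: orthogonal_matrix_def)
    then show ?thesis by (simp add: det_mul)
  qed
  then have "det (G r) = 1 \<or> det (G r) = -1" by (simp add: square_eq_1_iff)
  ultimately have "det (G r) = 1 \<or> det (G r') = 1" by auto
  then show ?thesis using G[OF r] G[of r', OF r'] unfolding rotation_matrix_def by blast
qed

lemma diagonalize_complex:
  fixes A :: "complex^3^3"
  assumes sym: "transpose A = A" and disc: "disc3 (trace A) (minors A) (det A) \<noteq> 0"
  obtains g l where "rotation_matrix g" "A = g ** diag l ** transpose g"
    "l $ 1 \<noteq> l $ 2" "l $ 2 \<noteq> l $ 3" "l $ 3 \<noteq> l $ 1"
proof -
  obtain x y z where e: "x + y + z = trace A" "x * y + y * z + z * x = minors A" "x * y * z = det A"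
    by (rule cubic_roots)
  define l :: "complex^3" where "l = vector [x, y, z]"
  have dist: "l $ 1 \<noteq> l $ 2" "l $ 2 \<noteq> l $ 3" "l $ 3 \<noteq> l $ 1"
    using disc unfolding e[symmetric] disc3_roots l_def by auto
  have "det (mat t - A) = (t - x) * (t - y) * (t - z)" for t
    unfolding det_charmat e[symmetric] by (simp add: algebra_simps power2_eq_square power3_eq_cube)
  then have "det (mat (l $ i) - A) = 0" for i using exhaust_3[of i] by (auto simp: l_def)
  then have "\<exists>w. w \<noteq> 0 \<and> A *v w = l $ i *s w" for i by (simp add: eigenvector_iff)
  then obtain w where w: "\<And>i. w i \<noteq> 0" "\<And>i. A *v w i = l $ i *s w i" by metis
  have "\<exists>r. r * r = dotp (w i) (w i)" for i
    by (metis power2_csqrt power2_eq_square)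
  from diagonalize_eigenvectors[OF sym dist w this] show thesis using that dist by blast
qed

text \<open>The characteristic roots exist over the complex numbers. For an eigenvector
  \<open>w\<close> the hermitian values of \<open>A\<close> and of the identity at \<open>w\<close>
  are real and the second is nonzero, so the root is real; then real eigenvectors exist.\<close>

lemma diagonalize_real:
  fixes A :: "real^3^3"
  assumes sym: "transpose A = A" and disc: "disc3 (trace A) (minors A) (det A) \<noteq> 0"
  obtains g l where "rotation_matrix g" "A = g ** diag l ** transpose g"
    "l $ 1 \<noteq> l $ 2" "l $ 2 \<noteq> l $ 3" "l $ 3 \<noteq> l $ 1"
proof -
  obtain x y z where e: "x + y + z = complex_of_real (trace A)"
    "x * y + y * z + z * x = complex_of_real (minors A)" "x * y * z = complex_of_real (det A)"
    by (rule cubic_roots)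
  define A' :: "complex^3^3" where "A' = (\<chi> i j. complex_of_real (A $ i $ j))"
  have A': "trace A' = complex_of_real (trace A)" "minors A' = complex_of_real (minors A)"
    "det A' = complex_of_real (det A)"
    by (simp_all add: A'_def trace_3 minors_def det_3)
  have s: "A $ i $ j = A $ j $ i" for i j 
    using arg_cong[OF sym, of "\<lambda>M. M $ j $ i"] by (simp add: transpose_def)
  have real: "t \<in> \<real>" if t: "det (mat t - A') = 0" for t
  proof -
    obtain w where w: "w \<noteq> 0" "A' *v w = t *s w" using t by (auto simp flip: eigenvector_iff)
    define N where "N = (\<Sum>i\<in>UNIV. cnj (w $ i) * w $ i)"
    have "N = complex_of_real (\<Sum>i\<in>UNIV. (cmod (w $ i))\<^sup>2)"
      unfolding N_def of_real_sum
      by (intro sum.cong refl) (simp add: complex_norm_square mult.commute flip: of_real_power)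
    moreover have "(\<Sum>i\<in>UNIV. (cmod (w $ i))\<^sup>2) \<noteq> 0"
      using w(1) by (auto simp: sum_nonneg_eq_0_iff vec_eq_iff)
    ultimately have N: "N \<noteq> 0" "cnj N = N" by (simp_all only: of_real_eq_0_iff complex_cnj_complex_of_real not_False_eq_True)
    define Q where "Q = (\<Sum>i\<in>UNIV. \<Sum>j\<in>UNIV. cnj (w $ i) * complex_of_real (A $ i $ j) * w $ j)"
    have "(\<Sum>j\<in>UNIV. complex_of_real (A $ i $ j) * w $ j) = t * w $ i" for i
      using arg_cong[OF w(2), of "\<lambda>u. u $ i"] by (simp add: A'_def matrix_vector_mult_def)
    then have "(\<Sum>j\<in>UNIV. cnj (w $ i) * complex_of_real (A $ i $ j) * w $ j) = t * (cnj (w $ i) * w $ i)" for i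
      
      unfolding mult.assoc sum_distrib_left[symmetric] by (simp only: mult.left_commute)
    then have "Q = t * N" unfolding Q_def N_def by (simp only: sum_distrib_left)
    moreover have "cnj Q = Q"
    proof -
      have "cnj Q = (\<Sum>i\<in>UNIV. \<Sum>j\<in>UNIV. w $ i * complex_of_real (A $ i $ j) * cnj (w $ j))"
        by (simp add: Q_def)
      also have "\<dots> = (\<Sum>j\<in>UNIV. \<Sum>i\<in>UNIV. w $ i * complex_of_real (A $ i $ j) * cnj (w $ j))"
        by (rule sum.swap)
      also have "\<dots> = Q" unfolding Q_def
      proof (intro sum.cong refl)
        fix i j
        have "A $ j $ i = A $ i $ j" by (rule s)
        then show "w $ j * complex_of_real (A $ j $ i) * cnj (w $ i) = cnj (w $ i) * complex_of_real (A $ i $ j) * w $ j"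
          by (simp only: mult_ac)
      qed
      finally show ?thesis .
    qed
    ultimately have "cnj t * N = t * N" using N by (metis complex_cnj_mult)
    then show ?thesis using N by (simp add: Reals_cnj_iff)
  qed
  have fac: "det (mat t - A') = (t - x) * (t - y) * (t - z)" for t
    unfolding det_charmat A' e[symmetric] by (simp add: algebra_simps power2_eq_square power3_eq_cube)
  have "x \<in> \<real>" "y \<in> \<real>" "z \<in> \<real>" by (rule real, simp add: fac)+
  then obtain x' y' z' where xyz: "x = of_real x'" "y = of_real y'" "z = of_real z'"
    unfolding Reals_def by blast
  have e': "x' + y' + z' = trace A" "x' * y' + y' * z' + z' * x' = minors A" "x' * y' * z' = det A"
    using e unfolding xyz of_real_add[symmetric] of_real_mult[symmetric] of_real_eq_iff by blast+
  define l :: "real^3" where "l = vector [x', y', z']"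
  have dist: "l $ 1 \<noteq> l $ 2" "l $ 2 \<noteq> l $ 3" "l $ 3 \<noteq> l $ 1"
    using disc unfolding e'[symmetric] disc3_roots l_def by auto
  have "det (mat t - A) = (t - x') * (t - y') * (t - z')" for t
    unfolding det_charmat e'[symmetric] by (simp add: algebra_simps power2_eq_square power3_eq_cube)
  then have "det (mat (l $ i) - A) = 0" for i using exhaust_3[of i] by (auto simp: l_def)
  then have "\<exists>w. w \<noteq> 0 \<and> A *v w = l $ i *s w" for i by (simp add: eigenvector_iff)
  then obtain w where w: "\<And>i. w i \<noteq> 0" "\<And>i. A *v w i = l $ i *s w i" by metis
  have "\<exists>r. r * r = dotp (w i) (w i)" for i
  proof -
    have "0 \<le> dotp (w i) (w i)" unfolding dotp_def by (rule sum_nonneg) simp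
    then show ?thesis by (intro exI[of _ "sqrt (dotp (w i) (w i))"]) simp
  qed
  from diagonalize_eigenvectors[OF sym dist w this] show thesis using that dist by blast
qed

section \<open>Averaging over the stabilizer of the slice\<close>

text \<open>The sign vectors with product \<open>sign \<pi>\<close>: two signs are free, the third
  is forced. With the six permutations they give the 24 signed permutation matrices of determinant
  one.\<close>

definition eps :: "real \<Rightarrow> real \<Rightarrow> (3 \<Rightarrow> 3) \<Rightarrow> 3 \<Rightarrow> real"
  where "eps a b \<pi> i = (if i = 1 then a else if i = 2 then b else of_int (sign \<pi>) * a * b)"

definition perms :: "(3 \<Rightarrow> 3) set" where "perms = {\<pi>. \<pi> permutes UNIV}"

text \<open>The plain sum over the 24 elements; the factor \<open>Const (1/24)\<close> is supplied
  where it is needed.\<close>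

definition avg :: "('y \<Rightarrow> (3 \<Rightarrow> 3) \<Rightarrow> (3 \<Rightarrow> real) \<Rightarrow> real) \<Rightarrow> 'y \<Rightarrow> real"
  where "avg t y = (\<Sum>\<pi>\<in>perms. \<Sum>a\<in>{1, -1}. \<Sum>b\<in>{1, -1}. t y \<pi> (eps a b \<pi>))"

lemma UNIV_3': "(UNIV :: 3 set) = insert 1 (insert 2 (insert 3 {}))"
  using UNIV_3 by simp

lemma prod_3: "(\<Prod>i\<in>(UNIV :: 3 set). f i) = f 1 * f 2 * (f 3 :: 'a::comm_ring_1)"
  unfolding UNIV_3' by (simp add: mult_ac)

lemma sum_perms_3:
  fixes F :: "3 \<Rightarrow> 3 \<Rightarrow> 3 \<Rightarrow> real \<Rightarrow> real"
  shows "(\<Sum>\<pi>\<in>perms. F (\<pi> 1) (\<pi> 2) (\<pi> 3) (of_int (sign \<pi>))) =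
    F 1 2 3 1 + F 1 3 2 (-1) + F 2 1 3 (-1) + F 2 3 1 1 + F 3 1 2 1 + F 3 2 1 (-1)"
proof -
  have f123: "finite {2::3, 3}" "1 \<notin> {2::3, 3}" and f23: "finite {3::3}" "2 \<notin> {3::3}" by auto
  show ?thesis unfolding perms_def UNIV_3'
    unfolding sum_over_permutations_insert[OF f123] sum_over_permutations_insert[OF f23] permutes_sing
    by (simp add: sign_swap_id sign_compose permutation_swap_id sign_id permutation_compose
        transpose_def add_ac)
qed

text \<open>\<open>K\<close> is the ring of functions on \<open>Y\<close> that descend: it has to
  contain the power sums of the eigenvalues and the inverse of the discriminant. Only values on
  \<open>Y\<close> count, by \<open>K_cong\<close>.\<close>

locale averaging_base =
  fixes Y :: "'y set" and K :: "('y \<Rightarrow> real) set" and lam :: "'y \<Rightarrow> 3 \<Rightarrow> real"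
  assumes K_const: "(\<lambda>y. r) \<in> K"
    and K_add: "f \<in> K \<Longrightarrow> g \<in> K \<Longrightarrow> (\<lambda>y. f y + g y) \<in> K"
    and K_mult: "f \<in> K \<Longrightarrow> g \<in> K \<Longrightarrow> (\<lambda>y. f y * g y) \<in> K"
    and K_cong: "f \<in> K \<Longrightarrow> (\<And>y. y \<in> Y \<Longrightarrow> g y = f y) \<Longrightarrow> g \<in> K"
    and K_pow: "(\<lambda>y. \<Sum>i\<in>UNIV. lam y i ^ n) \<in> K"
    and K_inv: "(\<lambda>y. inverse (((lam y 1 - lam y 2) * (lam y 2 - lam y 3) * (lam y 3 - lam y 1))\<^sup>2)) \<in> K"
    and distinct: "y \<in> Y \<Longrightarrow> lam y 1 \<noteq> lam y 2 \<and> lam y 2 \<noteq> lam y 3 \<and> lam y 3 \<noteq> lam y 1"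
begin

text \<open>Even functions of an eigenvalue index: polynomials in the eigenvalue with coefficients
  in \<open>K\<close>, unaffected by the sign of the eigenvector.\<close>

inductive_set EV :: "('y \<Rightarrow> 3 \<Rightarrow> real) set" where
  mon: "k \<in> K \<Longrightarrow> (\<lambda>y i. k y * lam y i ^ n) \<in> EV"
| add: "f \<in> EV \<Longrightarrow> g \<in> EV \<Longrightarrow> (\<lambda>y i. f y i + g y i) \<in> EV"
| ext: "f \<in> EV \<Longrightarrow> (\<And>y i. y \<in> Y \<Longrightarrow> g y i = f y i) \<Longrightarrow> g \<in> EV"

lemma EV_K: "k \<in> K \<Longrightarrow> (\<lambda>y i. k y) \<in> EV"
  using EV.mon[of k 0] by simp

lemma EV_const: "(\<lambda>y i. r) \<in> EV" by (rule EV_K[OF K_const])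

lemma EV_lam: "(\<lambda>y i. lam y i) \<in> EV"
  using EV.mon[OF K_const[of 1], of 1] by simp

lemma EV_mult:
  assumes "f \<in> EV" "g \<in> EV" shows "(\<lambda>y i. f y i * g y i) \<in> EV"
  using assms(1)
proof induction
  case (mon k n)
  show ?case using assms(2)
  proof induction
    case (mon l m)
    show ?case
      by (rule EV.ext[OF EV.mon[OF K_mult[OF \<open>k \<in> K\<close> mon], of "n + m"]]) (simp add: power_add)
  next
    case (add f g)
    show ?case by (rule EV.ext[OF EV.add[OF add.IH]]) (simp add: distrib_left)
  next
    case (ext f g)
    show ?case by (rule EV.ext[OF ext.IH]) (simp add: ext.hyps)
  qed
next
  case (add f f')
  show ?case by (rule EV.ext[OF EV.add[OF add.IH]]) (simp add: distrib_right)
next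
  case (ext f f')
  show ?case by (rule EV.ext[OF ext.IH]) (simp add: ext.hyps)
qed

lemma EV_diff:
  assumes "f \<in> EV" "g \<in> EV" shows "(\<lambda>y i. f y i - g y i) \<in> EV"
  by (rule EV.ext[OF EV.add[OF assms(1) EV_mult[OF EV_const[of "-1"] assms(2)]]]) simp

lemma K_sum_EV:
  assumes "f \<in> EV" shows "(\<lambda>y. \<Sum>i\<in>UNIV. f y i) \<in> K"
  using assms
proof induction
  case (mon k n)
  show ?case by (rule K_cong[OF K_mult[OF mon K_pow[of n]]]) (simp add: sum_distrib_left)
next
  case (add f g)
  show ?case by (rule K_cong[OF K_add[OF add.IH]]) (simp add: sum.distrib)
next
  case (ext f g)
  show ?case by (rule K_cong[OF ext.IH]) (simp add: ext.hyps)
qed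

lemma K_diff: "f \<in> K \<Longrightarrow> g \<in> K \<Longrightarrow> (\<lambda>y. f y - g y) \<in> K"
  by (rule K_cong[OF K_add[OF _ K_mult[OF K_const[of "-1"]]]]) auto

text \<open>Lagrange interpolation expresses \<open>f\<close> at the node \<open>\<lambda>\<^sub>i\<close> through its moments
  \<open>F\<^sub>n = \<Sum> \<lambda>\<^sub>i\<^sup>n f\<^sub>i\<close>. Since \<open>\<Delta> = \<chi>'(\<lambda>\<^sub>i)\<^sup>2 (\<lambda>\<^sub>j - \<lambda>\<^sub>k)\<^sup>2\<close>, inverting \<open>\<Delta>\<close> suffices.\<close>

lemma EV_moments:
  assumes F: "\<And>n. (\<lambda>y. \<Sum>i\<in>UNIV. lam y i ^ n * f y i) \<in> K"
  shows "f \<in> EV"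
proof -
  define D where "D y = ((lam y 1 - lam y 2) * (lam y 2 - lam y 3) * (lam y 3 - lam y 1))\<^sup>2" for y
  define p1 where "p1 y = (\<Sum>i\<in>UNIV. lam y i ^ 1)" for y
  define e2 where "e2 y = (p1 y * p1 y - (\<Sum>i\<in>UNIV. lam y i ^ 2)) * (1/2)" for y
  define F0 where "F0 y = (\<Sum>i\<in>UNIV. lam y i ^ 0 * f y i)" for y
  define F1 where "F1 y = (\<Sum>i\<in>UNIV. lam y i ^ 1 * f y i)" for y
  define F2 where "F2 y = (\<Sum>i\<in>UNIV. lam y i ^ 2 * f y i)" for y
  have p1: "p1 \<in> K" unfolding p1_def by (rule K_pow)
  have e2: "e2 \<in> K" unfolding e2_def
    by (intro K_mult K_diff K_const K_pow p1)
  have Fs: "F0 \<in> K" "F1 \<in> K" "F2 \<in> K" unfolding F0_def F1_def F2_def by (rule F)+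
  have Di: "(\<lambda>y. inverse (D y)) \<in> K" unfolding D_def by (rule K_inv)
  \<comment> \<open>With \<chi> the cubic with roots \<lambda>, this is the sum over
    \<open>j\<close> of \<open>f y j\<close> times the quotient of \<chi> by its factor at
    \<open>j\<close>, evaluated at the root of index \<open>i\<close>. Only the term
    \<open>j = i\<close> survives, so \<open>N\<close> is \<open>f y i\<close> times the derivative
    \<open>X'\<close>; \<open>d\<close> is the squared difference of the other two roots.\<close>
  define N where "N y i = F0 y * (lam y i * lam y i) - (p1 y * F0 y - F1 y) * lam y i +
     ((e2 y * F0 y - p1 y * F1 y) + F2 y)" for y i
  define X' where "X' y i = 3 * (lam y i * lam y i) - 2 * p1 y * lam y i + e2 y" for y i
  define d where "d y i = (p1 y - lam y i) * (p1 y - lam y i) - 4 * (e2 y - lam y i * (p1 y - lam y i))" for y i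
  note cl = EV.add EV_diff EV_mult EV_K EV_lam EV_const p1 e2 Fs
  have "(\<lambda>y i. inverse (D y) * (N y i * X' y i * d y i)) \<in> EV"
    unfolding N_def X'_def d_def
    by (intro cl EV_K[OF Di])
  then show ?thesis
  proof (rule EV.ext)
    fix y i assume y: "y \<in> Y"
    have e: "p1 y = lam y 1 + lam y 2 + lam y 3"
      "e2 y = lam y 1 * lam y 2 + lam y 2 * lam y 3 + lam y 3 * lam y 1"
      by (simp_all add: p1_def e2_def sum_3 algebra_simps power2_eq_square)
    have id: "N y i = f y i * X' y i \<and> X' y i * X' y i * d y i = D y"
    proof -
      obtain j k :: 3 where jk: "(i, j, k) \<in> {(1, 2, 3), (2, 3, 1), (3, 1, 2)}" using exhaust_3[of i] by auto
      define l1 l2 l3 g1 g2 g3 where l: "l1 = lam y i" "l2 = lam y j" "l3 = lam y k"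
        "g1 = f y i" "g2 = f y j" "g3 = f y k"
      have s: "p1 y = l1 + l2 + l3" "e2 y = l1 * l2 + l2 * l3 + l3 * l1"
        "F0 y = g1 + g2 + g3" "F1 y = l1 * g1 + l2 * g2 + l3 * g3"
        "F2 y = l1 * l1 * g1 + l2 * l2 * g2 + l3 * l3 * g3"
        "D y = ((l1 - l2) * (l2 - l3) * (l3 - l1))\<^sup>2"
        using jk unfolding l by (auto simp: e F0_def F1_def F2_def D_def sum_3 power2_eq_square)
      have X: "X' y i = (l1 - l2) * (l1 - l3)" and d: "d y i = (l2 - l3) * (l2 - l3)"
        unfolding X'_def d_def s l(1)[symmetric] by (simp_all add: algebra_simps)
      have "N y i = g1 * ((l1 - l2) * (l1 - l3))"
        unfolding N_def s l(1)[symmetric] by (simp add: algebra_simps)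
      then show ?thesis unfolding X d s l(4)[symmetric] by (simp add: power2_eq_square mult_ac) (simp add: algebra_simps)
    qed
    have "N y i * X' y i * d y i = f y i * (X' y i * X' y i * d y i)"
      using id by simp
    also have "\<dots> = f y i * D y" using id by simp
    finally have "N y i * X' y i * d y i = f y i * D y" .
    moreover have "D y \<noteq> 0" using distinct[OF y] by (simp add: D_def)
    ultimately show "f y i = inverse (D y) * (N y i * X' y i * d y i)" by simp
  qed
qed

text \<open>Inclusion and exclusion over coincidences of the three indices turn the permanent into
  products of sums over all indices, and those lie in \<open>K\<close> by
  \<open>K_sum_EV\<close>.\<close>

lemma permanent_in_K:
  assumes "f1 \<in> EV" "f2 \<in> EV" "f3 \<in> EV"
  shows "(\<lambda>y. \<Sum>\<pi>\<in>perms. f1 y (\<pi> 1) * f2 y (\<pi> 2) * f3 y (\<pi> 3)) \<in> K"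
proof -
  let ?S = "\<lambda>f y. \<Sum>i\<in>UNIV. f y (i :: 3) :: real"
  have S: "?S f1 \<in> K" "?S f2 \<in> K" "?S f3 \<in> K" "?S (\<lambda>y i. f1 y i * f2 y i) \<in> K"
    "?S (\<lambda>y i. f1 y i * f3 y i) \<in> K" "?S (\<lambda>y i. f2 y i * f3 y i) \<in> K"
    "?S (\<lambda>y i. f1 y i * f2 y i * f3 y i) \<in> K"
    by (intro K_sum_EV EV_mult assms)+
  have "(\<lambda>y. (?S f1 y * ?S f2 y * ?S f3 y - ?S (\<lambda>y i. f1 y i * f2 y i) y * ?S f3 y
     - ?S (\<lambda>y i. f1 y i * f3 y i) y * ?S f2 y - ?S (\<lambda>y i. f2 y i * f3 y i) y * ?S f1 y)
     + 2 * ?S (\<lambda>y i. f1 y i * f2 y i * f3 y i) y) \<in> K"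
    by (intro K_add[OF K_diff[OF K_diff[OF K_diff]]] K_mult K_const S)
  then show ?thesis
  proof (rule K_cong)
    fix y
    show "(\<Sum>\<pi>\<in>perms. f1 y (\<pi> 1) * f2 y (\<pi> 2) * f3 y (\<pi> 3)) =
      (?S f1 y * ?S f2 y * ?S f3 y - ?S (\<lambda>y i. f1 y i * f2 y i) y * ?S f3 y
     - ?S (\<lambda>y i. f1 y i * f3 y i) y * ?S f2 y - ?S (\<lambda>y i. f2 y i * f3 y i) y * ?S f1 y)
     + 2 * ?S (\<lambda>y i. f1 y i * f2 y i * f3 y i) y"
      unfolding sum_perms_3[of "\<lambda>i j k s. f1 y i * f2 y j * f3 y k"] sum_3 by (simp add: algebra_simps)
  qed
qed

end

text \<open>\<open>C\<close> holds functions that change sign with the eigenvector of index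
  \<open>i\<close>. \<open>K_two\<close> makes the product of two of them at the same index even;
  \<open>K_three\<close> covers the one product of odd functions that survives averaging over the
  signs, with one factor for each index.\<close>

locale averaging = averaging_base Y K lam
  for Y :: "'y set" and K :: "('y \<Rightarrow> real) set" and lam :: "'y \<Rightarrow> 3 \<Rightarrow> real" +
  fixes C :: "('y \<Rightarrow> 3 \<Rightarrow> real) set"
  assumes K_two: "c \<in> C \<Longrightarrow> d \<in> C \<Longrightarrow> (\<lambda>y. \<Sum>i\<in>UNIV. lam y i ^ n * (c y i * d y i)) \<in> K"
    and K_three: "c1 \<in> C \<Longrightarrow> c2 \<in> C \<Longrightarrow> c3 \<in> C \<Longrightarrow>
      (\<lambda>y. \<Sum>\<pi>\<in>perms. of_int (sign \<pi>) * (c1 y (\<pi> 1) * lam y (\<pi> 1) ^ n1) *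
        (c2 y (\<pi> 2) * lam y (\<pi> 2) ^ n2) * (c3 y (\<pi> 3) * lam y (\<pi> 3) ^ n3)) \<in> K"
begin

text \<open>The odd counterpart of \<open>EV\<close>: the module over it generated by
  \<open>C\<close>.\<close>

inductive_set OD :: "('y \<Rightarrow> 3 \<Rightarrow> real) set" where
  zero: "(\<lambda>y i. 0) \<in> OD"
| mon: "k \<in> K \<Longrightarrow> c \<in> C \<Longrightarrow> (\<lambda>y i. k y * (c y i * lam y i ^ n)) \<in> OD"
| add: "f \<in> OD \<Longrightarrow> g \<in> OD \<Longrightarrow> (\<lambda>y i. f y i + g y i) \<in> OD"
| ext: "f \<in> OD \<Longrightarrow> (\<And>y i. y \<in> Y \<Longrightarrow> g y i = f y i) \<Longrightarrow> g \<in> OD"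

lemma EV_OD:
  assumes "f \<in> EV" "g \<in> OD" shows "(\<lambda>y i. f y i * g y i) \<in> OD"
  using assms(1)
proof induction
  case (mon k n)
  show ?case using assms(2)
  proof induction
    case zero
    show ?case by (rule OD.ext[OF OD.zero]) simp
  next
    case (mon l c m)
    show ?case
      by (rule OD.ext[OF OD.mon[OF K_mult[OF \<open>k \<in> K\<close> mon(1)] mon(2), of "n + m"]]) (simp add: power_add)
  next
    case (add f g)
    show ?case by (rule OD.ext[OF OD.add[OF add.IH]]) (simp add: distrib_left)
  next
    case (ext f g)
    show ?case by (rule OD.ext[OF ext.IH]) (simp add: ext.hyps)
  qed
next
  case (add f f')
  show ?case by (rule OD.ext[OF OD.add[OF add.IH]]) (simp add: distrib_right)
next
  case (ext f f')
  show ?case by (rule OD.ext[OF ext.IH]) (simp add: ext.hyps)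
qed

text \<open>The one case that is not formal is a product of two generators: \<open>K_two\<close>
  puts its moments into \<open>K\<close>, and interpolation in \<open>EV_moments\<close> makes it
  even.\<close>

lemma OD_OD:
  assumes "f \<in> OD" "g \<in> OD" shows "(\<lambda>y i. f y i * g y i) \<in> EV"
  using assms(1)
proof induction
  case zero
  show ?case by (rule EV.ext[OF EV_const[of 0]]) simp
next
  case (mon k c n)
  show ?case using assms(2)
  proof induction
    case zero
    show ?case by (rule EV.ext[OF EV_const[of 0]]) simp
  next
    case (mon l d m)
    have "(\<lambda>y i. c y i * d y i) \<in> EV"
      by (rule EV_moments) (rule K_two[OF \<open>c \<in> C\<close> mon(2)])
    from EV_mult[OF EV.mon[OF K_mult[OF \<open>k \<in> K\<close> mon(1)], of "n + m"] this]
    show ?case by (rule EV.ext) (simp add: power_add)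
  next
    case (add f g)
    show ?case by (rule EV.ext[OF EV.add[OF add.IH]]) (simp add: distrib_left)
  next
    case (ext f g)
    show ?case by (rule EV.ext[OF ext.IH]) (simp add: ext.hyps)
  qed
next
  case (add f f')
  show ?case by (rule EV.ext[OF EV.add[OF add.IH]]) (simp add: distrib_right)
next
  case (ext f f')
  show ?case by (rule EV.ext[OF ext.IH]) (simp add: ext.hyps)
qed

lemma OD_C: "c \<in> C \<Longrightarrow> c \<in> OD"
  using OD.mon[OF K_const[of 1], of c 0] by simp

definition alt :: "('y \<Rightarrow> 3 \<Rightarrow> real) \<Rightarrow> ('y \<Rightarrow> 3 \<Rightarrow> real) \<Rightarrow> ('y \<Rightarrow> 3 \<Rightarrow> real) \<Rightarrow> 'y \<Rightarrow> real"
  where "alt f g h y = (\<Sum>\<pi>\<in>perms. of_int (sign \<pi>) * f y (\<pi> 1) * g y (\<pi> 2) * h y (\<pi> 3))"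

text \<open>Trilinearity reduces the claim to generators in all three arguments, which is
  \<open>K_three\<close>.\<close>

lemma alt_in_K:
  assumes "f1 \<in> OD" "f2 \<in> OD" "f3 \<in> OD"
  shows "alt f1 f2 f3 \<in> K"
proof -
  have alt_add: "alt (\<lambda>y i. f y i + f' y i) g h y = alt f g h y + alt f' g h y"
    "alt g (\<lambda>y i. f y i + f' y i) h y = alt g f h y + alt g f' h y"
    "alt g h (\<lambda>y i. f y i + f' y i) y = alt g h f y + alt g h f' y" for f f' g h y
    by (simp_all add: alt_def algebra_simps sum.distrib)
  have alt_zero: "alt (\<lambda>y i. 0) g h = (\<lambda>y. 0)" "alt g (\<lambda>y i. 0) h = (\<lambda>y. 0)" "alt g h (\<lambda>y i. 0) = (\<lambda>y. 0)" for g h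
    by (simp_all add: alt_def fun_eq_iff)
  show ?thesis using assms(1)
  proof induction
    case zero
    show ?case unfolding alt_zero by (rule K_const)
  next
    case (mon k1 c1 n1)
    note m1 = mon
    show ?case using assms(2)
    proof induction
      case zero
      show ?case unfolding alt_zero by (rule K_const)
    next
      case (mon k2 c2 n2)
      note m2 = mon
      show ?case using assms(3)
      proof induction
        case zero
        show ?case unfolding alt_zero by (rule K_const)
      next
        case (mon k3 c3 n3)
        show ?case
          by (rule K_cong[OF K_mult[OF K_mult[OF K_mult[OF m1(1) m2(1)] mon(1)] K_three[OF m1(2) m2(2) mon(2)]]])
            (simp add: alt_def sum_distrib_left mult_ac)
      next
        case (add f g)
        show ?case by (rule K_cong[OF K_add[OF add.IH]]) (rule alt_add)
      next
        case (ext f g)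
        show ?case by (rule K_cong[OF ext.IH]) (simp add: alt_def ext.hyps)
      qed
    next
      case (add f g)
      show ?case by (rule K_cong[OF K_add[OF add.IH]]) (rule alt_add)
    next
      case (ext f g)
      show ?case by (rule K_cong[OF ext.IH]) (simp add: alt_def ext.hyps)
    qed
  next
    case (add f g)
    show ?case by (rule K_cong[OF K_add[OF add.IH]]) (rule alt_add)
  next
    case (ext f g)
    show ?case by (rule K_cong[OF ext.IH]) (simp add: alt_def ext.hyps)
  qed
qed

text \<open>Functions of a parameter and a signed permutation, with one factor for each slot. Since
  the signs square to one, a product of two factors \<open>u + \<epsilon> w\<close> has the same
  form again, with even part \<open>u u' + w w'\<close>; this is why \<open>ext\<close> compares
  only at sign vectors.\<close>

inductive_set TT :: "('y \<Rightarrow> (3 \<Rightarrow> 3) \<Rightarrow> (3 \<Rightarrow> real) \<Rightarrow> real) set" where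
  prod: "(\<And>i. u i \<in> EV) \<Longrightarrow> (\<And>i. w i \<in> OD) \<Longrightarrow>
    (\<lambda>y \<pi> \<epsilon>. \<Prod>i\<in>UNIV. u i y (\<pi> i) + \<epsilon> i * w i y (\<pi> i)) \<in> TT"
| add: "s \<in> TT \<Longrightarrow> t \<in> TT \<Longrightarrow> (\<lambda>y \<pi> \<epsilon>. s y \<pi> \<epsilon> + t y \<pi> \<epsilon>) \<in> TT"
| ext: "s \<in> TT \<Longrightarrow> (\<And>y \<pi> \<epsilon>. y \<in> Y \<Longrightarrow> (\<And>i. \<epsilon> i * \<epsilon> i = 1) \<Longrightarrow> t y \<pi> \<epsilon> = s y \<pi> \<epsilon>) \<Longrightarrow> t \<in> TT"

lemma TT_mult:
  assumes "s \<in> TT" "t \<in> TT" shows "(\<lambda>y \<pi> \<epsilon>. s y \<pi> \<epsilon> * t y \<pi> \<epsilon>) \<in> TT"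
  using assms(1)
proof induction
  case (prod u w)
  note uw = prod
  show ?case using assms(2)
  proof induction
    case (prod u' w')
    have "(\<lambda>y \<pi> \<epsilon>. \<Prod>i\<in>UNIV. (u i y (\<pi> i) * u' i y (\<pi> i) + w i y (\<pi> i) * w' i y (\<pi> i)) +
       \<epsilon> i * (u i y (\<pi> i) * w' i y (\<pi> i) + u' i y (\<pi> i) * w i y (\<pi> i))) \<in> TT"
      by (rule TT.prod[of "\<lambda>i y j. u i y j * u' i y j + w i y j * w' i y j"
            "\<lambda>i y j. u i y j * w' i y j + u' i y j * w i y j"])
        (intro EV.add OD.add EV_mult OD_OD EV_OD uw prod)+
    then show ?case
    proof (rule TT.ext)
      fix y \<pi> and \<epsilon> :: "3 \<Rightarrow> real" assume e: "\<And>i. \<epsilon> i * \<epsilon> i = 1"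
      have "(u i y (\<pi> i) + \<epsilon> i * w i y (\<pi> i)) * (u' i y (\<pi> i) + \<epsilon> i * w' i y (\<pi> i)) =
        (u i y (\<pi> i) * u' i y (\<pi> i) + w i y (\<pi> i) * w' i y (\<pi> i)) +
        \<epsilon> i * (u i y (\<pi> i) * w' i y (\<pi> i) + u' i y (\<pi> i) * w i y (\<pi> i))" for i
      proof -
        have "(a + e * b) * (a' + e * b') = (a * a' + e * e * (b * b')) + e * (a * b' + a' * b)"
          for a b a' b' e :: real by (simp add: algebra_simps)
        then show ?thesis using e[of i] by simp
      qed
      then show "(\<Prod>i\<in>UNIV. u i y (\<pi> i) + \<epsilon> i * w i y (\<pi> i)) * (\<Prod>i\<in>UNIV. u' i y (\<pi> i) + \<epsilon> i * w' i y (\<pi> i)) =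
        (\<Prod>i\<in>UNIV. (u i y (\<pi> i) * u' i y (\<pi> i) + w i y (\<pi> i) * w' i y (\<pi> i)) +
       \<epsilon> i * (u i y (\<pi> i) * w' i y (\<pi> i) + u' i y (\<pi> i) * w i y (\<pi> i)))"
        unfolding prod.distrib[symmetric] by (intro prod.cong) auto
    qed
  next
    case (add f g)
    show ?case by (rule TT.ext[OF TT.add[OF add.IH]]) (simp add: distrib_left)
  next
    case (ext f g)
    show ?case by (rule TT.ext[OF ext.IH]) (simp add: ext.hyps)
  qed
next
  case (add f f')
  show ?case by (rule TT.ext[OF TT.add[OF add.IH]]) (simp add: distrib_right)
next
  case (ext f f')
  show ?case by (rule TT.ext[OF ext.IH]) (simp add: ext.hyps)
qed

lemma TT_single:
  assumes "u \<in> EV" "w \<in> OD"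
  shows "(\<lambda>y \<pi> \<epsilon>. u y (\<pi> j) + \<epsilon> j * w y (\<pi> j)) \<in> TT"
proof -
  have "(\<lambda>y \<pi> \<epsilon>. \<Prod>i\<in>UNIV. (if i = j then u else (\<lambda>y i. 1)) y (\<pi> i) +
    \<epsilon> i * (if i = j then w else (\<lambda>y i. 0)) y (\<pi> i)) \<in> TT"
    by (rule TT.prod[of "\<lambda>i. if i = j then u else (\<lambda>y i. 1)" "\<lambda>i. if i = j then w else (\<lambda>y i. 0)"])
      (use assms EV_const OD.zero in auto)
  then show ?thesis
  proof (rule TT.ext)
    fix y \<pi> and \<epsilon> :: "3 \<Rightarrow> real"
    have "(\<Prod>i\<in>UNIV. (if i = j then u else (\<lambda>y i. 1)) y (\<pi> i) +
      \<epsilon> i * (if i = j then w else (\<lambda>y i. 0)) y (\<pi> i)) = (\<Prod>i\<in>{j}. u y (\<pi> i) + \<epsilon> i * w y (\<pi> i))"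
      by (rule prod.mono_neutral_cong_right) auto
    then show "u y (\<pi> j) + \<epsilon> j * w y (\<pi> j) = (\<Prod>i\<in>UNIV. (if i = j then u else (\<lambda>y i. 1)) y (\<pi> i) +
      \<epsilon> i * (if i = j then w else (\<lambda>y i. 0)) y (\<pi> i))" by simp
  qed
qed

lemma TT_K: "k \<in> K \<Longrightarrow> (\<lambda>y \<pi> \<epsilon>. k y) \<in> TT"
  using TT_single[OF EV_K OD.zero] by simp

lemma TT_const: "(\<lambda>y \<pi> \<epsilon>. r) \<in> TT" by (rule TT_K[OF K_const])

lemma TT_lam: "(\<lambda>y \<pi> \<epsilon>. lam y (\<pi> j)) \<in> TT"
  using TT_single[OF EV_lam OD.zero] by simp

lemma TT_C: "c \<in> C \<Longrightarrow> (\<lambda>y \<pi> \<epsilon>. \<epsilon> j * c y (\<pi> j)) \<in> TT"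
  using TT_single[OF EV_const[of 0] OD_C] by simp

text \<open>Expand the product over the three slots. Summing over the two free signs kills every
  term except the one with all factors even and the one with all factors odd; the latter acquires
  \<open>sign \<pi>\<close>. What remains is four times a permanent plus an alternating sum.\<close>

lemma avg_in_K:
  assumes "t \<in> TT" shows "avg t \<in> K"
  using assms
proof induction
  case (prod u w)
  have "(\<lambda>y. 4 * ((\<Sum>\<pi>\<in>perms. u 1 y (\<pi> 1) * u 2 y (\<pi> 2) * u 3 y (\<pi> 3)) + alt (w 1) (w 2) (w 3) y)) \<in> K"
    by (intro K_add K_mult K_const permanent_in_K alt_in_K prod)
  then show ?case
  proof (rule K_cong)
    fix y
    have "(\<Sum>a\<in>{1, -1}. \<Sum>b\<in>{1, -1}. \<Prod>i\<in>UNIV. u i y (\<pi> i) + eps a b \<pi> i * w i y (\<pi> i)) =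
      4 * (u 1 y (\<pi> 1) * u 2 y (\<pi> 2) * u 3 y (\<pi> 3) +
        of_int (sign \<pi>) * w 1 y (\<pi> 1) * w 2 y (\<pi> 2) * w 3 y (\<pi> 3))" for \<pi>
      by (simp add: prod_3 eps_def algebra_simps)
    then show "avg (\<lambda>y \<pi> \<epsilon>. \<Prod>i\<in>UNIV. u i y (\<pi> i) + \<epsilon> i * w i y (\<pi> i)) y =
      4 * ((\<Sum>\<pi>\<in>perms. u 1 y (\<pi> 1) * u 2 y (\<pi> 2) * u 3 y (\<pi> 3)) + alt (w 1) (w 2) (w 3) y)"
      by (simp add: avg_def alt_def sum.distrib flip: sum_distrib_left)
  qed
next
  case (add s t)
  show ?case by (rule K_cong[OF K_add[OF add.IH]]) (simp add: avg_def sum.distrib)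
next
  case (ext s t)
  show ?case
  proof (rule K_cong[OF ext.IH])
    fix y assume y: "y \<in> Y"
    have "eps a b \<pi> i * eps a b \<pi> i = 1" if "a \<in> {1, -1}" "b \<in> {1, -1}" for a b \<pi> i
      using that by (auto simp: eps_def sign_def)
    then show "avg t y = avg s y" unfolding avg_def using ext.hyps(2)[OF y] by (intro sum.cong refl) blast
  qed
qed

end

section \<open>Invariant polynomials and their values on the slice\<close>

text \<open>\<open>coord_value\<close> for any field, so that real points can be evaluated
  too.\<close>

primrec cval :: "coord \<Rightarrow> ('a^3) \<times> ('a^3^3) \<Rightarrow> 'a" where
  "cval V1 x = fst x $ 1"
| "cval V2 x = fst x $ 2"
| "cval V3 x = fst x $ 3"
| "cval A11 x = snd x $ 1 $ 1"
| "cval A12 x = snd x $ 1 $ 2"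
| "cval A13 x = snd x $ 1 $ 3"
| "cval A22 x = snd x $ 2 $ 2"
| "cval A23 x = snd x $ 2 $ 3"
| "cval A33 x = snd x $ 3 $ 3"

lemma coord_value_cval: "coord_value c x = cval c x"
  by (cases c) simp_all

abbreviation ev :: "('a::real_field^3) \<times> ('a^3^3) \<Rightarrow> real_poly \<Rightarrow> 'a"
  where "ev x \<equiv> evl (\<lambda>c. cval c x)"

lemma eval_at_ev: "eval_at x = ev x"
  by (simp add: eval_at_evl coord_value_cval)

definition ract :: "'a::comm_ring_1^3^3 \<Rightarrow> ('a^3) \<times> ('a^3^3) \<Rightarrow> ('a^3) \<times> ('a^3^3)"
  where "ract g x = (g *v fst x, g ** snd x ** transpose g)"

lemma act_ract: "act g x = ract g x" by (simp add: act_def ract_def)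

lemma ract_ract: "ract g (ract h x) = ract (g ** h) x"
  by (simp add: ract_def matrix_vector_mul_assoc matrix_transpose_mul matrix_mul_assoc)

lemma ract_mat1: "ract (mat 1) x = x" by (simp add: ract_def)

lemma coords_surj:
  fixes f :: "coord \<Rightarrow> 'a::zero"
  obtains v A where "transpose A = A" "\<And>c. cval c (v, A) = f c"
proof
  let ?v = "vector [f V1, f V2, f V3] :: 'a^3"
  let ?A = "vector [vector [f A11, f A12, f A13], vector [f A12, f A22, f A23],
    vector [f A13, f A23, f A33]] :: 'a^3^3"
  show "transpose ?A = ?A" by (simp add: vec_eq_iff transpose_def forall_3)
  show "cval c (?v, ?A) = f c" for c by (cases c) simp_all
qed

lemma rotation_matrixD:
  assumes "rotation_matrix g"
  shows "transpose g ** g = mat 1" "g ** transpose g = mat 1" "det g = 1"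
  using assms by (auto simp: rotation_matrix_def orthogonal_matrix_def)

lemma rotation_matrix_mult:
  assumes "rotation_matrix (g :: 'a::comm_ring_1^'n^'n)" "rotation_matrix h"
  shows "rotation_matrix (g ** h)"
proof -
  have "transpose h ** (transpose g ** g) ** h = mat 1" "g ** (h ** transpose h) ** transpose g = mat 1"
    using assms by (simp_all add: rotation_matrix_def orthogonal_matrix_def)
  then show ?thesis using assms
    by (simp add: rotation_matrix_def orthogonal_matrix_def matrix_transpose_mul det_mul matrix_mul_assoc)
qed

lemma rotation_matrix_transpose: "rotation_matrix (transpose g) \<longleftrightarrow> rotation_matrix g"
  by (auto simp: rotation_matrix_def orthogonal_matrix_def)

lemma ract_symmetric: "transpose (snd x) = snd x \<Longrightarrow> transpose (snd (ract g x)) = snd (ract g x)"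
  by (simp add: ract_def matrix_transpose_mul matrix_mul_assoc)

definition gen_vec :: "real_poly^3" where "gen_vec = vector [Var V1, Var V2, Var V3]"

lemma ev_gen_vec: "ev (v, A) (gen_vec $ i) = v $ i"
  using exhaust_3[of i] by (auto simp: gen_vec_def)

lemma ev_gen_mat: "transpose A = A \<Longrightarrow> ev (v, A) (generic_matrix $ i $ j) = A $ i $ j"
proof -
  assume sym: "transpose A = A"
  have "A $ b $ a = A $ a $ b" for a b
    using arg_cong[OF sym, of "\<lambda>M. M $ a $ b"] by (simp add: transpose_def)
  then show ?thesis
    using exhaust_3[of i] exhaust_3[of j] by (auto simp: generic_matrix_def)
qed

lemma ev_mpow:
  assumes "transpose A = A"
  shows "ev (v, A) (mpow generic_matrix n $ i $ j) = mpow A n $ i $ j"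
proof (induction n arbitrary: i j)
  case 0
  then show ?case by (simp add: mat_def)
next
  case (Suc n)
  then show ?case by (simp add: matrix_matrix_mult_def ev_gen_mat[OF assms])
qed

lemma evl_det: "evl f (det M) = det (\<chi> i j. evl f (M $ i $ j :: real_poly) :: 'a::real_field^3^3)"
  by (simp add: det_3)

section \<open>The generating invariants\<close>

definition tp :: "nat \<Rightarrow> real_poly" where "tp n = trace (mpow generic_matrix n)"

definition pp :: "nat \<Rightarrow> real_poly"
  where "pp n = (\<Sum>i\<in>UNIV. \<Sum>j\<in>UNIV. gen_vec $ i * mpow generic_matrix n $ i $ j * gen_vec $ j)"

text \<open>The exponents 0, 1, 2 of the three rows. In the index type \<open>3\<close> the numeral
  3 is 0, so the map is written by cases.\<close>

definition pos :: "3 \<Rightarrow> nat" where "pos i = (if i = 1 then 0 else if i = 2 then 1 else 2)"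

definition dp :: real_poly
  where "dp = det (\<chi> i j. \<Sum>k\<in>UNIV. mpow generic_matrix (pos i) $ j $ k * gen_vec $ k)"

context
  fixes A :: "'a::real_field^3^3" and v :: "'a^3"
  assumes sym: "transpose A = A"
begin

lemma ev_tp: "ev (v, A) (tp n) = trace (mpow A n)"
  by (simp add: tp_def trace_def ev_mpow[OF sym])

lemma ev_pp: "ev (v, A) (pp n) = dotp v (mpow A n *v v)"
  by (simp add: pp_def ev_mpow[OF sym] ev_gen_vec dotp_def matrix_vector_mult_def sum_distrib_left mult.assoc)

lemma ev_dp: "ev (v, A) dp = det (\<chi> i. mpow A (pos i) *v v)"
proof -
  have "(\<chi> i j. ev (v, A) (\<Sum>k\<in>UNIV. mpow generic_matrix (pos i) $ j $ k * gen_vec $ k)) =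
    (\<chi> i. mpow A (pos i) *v v)"
    by (simp add: vec_eq_iff matrix_vector_mult_def ev_mpow[OF sym] ev_gen_vec)
  then show ?thesis unfolding dp_def evl_det by simp
qed

lemma ev_Discr: "ev (v, A) Discr = disc3 (trace A) (minors A) (det A)"
  unfolding Discr_def cubic_discriminant_charpoly
  by (simp add: disc3_def trace_3 minors_def det_3 ev_gen_mat[OF sym])

end

lemma disc3_trace:
  "disc3 (trace A) (minors A) (det A) = disc3 (trace A) ((trace A ^ 2 - trace (mpow A 2)) / 2)
    ((trace A ^ 3 - 3 * trace A * trace (mpow A 2) + 2 * trace (mpow (A :: 'a::real_field^3^3) 3)) / 6)"
proof -
  have "minors A = (trace A ^ 2 - trace (mpow A 2)) / 2" using minors_trace[of A] by (simp add: field_simps)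
  moreover have "det A = (trace A ^ 3 - 3 * trace A * trace (mpow A 2) + 2 * trace (mpow A 3)) / 6"
    using det_trace[of A] by (simp add: field_simps)
  ultimately show ?thesis by (simp only:)
qed

lemma mpow_1: "mpow A 1 = (A :: 'a::comm_ring_1^'n^'n)" by simp

context
  fixes g A :: "'a::real_field^3^3" and v :: "'a^3"
  assumes g: "rotation_matrix g" and sym: "transpose A = A"
begin

lemma sym': "transpose (g ** A ** transpose g) = g ** A ** transpose g"
  by (simp add: matrix_transpose_mul sym matrix_mul_assoc)

lemma tp_invariant: "ev (ract g (v, A)) (tp n) = ev (v, A) (tp n)"
  unfolding ract_def fst_conv snd_conv ev_tp[OF sym'] ev_tp[OF sym]
  by (simp add: mpow_conj rotation_matrixD[OF g] trace_conj)

lemma mpow_conj_vec: "mpow (g ** A ** transpose g) n *v (g *v v) = g *v (mpow A n *v v)"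
proof -
  have "mpow (g ** A ** transpose g) n ** g = g ** mpow A n ** (transpose g ** g)"
    unfolding mpow_conj[OF rotation_matrixD(1,2)[OF g]] by (simp only: matrix_mul_assoc)
  then have "mpow (g ** A ** transpose g) n ** g = g ** mpow A n"
    by (simp add: rotation_matrixD[OF g])
  then show ?thesis by (simp only: matrix_vector_mul_assoc)
qed

lemma pp_invariant: "ev (ract g (v, A)) (pp n) = ev (v, A) (pp n)"
proof -
  have "dotp (g *v v) (g *v u) = dotp v u" for u
    unfolding dotp_matrix by (simp add: matrix_vector_mul_assoc rotation_matrixD[OF g])
  then show ?thesis
    unfolding ract_def fst_conv snd_conv ev_pp[OF sym'] ev_pp[OF sym] mpow_conj_vec by simp
qed

text \<open>The determinant one of \<open>g\<close> enters here: a reflection would change the sign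
  of \<open>dp\<close>, while traces and moments only see orthogonality.\<close>

lemma dp_invariant: "ev (ract g (v, A)) dp = ev (v, A) dp"
proof -
  have "(\<chi> i. g *v u i) = (\<chi> i. u i) ** transpose g" for u :: "3 \<Rightarrow> 'a^3"
    by (simp add: vec_eq_iff matrix_matrix_mult_def matrix_vector_mult_def transpose_def mult.commute)
  then show ?thesis
    unfolding ract_def fst_conv snd_conv ev_dp[OF sym'] ev_dp[OF sym] mpow_conj_vec
    by (simp add: det_mul rotation_matrixD[OF g])
qed

lemma Discr_invariant: "ev (ract g (v, A)) Discr = ev (v, A) Discr"
  using tp_invariant[of 1] tp_invariant[of 2] tp_invariant[of 3]
  unfolding ract_def fst_conv snd_conv ev_Discr[OF sym'] ev_Discr[OF sym] ev_tp[OF sym'] ev_tp[OF sym]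
    mpow_1 disc3_trace by simp

end

lemma diag_symmetric: "transpose (diag l) = diag l"
  by (simp add: vec_eq_iff transpose_def diag_def)

lemma diag_vec: "(diag l *v v) $ i = l $ i * (v $ i :: 'a::comm_ring_1)"
proof -
  have "(\<Sum>j\<in>UNIV. (if i = j then l $ i else 0) * v $ j) = (\<Sum>j\<in>{i}. l $ i * v $ j)"
    by (rule sum.mono_neutral_cong_right) auto
  then show ?thesis by (simp add: matrix_vector_mult_def diag_def)
qed

context
  fixes l v :: "'a::real_field^3"
begin

lemma tp_diag: "ev (v, diag l) (tp n) = (\<Sum>i\<in>UNIV. l $ i ^ n)"
  unfolding ev_tp[OF diag_symmetric] mpow_diag by (simp add: trace_def diag_def)

lemma pp_diag: "ev (v, diag l) (pp n) = (\<Sum>i\<in>UNIV. l $ i ^ n * (v $ i * v $ i))"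
  unfolding ev_pp[OF diag_symmetric] mpow_diag by (simp add: dotp_def diag_vec mult_ac)

lemma dp_diag: "ev (v, diag l) dp =
  v $ 1 * v $ 2 * v $ 3 * ((l $ 2 - l $ 1) * (l $ 3 - l $ 1) * (l $ 3 - l $ 2))"
  unfolding ev_dp[OF diag_symmetric] mpow_diag
  by (simp add: det_3 diag_vec pos_def algebra_simps power2_eq_square)

lemma Discr_diag: "ev (v, diag l) Discr = ((l $ 1 - l $ 2) * (l $ 2 - l $ 3) * (l $ 3 - l $ 1))\<^sup>2"
  unfolding ev_Discr[OF diag_symmetric]
proof -
  have "trace (diag l) = l $ 1 + l $ 2 + l $ 3" "minors (diag l) = l $ 1 * l $ 2 + l $ 2 * l $ 3 + l $ 3 * l $ 1"
    "det (diag l) = l $ 1 * l $ 2 * l $ 3"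
    by (simp_all add: trace_3 minors_def det_3 diag_def)
  then show "disc3 (trace (diag l)) (minors (diag l)) (det (diag l)) =
    ((l $ 1 - l $ 2) * (l $ 2 - l $ 3) * (l $ 3 - l $ 1))\<^sup>2" by (simp only: disc3_roots)
qed

end

text \<open>Finitely many generators: by Cayley and Hamilton the higher traces and moments follow
  from these. The finiteness is reused to show that the quotient is of finite type.\<close>

inductive_set Inv_alg :: "real_poly set" where
  const: "Const r \<in> Inv_alg"
| tp: "n \<in> {1, 2, 3} \<Longrightarrow> tp n \<in> Inv_alg"
| pp: "n \<in> {0, 1, 2} \<Longrightarrow> pp n \<in> Inv_alg"
| dp: "dp \<in> Inv_alg"
| add: "P \<in> Inv_alg \<Longrightarrow> Q \<in> Inv_alg \<Longrightarrow> P + Q \<in> Inv_alg"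
| mult: "P \<in> Inv_alg \<Longrightarrow> Q \<in> Inv_alg \<Longrightarrow> P * Q \<in> Inv_alg"

lemma Inv_alg_invariant:
  fixes g A :: "'a::real_field^3^3"
  assumes "P \<in> Inv_alg" "rotation_matrix g" "transpose A = A"
  shows "ev (ract g (v, A)) P = ev (v, A) P"
  using assms(1)
  by induction (simp_all add: tp_invariant pp_invariant dp_invariant assms(2,3))

lemma Inv_alg_uminus: "P \<in> Inv_alg \<Longrightarrow> - P \<in> Inv_alg"
proof -
  assume "P \<in> Inv_alg"
  then have "Const (-1) * P \<in> Inv_alg" by (intro Inv_alg.mult Inv_alg.const)
  moreover have "Const (-1) * P = - P" by (rule real_poly_eqI) simp
  ultimately show ?thesis by simp
qed

lemma Inv_alg_diff: "P \<in> Inv_alg \<Longrightarrow> Q \<in> Inv_alg \<Longrightarrow> P - Q \<in> Inv_alg"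
  using Inv_alg.add[OF _ Inv_alg_uminus] by fastforce

lemma Inv_alg_power: "P \<in> Inv_alg \<Longrightarrow> P ^ n \<in> Inv_alg"
  by (induction n) (use Inv_alg.mult Inv_alg.const[of 1] in simp_all)

lemma Inv_alg_numeral: "numeral n \<in> Inv_alg"
  using Inv_alg.const[of "numeral n"] by (simp add: Const_def)

text \<open>Stated for any set closed under the ring operations, because it is applied to
  \<open>Inv_alg\<close> and again in \<open>points_exist\<close> to the invariants on which a
  homomorphism agrees with an evaluation.\<close>

lemma Discr_in_subalgebra:
  assumes c: "\<And>r. Const r \<in> S" and a: "\<And>P Q. P \<in> S \<Longrightarrow> Q \<in> S \<Longrightarrow> P + Q \<in> S"
    and m: "\<And>P Q. P \<in> S \<Longrightarrow> Q \<in> S \<Longrightarrow> P * Q \<in> S" and t: "tp 1 \<in> S" "tp 2 \<in> S" "tp 3 \<in> S"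
  shows "Discr \<in> S"
proof -
  have pow: "P ^ n \<in> S" if "P \<in> S" for P n
    by (induction n) (use m[OF that] c[of 1] in simp_all)
  have num: "numeral n \<in> S" for n using c[of "numeral n"] by (simp add: Const_def)
  have diff: "P - Q \<in> S" if "P \<in> S" "Q \<in> S" for P Q
  proof -
    have "P + Const (-1) * Q \<in> S" by (intro a m c that)
    moreover have "P + Const (-1) * Q = P - Q" by (rule real_poly_eqI) simp
    ultimately show ?thesis by simp
  qed
  define b where "b = Const (1/2) * (tp 1 ^ 2 - tp 2)"
  define d where "d = Const (1/6) * (tp 1 ^ 3 - 3 * tp 1 * tp 2 + 2 * tp 3)"
  have bd: "b \<in> S" "d \<in> S" unfolding b_def d_def by (intro m a c pow diff num t)+
  have "disc3 (tp 1) b d \<in> S" unfolding disc3_def by (intro m a c pow diff num t bd)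
  moreover have "Discr = disc3 (tp 1) b d"
  proof (rule real_poly_eqI)
    fix f :: "coord \<Rightarrow> real"
    obtain v A where vA: "transpose A = A" "\<And>c. cval c (v, A) = f c" using coords_surj[of f] by metis
    have "ev (v, A) Discr = ev (v, A) (disc3 (tp 1) b d)"
      unfolding ev_Discr[OF vA(1)] disc3_trace
      by (simp only: disc3_def evl_add evl_diff evl_mult evl_power evl_numeral b_def d_def evl_Const
          ev_tp[OF vA(1)] mpow_1) simp
    then show "evl f Discr = evl f (disc3 (tp 1) b d)" using vA(2) by simp
  qed
  ultimately show ?thesis by simp
qed

lemma Discr_Inv_alg: "Discr \<in> Inv_alg"
  by (rule Discr_in_subalgebra) (simp_all add: Inv_alg.intros)

section \<open>Real points of the slice\<close>

type_synonym slice_point = "(real^3^3) \<times> (real^3) \<times> (real^3)"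

text \<open>Single eigenvalues and eigenvectors are not functions of the matrix, but they are
  functions on these triples. \<open>slp\<close> is the slice part of a triple and
  \<open>spt\<close> the point it represents.\<close>

definition YR :: "slice_point set"
  where "YR = {(g, v, l). rotation_matrix g \<and> l $ 1 \<noteq> l $ 2 \<and> l $ 2 \<noteq> l $ 3 \<and> l $ 3 \<noteq> l $ 1}"

definition slp :: "slice_point \<Rightarrow> (real^3) \<times> (real^3^3)"
  where "slp y = (fst (snd y), diag (snd (snd y)))"

definition spt :: "slice_point \<Rightarrow> (real^3) \<times> (real^3^3)"
  where "spt y = ract (fst y) (slp y)"

definition lamf :: "slice_point \<Rightarrow> 3 \<Rightarrow> real" where "lamf y i = snd (snd y) $ i"
definition vecf :: "slice_point \<Rightarrow> 3 \<Rightarrow> real" where "vecf y i = fst (snd y) $ i"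
definition rotf :: "3 \<Rightarrow> slice_point \<Rightarrow> 3 \<Rightarrow> real" where "rotf a y i = fst y $ a $ i"

lemma YR_rot: "y \<in> YR \<Longrightarrow> rotation_matrix (fst y)"
  and YR_dist: "y \<in> YR \<Longrightarrow> lamf y 1 \<noteq> lamf y 2 \<and> lamf y 2 \<noteq> lamf y 3 \<and> lamf y 3 \<noteq> lamf y 1"
  by (auto simp: YR_def lamf_def)

lemma ev_spt_invariant:
  assumes "y \<in> YR" and "\<And>(g :: real^3^3) v A. rotation_matrix g \<Longrightarrow> transpose A = A \<Longrightarrow> ev (ract g (v, A)) P = ev (v, A) P"
  shows "ev (spt y) P = ev (slp y) P"
  unfolding spt_def slp_def by (intro assms(2) YR_rot assms(1) diag_symmetric)

lemma ev_spt_Discr: "y \<in> YR \<Longrightarrow> ev (spt y) Discr =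
   ((lamf y 1 - lamf y 2) * (lamf y 2 - lamf y 3) * (lamf y 3 - lamf y 1))\<^sup>2"
  by (simp add: ev_spt_invariant[OF _ Discr_invariant] slp_def Discr_diag lamf_def)

lemma ev_spt_Discr_nz: "y \<in> YR \<Longrightarrow> ev (spt y) Discr \<noteq> 0"
  using YR_dist by (simp add: ev_spt_Discr)

lemma ev_spt_tp: "y \<in> YR \<Longrightarrow> ev (spt y) (tp n) = (\<Sum>i\<in>UNIV. lamf y i ^ n)"
  by (simp add: ev_spt_invariant[OF _ tp_invariant] slp_def tp_diag lamf_def)

lemma ev_spt_pp: "y \<in> YR \<Longrightarrow> ev (spt y) (pp n) = (\<Sum>i\<in>UNIV. lamf y i ^ n * (vecf y i * vecf y i))"
  by (simp add: ev_spt_invariant[OF _ pp_invariant] slp_def pp_diag lamf_def vecf_def)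

lemma ev_spt_dp: "y \<in> YR \<Longrightarrow> ev (spt y) dp = vecf y 1 * vecf y 2 * vecf y 3 *
   ((lamf y 2 - lamf y 1) * (lamf y 3 - lamf y 1) * (lamf y 3 - lamf y 2))"
  by (simp add: ev_spt_invariant[OF _ dp_invariant] slp_def dp_diag lamf_def vecf_def)

lemma snd_spt_symmetric: "transpose (snd (spt y)) = snd (spt y)"
  unfolding spt_def by (rule ract_symmetric) (simp add: slp_def diag_symmetric)

text \<open>The spectral decomposition. It says that the moments of a product of two eigenvector
  entries are polynomials, which is \<open>K_two\<close> for the interpretation
  \<open>T\<close>.\<close>

lemma ev_spt_mpow:
  assumes "y \<in> YR"
  shows "ev (spt y) (mpow generic_matrix n $ a $ b) = (\<Sum>i\<in>UNIV. lamf y i ^ n * (rotf a y i * rotf b y i))"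
proof -
  have "ev (spt y) (mpow generic_matrix n $ a $ b) = mpow (snd (spt y)) n $ a $ b"
    using ev_mpow[of "snd (spt y)" "fst (spt y)" n a b] snd_spt_symmetric by simp
  also have "snd (spt y) = fst y ** diag (snd (snd y)) ** transpose (fst y)"
    by (simp add: spt_def ract_def slp_def)
  finally show ?thesis
    unfolding mpow_conj[OF rotation_matrixD(1,2)[OF YR_rot[OF assms]]] mpow_diag conj_diag
    by (simp add: rotf_def lamf_def mult_ac)
qed

lemma Discr_nz: "Discr \<noteq> 0"
proof
  assume "Discr = 0"
  then have "ev (0, diag (vector [1, 2, 3] :: real^3)) Discr = 0" by simp
  then show False unfolding Discr_diag by simp
qed

text \<open>The difference times \<open>Discr\<close> vanishes at every real point, because real
  diagonalization writes each point with \<open>Discr\<close> nonzero as some \<open>spt y\<close>.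
  The polynomial ring has no zero divisors.\<close>

lemma spt_dense:
  assumes "\<And>y. y \<in> YR \<Longrightarrow> ev (spt y) P = ev (spt y) Q"
  shows "P = Q"
proof -
  have "evl f ((P - Q) * Discr) = 0" for f :: "coord \<Rightarrow> real"
  proof -
    obtain v A where vA: "transpose A = A" "\<And>c. cval c (v, A) = f c" using coords_surj[of f] by metis
    show ?thesis
    proof (cases "ev (v, A) Discr = 0")
      case True
      then show ?thesis using vA(2) by simp
    next
      case False
      obtain g l where gl: "rotation_matrix g" "A = g ** diag l ** transpose g"
        "l $ 1 \<noteq> l $ 2" "l $ 2 \<noteq> l $ 3" "l $ 3 \<noteq> l $ 1"
        using diagonalize_real[OF vA(1)] False unfolding ev_Discr[OF vA(1)] by metis
      have "g *v (transpose g *v v) = v"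
        unfolding matrix_vector_mul_assoc rotation_matrixD(2)[OF gl(1)] by simp
      then have "(v, A) = spt (g, transpose g *v v, l)"
        unfolding spt_def ract_def slp_def fst_conv snd_conv gl(2) by (simp only:)
      moreover have "(g, transpose g *v v, l) \<in> YR" using gl by (simp add: YR_def)
      ultimately have "ev (v, A) P = ev (v, A) Q" using assms by metis
      then show ?thesis using vA(2) by simp
    qed
  qed
  then have "(P - Q) * Discr = 0" by (rule real_poly_zero)
  then have "P - Q = 0" using real_poly_no_zero_divisors Discr_nz by blast
  then show ?thesis by simp
qed

text \<open>Functions on \<open>YR\<close> that are fractions with numerator in \<open>S\<close> and
  a power of \<open>Discr\<close> as denominator. \<open>S\<close> is an algebra in the two
  interpretations below and an ideal in \<open>span_avg\<close>.\<close>

definition Kf :: "real_poly set \<Rightarrow> (slice_point \<Rightarrow> real) set"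
  where "Kf S = {f. \<exists>P\<in>S. \<exists>n. \<forall>y\<in>YR. f y * ev (spt y) Discr ^ n = ev (spt y) P}"

lemma KfI: "P \<in> S \<Longrightarrow> (\<And>y. y \<in> YR \<Longrightarrow> f y * ev (spt y) Discr ^ n = ev (spt y) P) \<Longrightarrow> f \<in> Kf S"
  unfolding Kf_def by blast

lemma KfE:
  assumes "f \<in> Kf S"
  obtains P n where "P \<in> S" "\<And>y. y \<in> YR \<Longrightarrow> f y * ev (spt y) Discr ^ n = ev (spt y) P"
  using assms unfolding Kf_def by blast

lemma Kf_cong: "f \<in> Kf S \<Longrightarrow> (\<And>y. y \<in> YR \<Longrightarrow> g y = f y) \<Longrightarrow> g \<in> Kf S"
  by (erule KfE, rule KfI) auto

lemma Kf_poly: "P \<in> S \<Longrightarrow> (\<lambda>y. ev (spt y) P) \<in> Kf S"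
  by (rule KfI[of P _ _ 0]) auto

lemma Kf_add:
  assumes "\<And>P Q. P \<in> S \<Longrightarrow> Q \<in> S \<Longrightarrow> P + Q \<in> S" "\<And>P. P \<in> S \<Longrightarrow> P * Discr \<in> S"
    and "f \<in> Kf S" "g \<in> Kf S"
  shows "(\<lambda>y. f y + g y) \<in> Kf S"
proof -
  obtain P n where P: "P \<in> S" "\<And>y. y \<in> YR \<Longrightarrow> f y * ev (spt y) Discr ^ n = ev (spt y) P"
    using assms(3) by (erule KfE)
  obtain Q m where Q: "Q \<in> S" "\<And>y. y \<in> YR \<Longrightarrow> g y * ev (spt y) Discr ^ m = ev (spt y) Q"
    using assms(4) by (erule KfE)
  have pow: "R * Discr ^ k \<in> S" if "R \<in> S" for R k
  proof (induction k)
    case 0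
    then show ?case using that by simp
  next
    case (Suc k)
    then show ?case using assms(2)[OF Suc] by (simp only: power_Suc2 mult.assoc[symmetric])
  qed
  show ?thesis
  proof (rule KfI[of "P * Discr ^ m + Q * Discr ^ n" _ _ "n + m"])
    show "P * Discr ^ m + Q * Discr ^ n \<in> S" by (intro assms(1) pow P Q)
    fix y assume y: "y \<in> YR"
    show "(f y + g y) * ev (spt y) Discr ^ (n + m) = ev (spt y) (P * Discr ^ m + Q * Discr ^ n)"
      unfolding evl_add evl_mult evl_power P(2)[OF y, symmetric] Q(2)[OF y, symmetric]
      by (simp add: power_add algebra_simps)
  qed
qed

text \<open>Three sets, so that it also covers an ideal times an algebra.\<close>

lemma Kf_mult:
  assumes "\<And>P Q. P \<in> S \<Longrightarrow> Q \<in> T \<Longrightarrow> P * Q \<in> U" and "f \<in> Kf S" "g \<in> Kf T"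
  shows "(\<lambda>y. f y * g y) \<in> Kf U"
proof -
  obtain P n where P: "P \<in> S" "\<And>y. y \<in> YR \<Longrightarrow> f y * ev (spt y) Discr ^ n = ev (spt y) P"
    using assms(2) by (erule KfE)
  obtain Q m where Q: "Q \<in> T" "\<And>y. y \<in> YR \<Longrightarrow> g y * ev (spt y) Discr ^ m = ev (spt y) Q"
    using assms(3) by (erule KfE)
  show ?thesis
  proof (rule KfI[of "P * Q" _ _ "n + m"])
    show "P * Q \<in> U" by (intro assms(1) P Q)
    fix y assume y: "y \<in> YR"
    show "(f y * g y) * ev (spt y) Discr ^ (n + m) = ev (spt y) (P * Q)"
      unfolding evl_mult P(2)[OF y, symmetric] Q(2)[OF y, symmetric]
      by (simp add: power_add algebra_simps)
  qed
qed

lemma averaging_base_Kf: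
  assumes c: "\<And>r. Const r \<in> S" and a: "\<And>P Q. P \<in> S \<Longrightarrow> Q \<in> S \<Longrightarrow> P + Q \<in> S"
    and m: "\<And>P Q. P \<in> S \<Longrightarrow> Q \<in> S \<Longrightarrow> P * Q \<in> S" and D: "Discr \<in> S"
    and pow: "\<And>n. (\<lambda>y. \<Sum>i\<in>UNIV. lamf y i ^ n) \<in> Kf S"
  shows "averaging_base YR (Kf S) lamf"
proof
  show "(\<lambda>y. r) \<in> Kf S" for r by (rule Kf_cong[OF Kf_poly[OF c[of r]]]) simp
  show "f \<in> Kf S \<Longrightarrow> g \<in> Kf S \<Longrightarrow> (\<lambda>y. f y + g y) \<in> Kf S" for f g
    by (rule Kf_add) (use a m D in auto)
  show "f \<in> Kf S \<Longrightarrow> g \<in> Kf S \<Longrightarrow> (\<lambda>y. f y * g y) \<in> Kf S" for f g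
    by (rule Kf_mult[OF m])
  show "f \<in> Kf S \<Longrightarrow> (\<And>y. y \<in> YR \<Longrightarrow> g y = f y) \<Longrightarrow> g \<in> Kf S" for f g by (rule Kf_cong)
  show "(\<lambda>y. \<Sum>i\<in>UNIV. lamf y i ^ n) \<in> Kf S" for n by (rule pow)
  show "(\<lambda>y. inverse (((lamf y 1 - lamf y 2) * (lamf y 2 - lamf y 3) * (lamf y 3 - lamf y 1))\<^sup>2)) \<in> Kf S"
  proof (rule KfI[OF c[of 1], of _ 1])
    fix y assume y: "y \<in> YR"
    show "inverse (((lamf y 1 - lamf y 2) * (lamf y 2 - lamf y 3) * (lamf y 3 - lamf y 1))\<^sup>2) *
      ev (spt y) Discr ^ 1 = ev (spt y) (Const 1)"
      unfolding ev_spt_Discr[OF y, symmetric] using ev_spt_Discr_nz[OF y] by simp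
  qed
  show "y \<in> YR \<Longrightarrow> lamf y 1 \<noteq> lamf y 2 \<and> lamf y 2 \<noteq> lamf y 3 \<and> lamf y 3 \<noteq> lamf y 1" for y
    by (rule YR_dist)
qed

text \<open>The eigenvalues are roots of the characteristic polynomial, so power sums obey a linear recursion.\<close>

lemma moments_recursion:
  assumes F: "(\<lambda>y. \<Sum>i\<in>UNIV. lamf y i ^ 0 * f y i) \<in> Kf Inv_alg"
    "(\<lambda>y. \<Sum>i\<in>UNIV. lamf y i ^ 1 * f y i) \<in> Kf Inv_alg"
    "(\<lambda>y. \<Sum>i\<in>UNIV. lamf y i ^ 2 * f y i) \<in> Kf Inv_alg"
  shows "(\<lambda>y. \<Sum>i\<in>UNIV. lamf y i ^ n * f y i) \<in> Kf Inv_alg"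
proof -
  let ?F = "\<lambda>n y. \<Sum>i\<in>UNIV. lamf y i ^ n * f y i"
  have add: "g \<in> Kf Inv_alg \<Longrightarrow> h \<in> Kf Inv_alg \<Longrightarrow> (\<lambda>y. g y + h y) \<in> Kf Inv_alg" for g h
    by (rule Kf_add) (auto intro: Inv_alg.add Inv_alg.mult Discr_Inv_alg)
  have mult: "g \<in> Kf Inv_alg \<Longrightarrow> h \<in> Kf Inv_alg \<Longrightarrow> (\<lambda>y. g y * h y) \<in> Kf Inv_alg" for g h
    by (rule Kf_mult[OF Inv_alg.mult])
  define e1 where "e1 = tp 1"
  \<comment> \<open>Newton's identities again; the minus sign is built into \<open>e2\<close> so
    that the recursion below only adds.\<close>
  define e2 where "e2 = Const (-1/2) * (tp 1 ^ 2 - tp 2)"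
  define e3 where "e3 = Const (1/6) * (tp 1 ^ 3 - 3 * tp 1 * tp 2 + 2 * tp 3)"
  have e: "e1 \<in> Inv_alg" "e2 \<in> Inv_alg" "e3 \<in> Inv_alg" unfolding e1_def e2_def e3_def
    by (intro Inv_alg.mult Inv_alg.add Inv_alg.const Inv_alg_power Inv_alg_diff Inv_alg_numeral Inv_alg.tp; simp)+
  have rec: "?F (n + 3) \<in> Kf Inv_alg" if "?F n \<in> Kf Inv_alg" "?F (n + 1) \<in> Kf Inv_alg" "?F (n + 2) \<in> Kf Inv_alg" for n
  proof -
    have "(\<lambda>y. ev (spt y) e1 * ?F (n + 2) y + ev (spt y) e2 * ?F (n + 1) y + ev (spt y) e3 * ?F n y) \<in> Kf Inv_alg"
      by (intro add mult Kf_poly e that)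
    then show ?thesis
    proof (rule Kf_cong)
      fix y assume y: "y \<in> YR"
      define a b c where abc: "a = lamf y 1" "b = lamf y 2" "c = lamf y 3"
      have t: "ev (spt y) (tp 1) = a + b + c" "ev (spt y) (tp 2) = a^2 + b^2 + c^2"
        "ev (spt y) (tp 3) = a^3 + b^3 + c^3"
        unfolding abc ev_spt_tp[OF y] by (simp_all add: sum_3)
      have "(a + b + c)^2 - (a^2 + b^2 + c^2) = 2 * (a * b + b * c + c * a)"
        "(a + b + c)^3 - 3 * (a + b + c) * (a^2 + b^2 + c^2) + 2 * (a^3 + b^3 + c^3) = 6 * (a * b * c)"
        by (simp_all add: power2_eq_square power3_eq_cube algebra_simps)
      then have ee: "ev (spt y) e1 = a + b + c" "ev (spt y) e2 = - (a * b + b * c + c * a)"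
        "ev (spt y) e3 = a * b * c"
        unfolding e1_def e2_def e3_def evl_mult evl_Const evl_add evl_diff evl_power evl_numeral t by simp_all
      have cubic: "x ^ (n + 3) = (a + b + c) * x ^ (n + 2) + - (a * b + b * c + c * a) * x ^ (n + 1) + a * b * c * x ^ n"
        if "x = a \<or> x = b \<or> x = c" for x
      proof -
        have "(x - a) * ((x - b) * (x - c)) * x ^ n = 0" using that by auto
        then show ?thesis by (simp add: algebra_simps power_add power2_eq_square power3_eq_cube)
      qed
      have "lamf y i ^ (n + 3) * f y i = ev (spt y) e1 * (lamf y i ^ (n + 2) * f y i) +
        ev (spt y) e2 * (lamf y i ^ (n + 1) * f y i) + ev (spt y) e3 * (lamf y i ^ n * f y i)" for i
      proof -
        have "lamf y i = a \<or> lamf y i = b \<or> lamf y i = c" using exhaust_3[of i] by (auto simp: abc)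
        from cubic[OF this] show ?thesis unfolding ee by (simp only: distrib_right mult.assoc)
      qed
      then show "?F (n + 3) y = ev (spt y) e1 * ?F (n + 2) y + ev (spt y) e2 * ?F (n + 1) y + ev (spt y) e3 * ?F n y"
        by (simp only: sum.distrib sum_distrib_left)
    qed
  qed
  have "?F n \<in> Kf Inv_alg \<and> ?F (n + 1) \<in> Kf Inv_alg \<and> ?F (n + 2) \<in> Kf Inv_alg" for n
  proof (induction n)
    case 0
    show ?case using F by (simp only: add_0)
  next
    case (Suc n)
    have "Suc n = n + 1" "n + 1 + 1 = n + 2" "n + 1 + 2 = n + 3" by simp_all
    then show ?case using Suc rec[of n] by (simp only:)
  qed
  then show ?thesis by blast
qed

lemma Kf_lamf_pow: "(\<lambda>y. \<Sum>i\<in>UNIV. lamf y i ^ n) \<in> Kf Inv_alg"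
proof -
  have "(\<lambda>y. \<Sum>i\<in>UNIV. lamf y i ^ k * 1) \<in> Kf Inv_alg" if "k < 3" for k
  proof (cases "k = 0")
    case True
    then show ?thesis by (intro Kf_cong[OF Kf_poly[OF Inv_alg.const[of 3]]]) simp
  next
    case False
    then have "k \<in> {1, 2, 3}" using that by auto
    from Kf_poly[OF Inv_alg.tp[OF this]] show ?thesis by (rule Kf_cong) (simp add: ev_spt_tp)
  qed
  note F = this
  have "(\<lambda>y. \<Sum>i\<in>UNIV. lamf y i ^ n * 1) \<in> Kf Inv_alg" by (rule moments_recursion; rule F; simp)
  then show ?thesis by simp
qed

lemma Kf_vecf: "(\<lambda>y. \<Sum>i\<in>UNIV. lamf y i ^ n * (vecf y i * vecf y i)) \<in> Kf Inv_alg"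
proof -
  have "(\<lambda>y. \<Sum>i\<in>UNIV. lamf y i ^ k * (vecf y i * vecf y i)) \<in> Kf Inv_alg" if "k < 3" for k
  proof -
    have "k \<in> {0, 1, 2}" using that by auto
    from Kf_poly[OF Inv_alg.pp[OF this]] show ?thesis by (rule Kf_cong) (simp add: ev_spt_pp)
  qed
  note F = this
  show ?thesis by (rule moments_recursion; rule F; simp)
qed

global_interpretation base_B: averaging_base YR "Kf Inv_alg" lamf
  by (rule averaging_base_Kf) (auto intro: Inv_alg.intros Discr_Inv_alg Kf_lamf_pow)

text \<open>For \<open>K_three\<close>, let \<open>V\<close> be the Vandermonde product,
  \<open>w\<close> the product of the three coordinates and \<open>alt\<close> the alternant. Then
  \<open>dp\<close> has value \<open>w * V\<close>, while \<open>V * alt\<close>, a product of two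
  alternating functions, is a signed sum of six permanents \<open>M\<close>. As \<open>D\<close> is
  the square of \<open>V\<close>, \<open>w * alt\<close> is \<open>dp\<close> times
  \<open>V * alt\<close> divided by \<open>D\<close>.\<close>

global_interpretation B: averaging YR "Kf Inv_alg" lamf "{vecf}"
proof
  show "c \<in> {vecf} \<Longrightarrow> d \<in> {vecf} \<Longrightarrow> (\<lambda>y. \<Sum>i\<in>UNIV. lamf y i ^ n * (c y i * d y i)) \<in> Kf Inv_alg" for c d n
    using Kf_vecf by simp
  fix c1 c2 c3 :: "slice_point \<Rightarrow> 3 \<Rightarrow> real" and n1 n2 n3 :: nat
  assume "c1 \<in> {vecf}" "c2 \<in> {vecf}" "c3 \<in> {vecf}"
  then have c: "c1 = vecf" "c2 = vecf" "c3 = vecf" by simp_all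
  define M where "M a b c y = (\<Sum>\<pi>\<in>perms. (lamf y (\<pi> 1) ^ (n1 + a)) * (lamf y (\<pi> 2) ^ (n2 + b)) *
    (lamf y (\<pi> 3) ^ (n3 + c)))" for a b c y
  have M: "M a b c \<in> Kf Inv_alg" for a b c
    unfolding M_def
    by (rule base_B.permanent_in_K) (use base_B.EV.mon[OF base_B.K_const[of 1]] in simp_all)
  define D where "D y = ((lamf y 1 - lamf y 2) * (lamf y 2 - lamf y 3) * (lamf y 3 - lamf y 1))\<^sup>2" for y
  have D: "(\<lambda>y. inverse (D y)) \<in> Kf Inv_alg" unfolding D_def by (rule base_B.K_inv)
  have "(\<lambda>y. (ev (spt y) dp * inverse (D y)) * ((((((M 0 1 2 y - M 0 2 1 y) - M 1 0 2 y) + M 2 0 1 y) +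
    M 1 2 0 y) - M 2 1 0 y))) \<in> Kf Inv_alg"
    by (intro base_B.K_mult base_B.K_add base_B.K_diff M D Kf_poly Inv_alg.dp)
  then show "(\<lambda>y. \<Sum>\<pi>\<in>perms. of_int (sign \<pi>) * (c1 y (\<pi> 1) * lamf y (\<pi> 1) ^ n1) *
    (c2 y (\<pi> 2) * lamf y (\<pi> 2) ^ n2) * (c3 y (\<pi> 3) * lamf y (\<pi> 3) ^ n3)) \<in> Kf Inv_alg"
  proof (rule Kf_cong)
    fix y assume y: "y \<in> YR"
    define a b c where abc: "a = lamf y 1" "b = lamf y 2" "c = lamf y 3"
    define V where "V = (b - a) * (c - a) * (c - b)"
    define w where "w = vecf y 1 * vecf y 2 * vecf y 3"
    define alt where "alt = (\<Sum>\<pi>\<in>perms. of_int (sign \<pi>) * lamf y (\<pi> 1) ^ n1 * lamf y (\<pi> 2) ^ n2 * lamf y (\<pi> 3) ^ n3)"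
    define p1 p2 p3 p4 p5 p6 where p: "p1 = a ^ n1 * b ^ n2 * c ^ n3" "p2 = a ^ n1 * c ^ n2 * b ^ n3"
      "p3 = b ^ n1 * a ^ n2 * c ^ n3" "p4 = b ^ n1 * c ^ n2 * a ^ n3"
      "p5 = c ^ n1 * a ^ n2 * b ^ n3" "p6 = c ^ n1 * b ^ n2 * a ^ n3"
    have alt: "alt = p1 - p2 - p3 + p4 + p5 - p6"
      unfolding alt_def sum_perms_3[of "\<lambda>i j k s. s * lamf y i ^ n1 * lamf y j ^ n2 * lamf y k ^ n3"] p abc by simp
    have Me: "M i j k y = p1 * (a ^ i * b ^ j * c ^ k) + p2 * (a ^ i * c ^ j * b ^ k)
      + p3 * (b ^ i * a ^ j * c ^ k) + p4 * (b ^ i * c ^ j * a ^ k)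
      + p5 * (c ^ i * a ^ j * b ^ k) + p6 * (c ^ i * b ^ j * a ^ k)" for i j k
      unfolding M_def sum_perms_3[of "\<lambda>i' j' k' s. (lamf y i' ^ (n1 + i)) * (lamf y j' ^ (n2 + j)) * (lamf y k' ^ (n3 + k))"] p abc
      by (simp only: power_add mult_ac)
    have key: "((((M 0 1 2 y - M 0 2 1 y) - M 1 0 2 y) + M 2 0 1 y) + M 1 2 0 y) - M 2 1 0 y = V * alt"
      unfolding Me alt V_def by (simp add: power2_eq_square algebra_simps)
    have "D y = V * V" unfolding D_def V_def abc by (simp add: power2_eq_square algebra_simps)
    moreover have V: "V \<noteq> 0" using YR_dist[OF y] by (auto simp: V_def abc)
    moreover have "ev (spt y) dp = w * V" by (simp add: ev_spt_dp[OF y] w_def V_def abc)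
    ultimately have "(ev (spt y) dp * inverse (D y)) * (V * alt) = (w * V * inverse (V * V)) * (V * alt)"
      by (simp only:)
    also have "\<dots> = w * alt * ((V * V) * inverse (V * V))" by (simp only: mult_ac)
    also have "(V * V) * inverse (V * V) = 1" by (rule right_inverse) (use V in simp)
    finally have "(ev (spt y) dp * inverse (D y)) * (V * alt) = w * alt" by simp
    moreover have "(\<Sum>\<pi>\<in>perms. of_int (sign \<pi>) * (c1 y (\<pi> 1) * lamf y (\<pi> 1) ^ n1) *
      (c2 y (\<pi> 2) * lamf y (\<pi> 2) ^ n2) * (c3 y (\<pi> 3) * lamf y (\<pi> 3) ^ n3)) = w * alt"
      unfolding c sum_perms_3[of "\<lambda>i j k s. s * (vecf y i * lamf y i ^ n1) * (vecf y j * lamf y j ^ n2) * (vecf y k * lamf y k ^ n3)"]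
        alt w_def p abc by (simp add: algebra_simps)
    ultimately show "(\<Sum>\<pi>\<in>perms. of_int (sign \<pi>) * (c1 y (\<pi> 1) * lamf y (\<pi> 1) ^ n1) *
      (c2 y (\<pi> 2) * lamf y (\<pi> 2) ^ n2) * (c3 y (\<pi> 3) * lamf y (\<pi> 3) ^ n3)) =
      (ev (spt y) dp * inverse (D y)) * ((((((M 0 1 2 y - M 0 2 1 y) - M 1 0 2 y) + M 2 0 1 y) + M 1 2 0 y) - M 2 1 0 y))"
      unfolding key by (simp only:)
  qed
qed

text \<open>All polynomials may serve as coefficients here, so the entries of the eigenvectors can
  be taken as odd functions. The products required by the locale are then entries of powers of the
  matrix and determinants of such entries.\<close>

global_interpretation T: averaging YR "Kf UNIV" lamf "range rotf"
proof (intro averaging.intro averaging_base_Kf averaging_axioms.intro)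
  show "(\<lambda>y. \<Sum>i\<in>UNIV. lamf y i ^ n) \<in> Kf UNIV" for n
    by (rule Kf_cong[OF Kf_poly[of "tp n"]]) (auto simp: ev_spt_tp)
  show "c \<in> range rotf \<Longrightarrow> d \<in> range rotf \<Longrightarrow> (\<lambda>y. \<Sum>i\<in>UNIV. lamf y i ^ n * (c y i * d y i)) \<in> Kf UNIV" for c d n
  proof -
    assume "c \<in> range rotf" "d \<in> range rotf"
    then obtain a b where "c = rotf a" "d = rotf b" by auto
    then show ?thesis
      by (intro Kf_cong[OF Kf_poly[of "mpow generic_matrix n $ a $ b"]]) (auto simp: ev_spt_mpow)
  qed
  fix c1 c2 c3 :: "slice_point \<Rightarrow> 3 \<Rightarrow> real" and n1 n2 n3 :: nat
  assume "c1 \<in> range rotf" "c2 \<in> range rotf" "c3 \<in> range rotf"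
  then obtain a1 a2 a3 where c: "c1 = rotf a1" "c2 = rotf a2" "c3 = rotf a3" by auto
  define a where "a i = (if i = 1 then a1 else if i = 2 then a2 else a3)" for i :: 3
  define n where "n i = (if i = 1 then n1 else if i = 2 then n2 else n3)" for i :: 3
  have "(\<lambda>y. ev (spt y) (det (\<chi> i b. mpow generic_matrix (n i) $ a i $ b))) \<in> Kf UNIV"
    by (rule Kf_poly) simp
  then show "(\<lambda>y. \<Sum>\<pi>\<in>perms. of_int (sign \<pi>) * (c1 y (\<pi> 1) * lamf y (\<pi> 1) ^ n1) *
    (c2 y (\<pi> 2) * lamf y (\<pi> 2) ^ n2) * (c3 y (\<pi> 3) * lamf y (\<pi> 3) ^ n3)) \<in> Kf UNIV"
  proof (rule Kf_cong)
    fix y assume y: "y \<in> YR"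
    define M where "M = (\<chi> i j. rotf (a i) y j * lamf y j ^ n i)"
    have "(\<Sum>\<pi>\<in>perms. of_int (sign \<pi>) * (c1 y (\<pi> 1) * lamf y (\<pi> 1) ^ n1) *
      (c2 y (\<pi> 2) * lamf y (\<pi> 2) ^ n2) * (c3 y (\<pi> 3) * lamf y (\<pi> 3) ^ n3)) = det M"
      unfolding det_def perms_def c M_def
      by (intro sum.cong refl) (simp add: prod_3 a_def n_def mult_ac)
    \<comment> \<open>The rotation has determinant one, and multiplying by its transpose turns the
      rows of weighted eigenvector entries into rows of powers of the matrix.\<close>
    also have "det M = det (M ** transpose (fst y))"
      by (simp add: det_mul rotation_matrixD[OF YR_rot[OF y]])
    also have "M ** transpose (fst y) = (\<chi> i b. ev (spt y) (mpow generic_matrix (n i) $ a i $ b))"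
      by (simp add: vec_eq_iff matrix_matrix_mult_def M_def transpose_def ev_spt_mpow[OF y] rotf_def mult_ac)
    finally show "(\<Sum>\<pi>\<in>perms. of_int (sign \<pi>) * (c1 y (\<pi> 1) * lamf y (\<pi> 1) ^ n1) *
      (c2 y (\<pi> 2) * lamf y (\<pi> 2) ^ n2) * (c3 y (\<pi> 3) * lamf y (\<pi> 3) ^ n3)) =
      ev (spt y) (det (\<chi> i b. mpow generic_matrix (n i) $ a i $ b))"
      by (simp add: evl_det)
  qed
qed (rule UNIV_I)+

context averaging
begin

lemma TT_evl:
  assumes "\<And>c. (\<lambda>y \<pi> \<epsilon>. F y \<pi> \<epsilon> c) \<in> TT"
  shows "(\<lambda>y \<pi> \<epsilon>. evl (F y \<pi> \<epsilon>) P) \<in> TT"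
proof (induction P rule: real_poly_induct)
  case (const r)
  show ?case using TT_const[of r] by simp
next
  case (var c)
  show ?case using assms[of c] by simp
next
  case (add P P')
  show ?case using TT.add[OF add] by simp
next
  case (mult P P')
  show ?case using TT_mult[OF mult] by simp
qed

lemma TT_sum: "(\<And>j. j \<in> I \<Longrightarrow> t j \<in> TT) \<Longrightarrow> (\<lambda>y \<pi> \<epsilon>. \<Sum>j\<in>I. t j y \<pi> \<epsilon>) \<in> TT"
proof (induction I rule: infinite_finite_induct)
  case (insert a F)
  have "(\<lambda>y \<pi> \<epsilon>. t a y \<pi> \<epsilon> + (\<Sum>j\<in>F. t j y \<pi> \<epsilon>)) \<in> TT"
    by (rule TT.add) (use insert in simp_all)
  then show ?case using insert by simp
qed (simp_all add: TT_const)

lemma TT_prod: "(\<And>j. j \<in> I \<Longrightarrow> t j \<in> TT) \<Longrightarrow> (\<lambda>y \<pi> \<epsilon>. \<Prod>j\<in>I. t j y \<pi> \<epsilon>) \<in> TT"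
proof (induction I rule: infinite_finite_induct)
  case (insert a F)
  have "(\<lambda>y \<pi> \<epsilon>. t a y \<pi> \<epsilon> * (\<Prod>j\<in>F. t j y \<pi> \<epsilon>)) \<in> TT"
    by (rule TT_mult) (use insert in simp_all)
  then show ?case using insert by simp
qed (simp_all add: TT_const)

end

text \<open>The slice point moved by \<open>wmat \<pi> \<epsilon>\<close>, as
  \<open>ract_wmat\<close> confirms, in coordinates that exhibit membership in
  \<open>TT\<close>.\<close>

definition wslice :: "(3 \<Rightarrow> 3) \<Rightarrow> (3 \<Rightarrow> real) \<Rightarrow> slice_point \<Rightarrow> (real^3) \<times> (real^3^3)"
  where "wslice \<pi> \<epsilon> y = ((\<chi> i. \<epsilon> i * vecf y (\<pi> i)), diag (\<chi> i. lamf y (\<pi> i)))"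

lemma TT_point:
  assumes "averaging YR K lamf C"
    and v: "\<And>i. (\<lambda>y \<pi> \<epsilon>. \<epsilon> i * vecf y (\<pi> i)) \<in> averaging.TT YR K lamf C"
  shows "(\<lambda>y \<pi> \<epsilon>. ev (ract g (wslice \<pi> \<epsilon> y)) P) \<in> averaging.TT YR K lamf C"
proof -
  interpret averaging YR K lamf C by fact
  have f: "(\<lambda>y \<pi> \<epsilon>. fst (ract g (wslice \<pi> \<epsilon> y)) $ i) \<in> TT" for i
  proof -
    have "(\<lambda>y \<pi> \<epsilon>. \<Sum>k\<in>UNIV. g $ i $ k * (\<epsilon> k * vecf y (\<pi> k))) \<in> TT"
      by (rule TT_sum, rule TT_mult, rule TT_const, rule v)
    then show ?thesis by (simp add: ract_def wslice_def matrix_vector_mult_def)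
  qed
  have s: "(\<lambda>y \<pi> \<epsilon>. snd (ract g (wslice \<pi> \<epsilon> y)) $ i $ j) \<in> TT" for i j
  proof -
    have "(\<lambda>y \<pi> \<epsilon>. \<Sum>k\<in>UNIV. g $ i $ k * g $ j $ k * lamf y (\<pi> k)) \<in> TT"
      by (rule TT_sum, rule TT_mult, rule TT_mult, (rule TT_const)+, rule TT_lam)
    then show ?thesis by (simp add: ract_def wslice_def conj_diag)
  qed
  show ?thesis
  proof (rule TT_evl)
    show "(\<lambda>y \<pi> \<epsilon>. cval c (ract g (wslice \<pi> \<epsilon> y))) \<in> TT" for c
      by (cases c) (simp_all add: f s)
  qed
qed

lemma TT_B_point: "(\<lambda>y \<pi> \<epsilon>. ev (ract g (wslice \<pi> \<epsilon> y)) P) \<in> B.TT"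
  by (rule TT_point[OF B.averaging_axioms]) (rule B.TT_C, simp)

text \<open>Undoing the rotation shows the coordinates in the eigenbasis to be combinations of
  eigenvector entries with polynomial coefficients, so they are available in \<open>T\<close>, where
  only \<open>rotf\<close> generates.\<close>

lemma vecf_rotf: "y \<in> YR \<Longrightarrow> vecf y i = (\<Sum>a\<in>UNIV. rotf a y i * fst (spt y) $ a)"
proof -
  assume y: "y \<in> YR"
  have "transpose (fst y) *v (fst y *v fst (snd y)) = fst (snd y)"
    unfolding matrix_vector_mul_assoc rotation_matrixD(1)[OF YR_rot[OF y]] by simp
  from arg_cong[OF this, of "\<lambda>v. v $ i"] show ?thesis
    unfolding matrix_vector_mult_def[of "transpose (fst y)"]
    by (simp add: transpose_def rotf_def vecf_def spt_def ract_def slp_def)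
qed

lemma TT_T_point: "(\<lambda>y \<pi> \<epsilon>. ev (ract g (wslice \<pi> \<epsilon> y)) P) \<in> T.TT"
proof (rule TT_point[OF T.averaging_axioms])
  fix i
  have K: "(\<lambda>y. fst (spt y) $ a) \<in> Kf UNIV" for a
    by (rule Kf_cong[OF Kf_poly[of "gen_vec $ a"]]) (auto simp: ev_gen_vec[of "fst (spt y)" "snd (spt y)" for y, simplified])
  have "(\<lambda>y \<pi> \<epsilon>. \<Sum>a\<in>UNIV. (\<epsilon> i * rotf a y (\<pi> i)) * fst (spt y) $ a) \<in> T.TT"
    by (rule T.TT_sum, rule T.TT_mult, rule T.TT_C, rule rangeI, rule T.TT_K, rule K)
  then show "(\<lambda>y \<pi> \<epsilon>. \<epsilon> i * vecf y (\<pi> i)) \<in> T.TT"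
    by (rule T.TT.ext) (simp add: vecf_rotf sum_distrib_left mult.assoc)
qed

section \<open>Signed permutation matrices\<close>

definition wmat :: "(3 \<Rightarrow> 3) \<Rightarrow> (3 \<Rightarrow> 'a) \<Rightarrow> 'a::comm_ring_1^3^3"
  where "wmat \<pi> \<epsilon> = (\<chi> i j. if j = \<pi> i then \<epsilon> i else 0)"

text \<open>The condition on the product of the signs is determinant one. This is the group of 24
  rotations of a cube, which maps diagonal matrices to diagonal matrices.\<close>

definition Wset :: "(real^3^3) set"
  where "Wset = {wmat \<pi> \<epsilon> | \<pi> \<epsilon>. \<pi> \<in> perms \<and> (\<forall>i. \<epsilon> i * \<epsilon> i = 1) \<and> (\<Prod>i\<in>UNIV. \<epsilon> i) = of_int (sign \<pi>)}"

lemma perms_inj: "\<pi> \<in> perms \<Longrightarrow> \<pi> i = \<pi> j \<longleftrightarrow> i = j"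
  using permutes_inj[of \<pi> UNIV] by (auto simp: perms_def inj_def)

lemma sum_wmat: "(\<Sum>k\<in>UNIV. wmat \<pi> \<epsilon> $ i $ k * f k) = \<epsilon> i * f (\<pi> i)"
proof -
  have "(\<Sum>k\<in>UNIV. (if k = \<pi> i then \<epsilon> i else 0) * f k) = (\<Sum>k\<in>{\<pi> i}. \<epsilon> i * f k)"
    by (rule sum.mono_neutral_cong_right) auto
  then show ?thesis by (simp add: wmat_def)
qed

lemma ract_wmat_diag:
  assumes "\<pi> \<in> perms" "\<And>i. \<epsilon> i * \<epsilon> i = 1"
  shows "ract (wmat \<pi> \<epsilon>) (v, diag l) = ((\<chi> i. \<epsilon> i * v $ \<pi> i), diag (\<chi> i. l $ \<pi> i))"
proof -
  have "(wmat \<pi> \<epsilon> ** diag l ** transpose (wmat \<pi> \<epsilon>)) $ i $ j = (if i = j then l $ \<pi> i else 0)" for l i j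
    unfolding conj_diag mult.assoc sum_wmat using assms perms_inj[of \<pi> i j]
    by (simp add: wmat_def mult.assoc[symmetric] eq_commute[of "\<pi> i"])
  then show ?thesis
    by (simp add: ract_def vec_eq_iff matrix_vector_mult_def sum_wmat) (simp add: diag_def)
qed

lemma ract_wmat:
  assumes "\<pi> \<in> perms" "\<And>i. \<epsilon> i * \<epsilon> i = 1"
  shows "ract (wmat \<pi> \<epsilon>) (slp y) = wslice \<pi> \<epsilon> y"
  unfolding slp_def ract_wmat_diag[OF assms] by (simp add: wslice_def vecf_def lamf_def)

lemma wmat_mult: "wmat \<pi> \<epsilon> ** wmat \<pi>' \<epsilon>' = wmat (\<pi>' \<circ> \<pi>) (\<lambda>i. \<epsilon> i * \<epsilon>' (\<pi> i))"
  by (simp add: vec_eq_iff matrix_matrix_mult_def sum_wmat) (simp add: wmat_def)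

lemma eps_square: "a \<in> {1, -1} \<Longrightarrow> b \<in> {1, -1} \<Longrightarrow> eps a b \<pi> i * eps a b \<pi> i = 1"
  by (auto simp: eps_def sign_def)

lemma wmat_eps_Wset: "\<pi> \<in> perms \<Longrightarrow> a \<in> {1, -1} \<Longrightarrow> b \<in> {1, -1} \<Longrightarrow> wmat \<pi> (eps a b \<pi>) \<in> Wset"
  unfolding Wset_def using eps_square[of a b \<pi>]
  by (intro CollectI exI[of _ \<pi>] exI[of _ "eps a b \<pi>"]) (auto simp: prod_3 eps_def)

lemma wmat_rotation:
  fixes \<epsilon> :: "3 \<Rightarrow> 'a::field"
  assumes s: "\<pi> \<in> perms" "\<And>i. \<epsilon> i * \<epsilon> i = 1" "(\<Prod>i\<in>UNIV. \<epsilon> i) = of_int (sign \<pi>)"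
  shows "rotation_matrix (wmat \<pi> \<epsilon>)"
proof -
  let ?s = "wmat \<pi> \<epsilon>"
  have "(?s ** transpose ?s) $ i $ j = mat 1 $ i $ j" for i j
  proof -
    have "(?s ** transpose ?s) $ i $ j = (\<Sum>k\<in>UNIV. wmat \<pi> \<epsilon> $ i $ k * wmat \<pi> \<epsilon> $ j $ k)"
      by (simp add: matrix_matrix_mult_def transpose_def)
    also have "\<dots> = mat 1 $ i $ j"
      unfolding sum_wmat using s(2)[of i] perms_inj[OF s(1), of i j] by (auto simp: wmat_def mat_def)
    finally show ?thesis .
  qed
  then have o: "?s ** transpose ?s = mat 1" by (simp add: vec_eq_iff)
  have "?s = (\<chi> i. \<epsilon> i *s (mat 1 $ \<pi> i))"
    by (simp add: vec_eq_iff wmat_def mat_def)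
  then have "det ?s = prod \<epsilon> UNIV * det (\<chi> i. mat 1 $ \<pi> i :: 'a^3^3)" by (simp only: det_rows_mul)
  also have "det (\<chi> i. mat 1 $ \<pi> i :: 'a^3^3) = of_int (sign \<pi>)"
    using det_permute_rows[of \<pi> "mat 1 :: 'a^3^3"] s(1) by (simp add: perms_def)
  finally have "det ?s = 1" unfolding s(3) by (simp add: sign_def)
  then show ?thesis using o matrix_left_right_inverse[of ?s "transpose ?s"]
    by (simp add: rotation_matrix_def orthogonal_matrix_def)
qed

lemma Wset_rotation: "\<sigma> \<in> Wset \<Longrightarrow> rotation_matrix \<sigma>"
  unfolding Wset_def by (auto intro: wmat_rotation)

lemma Wset_mult:
  assumes "\<sigma> \<in> Wset" "\<tau> \<in> Wset" shows "\<sigma> ** \<tau> \<in> Wset"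
proof -
  obtain \<pi> \<epsilon> where s: "\<sigma> = wmat \<pi> \<epsilon>" "\<pi> \<in> perms" "\<And>i. \<epsilon> i * \<epsilon> i = 1"
    "(\<Prod>i\<in>UNIV. \<epsilon> i) = of_int (sign \<pi>)"
    using assms(1) unfolding Wset_def by blast
  obtain \<pi>' \<epsilon>' where t: "\<tau> = wmat \<pi>' \<epsilon>'" "\<pi>' \<in> perms" "\<And>i. \<epsilon>' i * \<epsilon>' i = 1"
    "(\<Prod>i\<in>UNIV. \<epsilon>' i) = of_int (sign \<pi>')"
    using assms(2) unfolding Wset_def by blast
  have p: "permutation \<pi>" "permutation \<pi>'"
    using s(2) t(2) permutes_imp_permutation[OF finite] by (auto simp: perms_def)
  have "\<pi>' \<circ> \<pi> \<in> perms" using s(2) t(2) by (auto simp: perms_def intro: permutes_compose)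
  moreover have "(\<epsilon> i * \<epsilon>' (\<pi> i)) * (\<epsilon> i * \<epsilon>' (\<pi> i)) = 1" for i
  proof -
    have "(\<epsilon> i * \<epsilon>' (\<pi> i)) * (\<epsilon> i * \<epsilon>' (\<pi> i)) = (\<epsilon> i * \<epsilon> i) * (\<epsilon>' (\<pi> i) * \<epsilon>' (\<pi> i))"
      by (simp only: mult_ac)
    then show ?thesis using s(3) t(3) by simp
  qed
  moreover have "(\<Prod>i\<in>UNIV. \<epsilon>' (\<pi> i)) = (\<Prod>i\<in>UNIV. \<epsilon>' i)"
    by (rule prod.reindex_bij_betw) (use s(2) in \<open>simp add: perms_def permutes_bij\<close>)
  then have "(\<Prod>i\<in>UNIV. \<epsilon> i * \<epsilon>' (\<pi> i)) = of_int (sign (\<pi>' \<circ> \<pi>))"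
    using sign_compose[OF p(2,1)] by (simp add: prod.distrib s(4) t(4))
  ultimately show ?thesis unfolding s(1) t(1) wmat_mult Wset_def by blast
qed

lemma finite_Wset: "finite Wset"
proof (rule finite_subset)
  let ?f = "\<lambda>(\<pi>, a, b). wmat \<pi> (eps a b \<pi>)"
  have "finite perms" unfolding perms_def by (rule finite_permutations) simp
  then show "finite (?f ` (perms \<times> {1, -1} \<times> {1, -1}))" by simp
  show "Wset \<subseteq> ?f ` (perms \<times> {1, -1} \<times> {1, -1})"
  proof
    fix \<sigma> assume "\<sigma> \<in> Wset"
    then obtain \<pi> \<epsilon> where s: "\<sigma> = wmat \<pi> \<epsilon>" "\<pi> \<in> perms" "\<And>i. \<epsilon> i * \<epsilon> i = 1"
      "(\<Prod>i\<in>UNIV. \<epsilon> i) = of_int (sign \<pi>)"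
      unfolding Wset_def by blast
    have m: "\<epsilon> i \<in> {1, -1}" for i using s(3)[of i] by (simp add: square_eq_1_iff)
    have "\<epsilon> i = eps (\<epsilon> 1) (\<epsilon> 2) \<pi> i" for i
      using exhaust_3[of i] s(4) m[of 1] m[of 2] by (auto simp: eps_def prod_3)
    then have "\<epsilon> = eps (\<epsilon> 1) (\<epsilon> 2) \<pi>" by (rule ext)
    then have "\<sigma> = ?f (\<pi>, \<epsilon> 1, \<epsilon> 2)"
      unfolding s(1) prod.case by (rule arg_cong)
    then show "\<sigma> \<in> ?f ` (perms \<times> {1, -1} \<times> {1, -1})" using s(2) m by blast
  qed
qed

lemma mat1_Wset: "mat 1 \<in> Wset"
proof -
  have "id \<in> perms" by (simp add: perms_def permutes_id)
  then have "wmat id (eps 1 1 id) \<in> Wset" by (intro wmat_eps_Wset) auto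
  moreover have "wmat id (eps 1 1 id) = mat 1"
    by (auto simp: wmat_def mat_def vec_eq_iff eps_def sign_id)
  ultimately show ?thesis by simp
qed

lemma avg_const:
  assumes "\<And>\<pi> \<epsilon>. \<pi> \<in> perms \<Longrightarrow> (\<And>i. \<epsilon> i * \<epsilon> i = 1) \<Longrightarrow> wmat \<pi> \<epsilon> \<in> Wset \<Longrightarrow> t y \<pi> \<epsilon> = c"
  shows "avg t y = 24 * c"
proof -
  have "avg t y = (\<Sum>\<pi>\<in>perms. \<Sum>a\<in>{1::real, -1}. \<Sum>b\<in>{1::real, -1}. c)"
    unfolding avg_def
    by (intro sum.cong refl assms wmat_eps_Wset) (auto simp: eps_square[simplified])
  also have "\<dots> = (\<Sum>\<pi>\<in>perms. 4 * c)" by simp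
  also have "\<dots> = 24 * c" using sum_perms_3[of "\<lambda>i j k s. 4 * c"] by simp
  finally show ?thesis .
qed

text \<open>An invariant polynomial is its own average over the stabilizer of the slice.\<close>

lemma invariant_in_Inv_alg:
  assumes inv: "\<And>(g :: real^3^3) v A. rotation_matrix g \<Longrightarrow> transpose A = A \<Longrightarrow> ev (ract g (v, A)) P = ev (v, A) P"
  shows "\<exists>n. P * Discr ^ n \<in> Inv_alg"
proof -
  define t where "t = (\<lambda>y \<pi> \<epsilon>. ev (ract (mat 1) (wslice \<pi> \<epsilon> y)) P)"
  have "avg t \<in> Kf Inv_alg" unfolding t_def by (intro B.avg_in_K TT_B_point)
  then obtain Q n where Q: "Q \<in> Inv_alg" "\<And>y. y \<in> YR \<Longrightarrow> avg t y * ev (spt y) Discr ^ n = ev (spt y) Q"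
    by (erule KfE)
  have "P * Discr ^ n = Const (1/24) * Q"
  proof (rule spt_dense)
    fix y assume y: "y \<in> YR"
    have "avg t y = 24 * ev (spt y) P"
    proof (rule avg_const)
      fix \<pi> \<epsilon> assume w: "\<pi> \<in> perms" "\<And>i. \<epsilon> i * \<epsilon> i = 1" "wmat \<pi> \<epsilon> \<in> Wset"
      have "t y \<pi> \<epsilon> = ev (ract (wmat \<pi> \<epsilon>) (slp y)) P" by (simp add: t_def ract_mat1 ract_wmat[OF w(1,2)])
      also have "\<dots> = ev (slp y) P"
        unfolding slp_def by (rule inv[OF Wset_rotation[OF w(3)] diag_symmetric])
      also have "\<dots> = ev (spt y) P" by (rule ev_spt_invariant[OF y inv, symmetric])
      finally show "t y \<pi> \<epsilon> = ev (spt y) P" .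
    qed
    then show "ev (spt y) (P * Discr ^ n) = ev (spt y) (Const (1/24) * Q)"
      using Q(2)[OF y] by simp
  qed
  then show ?thesis using Q(1) Inv_alg.mult[OF Inv_alg.const] by metis
qed

section \<open>Interpolation along the rotation group\<close>

inductive_set MF :: "((real^3^3) \<Rightarrow> real) set" where
  const: "(\<lambda>g. r) \<in> MF"
| entry: "(\<lambda>g. g $ i $ j) \<in> MF"
| add: "f \<in> MF \<Longrightarrow> h \<in> MF \<Longrightarrow> (\<lambda>g. f g + h g) \<in> MF"
| mult: "f \<in> MF \<Longrightarrow> h \<in> MF \<Longrightarrow> (\<lambda>g. f g * h g) \<in> MF"

lemma MF_sum: "finite A \<Longrightarrow> (\<And>a. a \<in> A \<Longrightarrow> f a \<in> MF) \<Longrightarrow> (\<lambda>g. \<Sum>a\<in>A. f a g) \<in> MF"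
  by (induction A rule: finite_induct) (simp_all add: MF.const MF.add)

text \<open>Each function that is not yet interpolated supplies a new node where its remainder does not vanish.\<close>

lemma interpolation_nodes:
  assumes "finite Ms" "Ms \<subseteq> MF"
  shows "\<exists>r \<gamma> c. (\<forall>j<r::nat. \<gamma> j \<in> G \<and> c j \<in> MF) \<and>
    (\<forall>m\<in>Ms. \<forall>g\<in>G. m g = (\<Sum>j<r. c j g * m (\<gamma> j)))"
  using assms
proof (induction Ms rule: finite_induct)
  case empty
  show ?case by (intro exI[of _ 0]) simp
next
  case (insert m Ms)
  then obtain r \<gamma> c where IH0: "(\<forall>j<r::nat. \<gamma> j \<in> G \<and> c j \<in> MF) \<and>
    (\<forall>m\<in>Ms. \<forall>g\<in>G. m g = (\<Sum>j<r. c j g * m (\<gamma> j)))" by blast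
  then have IH: "\<And>j. j < (r::nat) \<Longrightarrow> \<gamma> j \<in> G" "\<And>j. j < r \<Longrightarrow> c j \<in> MF"
    "\<And>m g. m \<in> Ms \<Longrightarrow> g \<in> G \<Longrightarrow> m g = (\<Sum>j<r. c j g * m (\<gamma> j))" by auto
  define m' where "m' g = m g - (\<Sum>j<r. c j g * m (\<gamma> j))" for g
  show ?case
  proof (cases "\<forall>g\<in>G. m' g = 0")
    case True
    then show ?thesis using IH by (intro exI[of _ r] exI[of _ \<gamma>] exI[of _ c]) (auto simp: m'_def)
  next
    case False
    then obtain h where h: "h \<in> G" "m' h \<noteq> 0" by auto
    \<comment> \<open>\<open>e\<close> is the remainder of \<open>m\<close>, scaled to be 1 at the
      new node \<open>h\<close>. By \<open>split\<close> the corrected coefficients add to an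
      expansion of \<open>k\<close> the function \<open>e\<close> times the error of that expansion
      at \<open>h\<close>: zero for the functions already treated, and exactly the missing remainder
      for \<open>m\<close>.\<close>
    define e where "e g = m' g * inverse (m' h)" for g
    define c' where "c' j = (if j < r then (\<lambda>g. c j g + (- c j h) * e g) else e)" for j
    define \<gamma>' where "\<gamma>' j = (if j < r then \<gamma> j else h)" for j
    have "m' = (\<lambda>g. m g + (\<Sum>j<r. c j g * (- m (\<gamma> j))))"
      by (simp add: m'_def fun_eq_iff sum_negf)
    moreover have "(\<lambda>g. m g + (\<Sum>j<r. c j g * (- m (\<gamma> j)))) \<in> MF"
      by (rule MF.add, use insert.prems in simp, rule MF_sum, simp, rule MF.mult, rule IH(2), simp, rule MF.const)
    ultimately have "m' \<in> MF" by simp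
    then have e: "e \<in> MF" unfolding e_def by (rule MF.mult[OF _ MF.const])
    have c': "c' j \<in> MF" for j
      unfolding c'_def using e MF.add[OF IH(2) MF.mult[OF MF.const[of "- c j h"] e], of j] by simp
    have split: "(\<Sum>j<Suc r. c' j g * k (\<gamma>' j)) = (\<Sum>j<r. c j g * k (\<gamma> j)) + e g * (k h - (\<Sum>j<r. c j h * k (\<gamma> j)))" for k g
    proof -
      have "(\<Sum>j<Suc r. c' j g * k (\<gamma>' j)) = (\<Sum>j<r. c' j g * k (\<gamma>' j)) + e g * k h"
        by (simp add: c'_def \<gamma>'_def)
      also have "(\<Sum>j<r. c' j g * k (\<gamma>' j)) = (\<Sum>j<r. c j g * k (\<gamma> j) - e g * (c j h * k (\<gamma> j)))"
        by (rule sum.cong) (auto simp: c'_def \<gamma>'_def algebra_simps)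
      also have "\<dots> = (\<Sum>j<r. c j g * k (\<gamma> j)) - e g * (\<Sum>j<r. c j h * k (\<gamma> j))"
        by (simp add: sum_subtractf sum_distrib_left)
      finally show ?thesis by (simp add: algebra_simps)
    qed
    have "k g = (\<Sum>j<Suc r. c' j g * k (\<gamma>' j))" if k: "k \<in> insert m Ms" and g: "g \<in> G" for k g
    proof (cases "k = m")
      case True
      have "e g * m' h = m' g" using h(2) by (simp add: e_def)
      then show ?thesis unfolding split True by (simp add: m'_def)
    next
      case False
      then have "k \<in> Ms" using k by simp
      then show ?thesis unfolding split using IH(3)[of k] h(1) g by simp
    qed
    moreover have "\<forall>j<Suc r. \<gamma>' j \<in> G \<and> c' j \<in> MF" using IH(1) h(1) c' by (auto simp: \<gamma>'_def)
    ultimately show ?thesis by (intro exI[of _ "Suc r"] exI[of _ \<gamma>'] exI[of _ c']) simp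
  qed
qed

text \<open>Finite sums of a polynomial in \<open>g\<close> times an arbitrary function of
  \<open>x\<close>. That the sums are finite expresses that the translates of a polynomial span a
  space of finite dimension.\<close>

inductive_set HF :: "((real^3^3) \<Rightarrow> 'x \<Rightarrow> real) set" where
  gen: "m \<in> MF \<Longrightarrow> (\<lambda>g x. m g * k x) \<in> HF"
| add: "f \<in> HF \<Longrightarrow> h \<in> HF \<Longrightarrow> (\<lambda>g x. f g x + h g x) \<in> HF"

lemma HF_mult:
  assumes "f \<in> HF" "h \<in> HF" shows "(\<lambda>g x. f g x * h g x) \<in> HF"
  using assms(1)
proof induction
  case (gen m k)
  note m = gen
  show ?case using assms(2)
  proof induction
    case (gen m' k')
    show ?case using HF.gen[OF MF.mult[OF m gen], of "\<lambda>x. k x * k' x"] by (simp add: mult_ac)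
  next
    case (add f h)
    show ?case using HF.add[OF add.IH] by (simp add: distrib_left)
  qed
next
  case (add f f')
  show ?case using HF.add[OF add.IH] by (simp add: distrib_right)
qed

lemma HF_sum: "finite A \<Longrightarrow> (\<And>a. a \<in> A \<Longrightarrow> f a \<in> HF) \<Longrightarrow> (\<lambda>g x. \<Sum>a\<in>A. f a g x) \<in> HF"
proof (induction A rule: finite_induct)
  case empty
  show ?case using HF.gen[OF MF.const[of 0], of "\<lambda>x. 0"] by simp
next
  case (insert a A)
  then show ?case by (simp add: HF.add)
qed

text \<open>\<open>h\<close> depends linearly on the finitely many functions of \<open>g\<close> in
  its expansion, so every interpolation formula valid for these holds for \<open>h\<close>. Nodes
  and coefficients are quantified inside because they are chosen only afterwards.\<close>

lemma HF_nodes: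
  assumes "h \<in> HF"
  shows "\<exists>Ms. finite Ms \<and> Ms \<subseteq> MF \<and> (\<forall>r \<gamma> c. (\<forall>m\<in>Ms. \<forall>g\<in>G. m g = (\<Sum>j<r::nat. c j g * m (\<gamma> j))) \<longrightarrow>
    (\<forall>g\<in>G. \<forall>x. h g x = (\<Sum>j<r. c j g * h (\<gamma> j) x)))"
  using assms
proof induction
  case (gen m k)
  show ?case
  proof (intro exI[of _ "{m}"] conjI allI impI ballI)
    fix r :: nat and \<gamma> c g x
    assume *: "\<forall>m\<in>{m}. \<forall>g\<in>G. m g = (\<Sum>j<r. c j g * m (\<gamma> j))" and g: "g \<in> G"
    have "m g = (\<Sum>j<r. c j g * m (\<gamma> j))" using * g by blast
    then show "m g * k x = (\<Sum>j<r. c j g * (m (\<gamma> j) * k x))"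
      by (simp add: sum_distrib_right mult.assoc)
  qed (use gen in auto)
next
  case (add f h)
  obtain M1 where M1: "finite M1" "M1 \<subseteq> MF" "\<forall>r \<gamma> c. (\<forall>m\<in>M1. \<forall>g\<in>G. m g = (\<Sum>j<r::nat. c j g * m (\<gamma> j))) \<longrightarrow>
    (\<forall>g\<in>G. \<forall>x. f g x = (\<Sum>j<r. c j g * f (\<gamma> j) x))" using add.IH(1) by (elim exE conjE) (rule that)
  obtain M2 where M2: "finite M2" "M2 \<subseteq> MF" "\<forall>r \<gamma> c. (\<forall>m\<in>M2. \<forall>g\<in>G. m g = (\<Sum>j<r::nat. c j g * m (\<gamma> j))) \<longrightarrow>
    (\<forall>g\<in>G. \<forall>x. h g x = (\<Sum>j<r. c j g * h (\<gamma> j) x))" using add.IH(2) by (elim exE conjE) (rule that)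
  show ?case
  proof (intro exI[of _ "M1 \<union> M2"] conjI allI impI ballI)
    fix r :: nat and \<gamma> c g x
    assume *: "\<forall>m\<in>M1 \<union> M2. \<forall>g\<in>G. m g = (\<Sum>j<r. c j g * m (\<gamma> j))" and g: "g \<in> G"
    have "\<forall>g\<in>G. \<forall>x. f g x = (\<Sum>j<r. c j g * f (\<gamma> j) x)"
      by (rule M1(3)[THEN spec, THEN spec, THEN spec, THEN mp]) (use * in simp)
    moreover have "\<forall>g\<in>G. \<forall>x. h g x = (\<Sum>j<r. c j g * h (\<gamma> j) x)"
      by (rule M2(3)[THEN spec, THEN spec, THEN spec, THEN mp]) (use * in simp)
    ultimately have "f g x = (\<Sum>j<r. c j g * f (\<gamma> j) x)" "h g x = (\<Sum>j<r. c j g * h (\<gamma> j) x)"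
      using g by auto
    then show "f g x + h g x = (\<Sum>j<r. c j g * (f (\<gamma> j) x + h (\<gamma> j) x))"
      by (simp add: distrib_left sum.distrib)
  qed (use M1 M2 in auto)
qed

lemma HF_ev: "(\<lambda>g x. ev (ract g x) P) \<in> HF"
proof -
  have fk: "(\<lambda>g x. g $ i $ k * F x) \<in> HF" for i k :: 3 and F :: "'x \<Rightarrow> real"
    by (rule HF.gen[OF MF.entry])
  have f: "(\<lambda>(g :: real^3^3) x. fst (ract g x) $ i) \<in> HF" for i
    using HF_sum[of UNIV "\<lambda>k g x. g $ i $ k * fst x $ k", OF finite fk]
    by (simp add: ract_def matrix_vector_mult_def)
  have s: "(\<lambda>(g :: real^3^3) x. snd (ract g x) $ i $ j) \<in> HF" for i j
  proof -
    have "(\<lambda>(g :: real^3^3) x. \<Sum>l\<in>UNIV. \<Sum>k\<in>UNIV. (g $ i $ k * g $ j $ l) * snd x $ k $ l) \<in> HF"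
      by (rule HF_sum[OF finite], rule HF_sum[OF finite], rule HF.gen, rule MF.mult, rule MF.entry, rule MF.entry)
    then show ?thesis
      by (simp add: ract_def matrix_matrix_mult_def transpose_def sum_distrib_left sum_distrib_right mult_ac)
  qed
  show ?thesis
  proof (induction P rule: real_poly_induct)
    case (const r)
    show ?case using HF.gen[OF MF.const[of r], of "\<lambda>x. 1"] by simp
  next
    case (var c)
    show ?case by (cases c) (simp_all add: f s)
  next
    case (add P P')
    show ?case using HF.add[OF add] by simp
  next
    case (mult P P')
    show ?case using HF_mult[OF mult] by simp
  qed
qed

text \<open>Replaces the variable rotation by finitely many fixed ones. This matters because the
  elementary symmetric functions descend to invariants only for a fixed rotation.\<close>

lemma interpolation:
  obtains r :: nat and \<gamma> c where "\<And>j. j < r \<Longrightarrow> rotation_matrix (\<gamma> j)" "\<And>j. j < r \<Longrightarrow> c j \<in> MF"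
    "\<And>g x. rotation_matrix g \<Longrightarrow> ev (ract g x) h = (\<Sum>j<r. c j g * ev (ract (\<gamma> j) x) h)"
proof -
  define G where "G = {g :: real^3^3. rotation_matrix g}"
  obtain Ms where Ms: "finite Ms" "Ms \<subseteq> MF" "\<forall>r \<gamma> c. (\<forall>m\<in>Ms. \<forall>g\<in>G. m g = (\<Sum>j<r::nat. c j g * m (\<gamma> j))) \<longrightarrow>
    (\<forall>g\<in>G. \<forall>x. ev (ract g x) h = (\<Sum>j<r. c j g * ev (ract (\<gamma> j) x) h))"
    using HF_nodes[OF HF_ev, of G h] by (elim exE conjE) (rule that)
  obtain r \<gamma> c where "\<forall>j<r::nat. \<gamma> j \<in> G \<and> c j \<in> MF" "\<forall>m\<in>Ms. \<forall>g\<in>G. m g = (\<Sum>j<r. c j g * m (\<gamma> j))"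
    using interpolation_nodes[OF Ms(1,2), of G] by (elim exE conjE) (rule that)
  note rgc = this
  have "\<forall>g\<in>G. \<forall>x. ev (ract g x) h = (\<Sum>j<r. c j g * ev (ract (\<gamma> j) x) h)"
    by (rule Ms(3)[THEN spec, THEN spec, THEN spec, THEN mp, OF rgc(2)])
  then have e: "ev (ract g x) h = (\<Sum>j<r. c j g * ev (ract (\<gamma> j) x) h)" if "rotation_matrix g" for g x
    using that unfolding G_def by blast
  show thesis by (rule that[of r \<gamma> c]) (use rgc(1) e in \<open>simp_all only: G_def mem_Collect_eq\<close>)
qed

text \<open>The argument is the rotation that takes the slice point moved by
  \<open>wmat \<pi> \<epsilon>\<close> back to \<open>spt y\<close>. Its entries are signed
  eigenvector entries, that is, the odd generators of \<open>T\<close>.\<close>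

lemma TT_T_MF:
  assumes "m \<in> MF" shows "(\<lambda>y \<pi> \<epsilon>. m (fst y ** transpose (wmat \<pi> \<epsilon>))) \<in> T.TT"
  using assms
proof induction
  case (entry a i)
  have "(fst y ** transpose (wmat \<pi> \<epsilon>)) $ a $ i = \<epsilon> i * rotf a y (\<pi> i)" for y \<pi> \<epsilon>
    using sum_wmat[of \<pi> \<epsilon> i "\<lambda>k. fst y $ a $ k"]
    by (simp add: matrix_matrix_mult_def transpose_def rotf_def mult.commute)
  then show ?case using T.TT_C[OF rangeI, of i a] by simp
qed (simp_all add: T.TT_const T.TT.add T.TT_mult)

section \<open>Elementary symmetric functions of an orbit\<close>

definition xval :: "real_poly \<Rightarrow> real^3^3 \<Rightarrow> real^3^3 \<Rightarrow> (real^3) \<times> (real^3^3) \<Rightarrow> real"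
  where "xval h g \<sigma> s = ev (ract g (ract \<sigma> s)) h"

definition esym :: "real_poly \<Rightarrow> real^3^3 \<Rightarrow> nat \<Rightarrow> (real^3) \<times> (real^3^3) \<Rightarrow> real"
  where "esym h g k s = (\<Sum>A\<in>{A. A \<subseteq> Wset \<and> card A = k}. \<Prod>\<sigma>\<in>A. xval h g \<sigma> s)"

lemma finite_subsets_Wset: "finite {A. A \<subseteq> Wset \<and> card A = k}"
  by (rule finite_subset[of _ "Pow Wset"]) (use finite_Wset in auto)

text \<open>Right multiplication by \<open>\<tau>\<close> permutes \<open>Wset\<close>, hence its
  subsets of size \<open>k\<close>.\<close>

lemma esym_Wset:
  assumes t: "\<tau> \<in> Wset" shows "esym h g k (ract \<tau> s) = esym h g k s"
proof -
  define r where "r \<sigma> = \<sigma> ** \<tau>" for \<sigma> :: "real^3^3"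
  have "r \<sigma> ** transpose \<tau> = \<sigma>" for \<sigma>
    by (simp add: r_def rotation_matrixD[OF Wset_rotation[OF t]] flip: matrix_mul_assoc)
  then have inj: "inj_on r A" for A by (rule inj_on_inverseI)
  have "r ` Wset \<subseteq> Wset" using Wset_mult[OF _ t] by (auto simp: r_def)
  then have rW: "r ` Wset = Wset" by (rule endo_inj_surj[OF finite_Wset _ inj])
  have bij: "bij_betw (image r) {A. A \<subseteq> Wset \<and> card A = k} {A. A \<subseteq> Wset \<and> card A = k}"
    unfolding bij_betw_def
  proof
    show "inj_on (image r) {A. A \<subseteq> Wset \<and> card A = k}"
      by (rule inj_onI) (simp add: inj_image_eq_iff[OF inj])
    show "image r ` {A. A \<subseteq> Wset \<and> card A = k} = {A. A \<subseteq> Wset \<and> card A = k}"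
    proof (intro equalityI subsetI)
      fix B assume "B \<in> image r ` {A. A \<subseteq> Wset \<and> card A = k}"
      then obtain A where A: "A \<subseteq> Wset" "card A = k" "B = r ` A" by auto
      then show "B \<in> {A. A \<subseteq> Wset \<and> card A = k}"
        using image_mono[OF A(1), of r] card_image[OF inj, of A] by (simp add: rW)
    next
      fix B assume B: "B \<in> {A. A \<subseteq> Wset \<and> card A = k}"
      then obtain A where A: "A \<subseteq> Wset" "B = r ` A" using rW subset_image_iff[of B r Wset] by auto
      then show "B \<in> image r ` {A. A \<subseteq> Wset \<and> card A = k}"
        using B card_image[OF inj, of A] by (intro image_eqI[of _ _ A]) simp_all
    qed
  qed
  have "(\<Prod>\<sigma>\<in>A. xval h g \<sigma> (ract \<tau> s)) = (\<Prod>\<sigma>\<in>r ` A. xval h g \<sigma> s)" for A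
    unfolding prod.reindex[OF inj] by (simp add: xval_def ract_ract r_def)
  then show ?thesis unfolding esym_def
    using sum.reindex_bij_betw[OF bij, of "\<lambda>A. \<Prod>\<sigma>\<in>A. xval h g \<sigma> s"] by simp
qed

text \<open>Expand the product over \<open>Wset\<close> of the differences
  \<open>x \<tau> - x \<sigma>\<close>, which has a zero factor, and solve for the leading power.
  The sum starts at 1, so every term on the right carries a proper elementary symmetric
  function.\<close>

lemma esym_root:
  assumes "\<tau> \<in> Wset"
  shows "xval h g \<tau> s ^ card Wset =
    (\<Sum>k\<in>{1..card Wset}. esym h g k s * (- ((-1) ^ k) * xval h g \<tau> s ^ (card Wset - k)))"
proof -
  define x where "x \<sigma> = xval h g \<sigma> s" for \<sigma>
  define n where "n = card Wset"
  have "0 = (\<Prod>\<sigma>\<in>Wset. - x \<sigma> + x \<tau>)"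
    by (rule prod_zero[symmetric, OF finite_Wset], rule bexI[OF _ assms]) simp
  also have "\<dots> = (\<Sum>A\<in>Pow Wset. (\<Prod>\<sigma>\<in>A. - x \<sigma>) * (\<Prod>\<sigma>\<in>Wset - A. x \<tau>))"
    by (rule prod_add[OF finite_Wset])
  also have "\<dots> = (\<Sum>A\<in>Pow Wset. (-1) ^ card A * (\<Prod>\<sigma>\<in>A. x \<sigma>) * x \<tau> ^ (n - card A))"
  proof (rule sum.cong[OF refl])
    fix A assume "A \<in> Pow Wset"
    then have A: "A \<subseteq> Wset" "finite A" using finite_subset[OF _ finite_Wset] by auto
    then have "card (Wset - A) = n - card A" by (simp add: card_Diff_subset n_def)
    moreover have "(\<Prod>\<sigma>\<in>A. - x \<sigma>) = (-1) ^ card A * (\<Prod>\<sigma>\<in>A. x \<sigma>)"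
      using prod.distrib[of "\<lambda>_. -1" x A] by simp
    ultimately show "(\<Prod>\<sigma>\<in>A. - x \<sigma>) * (\<Prod>\<sigma>\<in>Wset - A. x \<tau>) =
      (-1) ^ card A * (\<Prod>\<sigma>\<in>A. x \<sigma>) * x \<tau> ^ (n - card A)" by simp
  qed
  also have "\<dots> = (\<Sum>k\<in>{0..n}. \<Sum>A\<in>{A \<in> Pow Wset. card A = k}. (-1) ^ card A * (\<Prod>\<sigma>\<in>A. x \<sigma>) * x \<tau> ^ (n - card A))"
  proof (rule sum.group[symmetric])
    show "card ` Pow Wset \<subseteq> {0..n}" using card_mono[OF finite_Wset] by (auto simp: n_def)
  qed (use finite_Wset in simp_all)
  also have "\<dots> = (\<Sum>k\<in>{0..n}. esym h g k s * ((-1) ^ k * x \<tau> ^ (n - k)))"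
  proof (rule sum.cong[OF refl])
    fix k
    have "esym h g k s * ((-1) ^ k * x \<tau> ^ (n - k)) =
      (\<Sum>A\<in>{A \<in> Pow Wset. card A = k}. (\<Prod>\<sigma>\<in>A. x \<sigma>) * ((-1) ^ k * x \<tau> ^ (n - k)))"
      by (simp add: esym_def sum_distrib_right x_def)
    then show "(\<Sum>A\<in>{A \<in> Pow Wset. card A = k}. (-1) ^ card A * (\<Prod>\<sigma>\<in>A. x \<sigma>) * x \<tau> ^ (n - card A)) =
      esym h g k s * ((-1) ^ k * x \<tau> ^ (n - k))"
      by (simp add: mult_ac)
  qed
  also have "\<dots> = x \<tau> ^ n + (\<Sum>k\<in>{1..n}. esym h g k s * ((-1) ^ k * x \<tau> ^ (n - k)))"
  proof -
    have "{A. A \<subseteq> Wset \<and> card A = 0} = {{}}" 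
      using finite_subset[OF _ finite_Wset] by (auto simp: card_eq_0_iff)
    then have "esym h g 0 s = 1" by (simp add: esym_def)
    moreover have "{0..n} = insert 0 {1..n}" by auto
    ultimately show ?thesis by simp
  qed
  finally have "x \<tau> ^ n = - (\<Sum>k\<in>{1..n}. esym h g k s * ((-1) ^ k * x \<tau> ^ (n - k)))" by linarith
  also have "\<dots> = (\<Sum>k\<in>{1..n}. esym h g k s * (- ((-1) ^ k) * x \<tau> ^ (n - k)))"
    by (simp add: sum_negf)
  finally show ?thesis by (simp add: x_def n_def)
qed

lemma TT_B_xval: "(\<lambda>y \<pi> \<epsilon>. xval h g \<sigma> (wslice \<pi> \<epsilon> y)) \<in> B.TT"
  unfolding xval_def ract_ract by (rule TT_B_point)

text \<open>For fixed \<open>g\<close> the function is invariant under \<open>Wset\<close>, so it is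
  its average up to the factor 24. It is evaluated at the slice point: \<open>b\<close> is the
  invariant whose restriction to the slice it gives, and \<open>b\<close> has the same value at
  \<open>spt y\<close>.\<close>

lemma esym_in_Inv_alg:
  obtains b n where "b \<in> Inv_alg" "\<And>y. y \<in> YR \<Longrightarrow> esym h g k (slp y) * ev (spt y) Discr ^ n = ev (spt y) b"
proof -
  define t where "t = (\<lambda>y \<pi> \<epsilon>. esym h g k (wslice \<pi> \<epsilon> y))"
  have "avg t \<in> Kf Inv_alg" unfolding t_def esym_def
    by (rule B.avg_in_K, rule B.TT_sum, rule B.TT_prod, rule TT_B_xval)
  then obtain Q n where Q: "Q \<in> Inv_alg" "\<And>y. y \<in> YR \<Longrightarrow> avg t y * ev (spt y) Discr ^ n = ev (spt y) Q"
    by (erule KfE)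
  have "avg t y = 24 * esym h g k (slp y)" for y
  proof (rule avg_const)
    fix \<pi> \<epsilon> assume w: "\<pi> \<in> perms" "\<And>i. \<epsilon> i * \<epsilon> i = 1" "wmat \<pi> \<epsilon> \<in> Wset"
    show "t y \<pi> \<epsilon> = esym h g k (slp y)"
      unfolding t_def ract_wmat[OF w(1,2), symmetric] by (rule esym_Wset[OF w(3)])
  qed
  then have "esym h g k (slp y) * ev (spt y) Discr ^ n = ev (spt y) (Const (1/24) * Q)" if "y \<in> YR" for y
    using Q(2)[OF that] by simp
  then show thesis by (rule that[OF Inv_alg.mult[OF Inv_alg.const Q(1)]])
qed

section \<open>Radicals of ideals of functions\<close>

type_synonym tfun = "slice_point \<Rightarrow> (3 \<Rightarrow> 3) \<Rightarrow> (3 \<Rightarrow> real) \<Rightarrow> real"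

text \<open>Used twice: for the ideal spanned by a prime in \<open>T.TT\<close> and for a colon
  ideal in \<open>B.TT\<close>. Both times nilpotent elements have to be added and
  multiplied.\<close>

locale fun_ideal =
  fixes R I :: "tfun set"
  assumes R_const: "(\<lambda>y \<pi> \<epsilon>. r) \<in> R"
    and R_mult: "s \<in> R \<Longrightarrow> t \<in> R \<Longrightarrow> (\<lambda>y \<pi> \<epsilon>. s y \<pi> \<epsilon> * t y \<pi> \<epsilon>) \<in> R"
    and I_zero: "(\<lambda>y \<pi> \<epsilon>. 0) \<in> I"
    and I_add: "s \<in> I \<Longrightarrow> t \<in> I \<Longrightarrow> (\<lambda>y \<pi> \<epsilon>. s y \<pi> \<epsilon> + t y \<pi> \<epsilon>) \<in> I"
    and I_mult: "s \<in> R \<Longrightarrow> t \<in> I \<Longrightarrow> (\<lambda>y \<pi> \<epsilon>. s y \<pi> \<epsilon> * t y \<pi> \<epsilon>) \<in> I"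
begin

definition rad :: "tfun set"
  where "rad = {t \<in> R. \<exists>n. (\<lambda>y \<pi> \<epsilon>. t y \<pi> \<epsilon> ^ n) \<in> I}"

lemma R_power: "t \<in> R \<Longrightarrow> (\<lambda>y \<pi> \<epsilon>. t y \<pi> \<epsilon> ^ n) \<in> R"
proof (induction n)
  case 0
  show ?case using R_const[of 1] by simp
next
  case (Suc n)
  show ?case using R_mult[OF Suc.prems Suc.IH[OF Suc.prems]] by simp
qed

lemma I_power_ge:
  assumes "t \<in> R" "(\<lambda>y \<pi> \<epsilon>. t y \<pi> \<epsilon> ^ n) \<in> I" "n \<le> k"
  shows "(\<lambda>y \<pi> \<epsilon>. t y \<pi> \<epsilon> ^ k) \<in> I"
proof -
  have "t y \<pi> \<epsilon> ^ k = t y \<pi> \<epsilon> ^ (k - n) * t y \<pi> \<epsilon> ^ n" for y \<pi> \<epsilon>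
    using assms(3) power_add[of "t y \<pi> \<epsilon>" "k - n" n] by simp
  then show ?thesis using I_mult[OF R_power[OF assms(1), of "k - n"] assms(2)] by simp
qed

lemma I_sum: "finite A \<Longrightarrow> (\<And>a. a \<in> A \<Longrightarrow> t a \<in> I) \<Longrightarrow> (\<lambda>y \<pi> \<epsilon>. \<Sum>a\<in>A. t a y \<pi> \<epsilon>) \<in> I"
proof (induction A rule: finite_induct)
  case empty
  show ?case using I_zero by simp
next
  case (insert a A)
  then show ?case by (simp add: I_add)
qed

lemma rad_mult:
  assumes "s \<in> R" "t \<in> rad" shows "(\<lambda>y \<pi> \<epsilon>. s y \<pi> \<epsilon> * t y \<pi> \<epsilon>) \<in> rad"
proof -
  obtain n where t: "t \<in> R" "(\<lambda>y \<pi> \<epsilon>. t y \<pi> \<epsilon> ^ n) \<in> I" using assms(2) by (auto simp: rad_def)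
  have "(\<lambda>y \<pi> \<epsilon>. (s y \<pi> \<epsilon> * t y \<pi> \<epsilon>) ^ n) \<in> I"
    using I_mult[OF R_power[OF assms(1), of n] t(2)] by (simp add: power_mult_distrib)
  then show ?thesis unfolding rad_def using R_mult[OF assms(1) t(1)] by (intro CollectI conjI exI)
qed

lemma rad_add:
  assumes R_add: "\<And>s t. s \<in> R \<Longrightarrow> t \<in> R \<Longrightarrow> (\<lambda>y \<pi> \<epsilon>. s y \<pi> \<epsilon> + t y \<pi> \<epsilon>) \<in> R"
    and "s \<in> rad" "t \<in> rad"
  shows "(\<lambda>y \<pi> \<epsilon>. s y \<pi> \<epsilon> + t y \<pi> \<epsilon>) \<in> rad"
proof -
  obtain n where s: "s \<in> R" "(\<lambda>y \<pi> \<epsilon>. s y \<pi> \<epsilon> ^ n) \<in> I" using assms(2) by (auto simp: rad_def)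
  obtain m where t: "t \<in> R" "(\<lambda>y \<pi> \<epsilon>. t y \<pi> \<epsilon> ^ m) \<in> I" using assms(3) by (auto simp: rad_def)
  have "(\<lambda>y \<pi> \<epsilon>. \<Sum>k\<le>n + m. of_nat ((n + m) choose k) * (s y \<pi> \<epsilon> ^ k * t y \<pi> \<epsilon> ^ (n + m - k))) \<in> I"
  proof (rule I_sum)
    fix k
    have "(\<lambda>y \<pi> \<epsilon>. s y \<pi> \<epsilon> ^ k * t y \<pi> \<epsilon> ^ (n + m - k)) \<in> I"
    proof (cases "n \<le> k")
      case True
      show ?thesis
        using I_mult[OF R_power[OF t(1)] I_power_ge[OF s True], of "n + m - k"] by (simp add: mult.commute)
    next
      case False
      then have "m \<le> n + m - k" by simp
      from I_mult[OF R_power[OF s(1)] I_power_ge[OF t this], of k] show ?thesis .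
    qed
    then show "(\<lambda>y \<pi> \<epsilon>. of_nat ((n + m) choose k) * (s y \<pi> \<epsilon> ^ k * t y \<pi> \<epsilon> ^ (n + m - k))) \<in> I"
      by (rule I_mult[OF R_const])
  qed simp
  then have "(\<lambda>y \<pi> \<epsilon>. (s y \<pi> \<epsilon> + t y \<pi> \<epsilon>) ^ (n + m)) \<in> I"
    unfolding binomial_ring mult.assoc .
  then show ?thesis unfolding rad_def using R_add[OF s(1) t(1)] by (intro CollectI conjI exI)
qed

lemma rad_sum:
  assumes R_add: "\<And>s t. s \<in> R \<Longrightarrow> t \<in> R \<Longrightarrow> (\<lambda>y \<pi> \<epsilon>. s y \<pi> \<epsilon> + t y \<pi> \<epsilon>) \<in> R"
    and "finite A" "\<And>a. a \<in> A \<Longrightarrow> t a \<in> rad"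
  shows "(\<lambda>y \<pi> \<epsilon>. \<Sum>a\<in>A. t a y \<pi> \<epsilon>) \<in> rad"
  using assms(2,3)
proof (induction A rule: finite_induct)
  case empty
  have "(\<lambda>y \<pi> \<epsilon>. 0 ^ 1) \<in> I" using I_zero by simp
  then show ?case using R_const[of 0] unfolding rad_def by (intro CollectI conjI exI[of _ 1]) simp_all
next
  case (insert a A)
  have "(\<lambda>y \<pi> \<epsilon>. t a y \<pi> \<epsilon> + (\<Sum>a\<in>A. t a y \<pi> \<epsilon>)) \<in> rad"
    by (rule rad_add[OF R_add]) (use insert in simp_all)
  then show ?case using insert by simp
qed

end

text \<open>The ideal generated by \<open>q\<close> in \<open>TT\<close>. The last rule identifies
  functions that agree at genuine elements of the group, which is all that an average sees.\<close>

inductive_set span :: "real_poly set \<Rightarrow> tfun set \<Rightarrow> tfun set" for q TT where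
  zero: "(\<lambda>y \<pi> \<epsilon>. 0) \<in> span q TT"
| gen: "Q \<in> q \<Longrightarrow> \<theta> \<in> TT \<Longrightarrow> (\<lambda>y \<pi> \<epsilon>. ev (spt y) Q * \<theta> y \<pi> \<epsilon>) \<in> span q TT"
| add: "s \<in> span q TT \<Longrightarrow> t \<in> span q TT \<Longrightarrow> (\<lambda>y \<pi> \<epsilon>. s y \<pi> \<epsilon> + t y \<pi> \<epsilon>) \<in> span q TT"
| ext: "s \<in> span q TT \<Longrightarrow> (\<And>y \<pi> \<epsilon>. y \<in> YR \<Longrightarrow> \<pi> \<in> perms \<Longrightarrow> (\<And>i. \<epsilon> i * \<epsilon> i = 1) \<Longrightarrow> wmat \<pi> \<epsilon> \<in> Wset \<Longrightarrow>
    t y \<pi> \<epsilon> = s y \<pi> \<epsilon>) \<Longrightarrow> t \<in> span q TT"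

lemma span_mult:
  assumes TT_mult: "\<And>s t. s \<in> TT \<Longrightarrow> t \<in> TT \<Longrightarrow> (\<lambda>y \<pi> \<epsilon>. s y \<pi> \<epsilon> * t y \<pi> \<epsilon>) \<in> TT"
    and s: "s \<in> TT" and t: "t \<in> span q TT"
  shows "(\<lambda>y \<pi> \<epsilon>. s y \<pi> \<epsilon> * t y \<pi> \<epsilon>) \<in> span q TT"
  using t
proof induction
  case zero
  show ?case using span.zero by simp
next
  case (gen Q \<theta>)
  show ?case by (rule span.ext[OF span.gen[OF gen(1) TT_mult[OF s gen(2)]]]) (simp add: mult_ac)
next
  case (add t t')
  show ?case by (rule span.ext[OF span.add[OF add.IH]]) (simp add: distrib_left)
next
  case (ext t t')
  show ?case by (rule span.ext[OF ext.IH]) (simp add: ext.hyps)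
qed

text \<open>\<open>ev (spt y) Q\<close> does not depend on the signed permutation, so it comes out
  of the average; the ideal \<open>J\<close> then absorbs the numerator of the averaged
  cofactor.\<close>

lemma span_avg:
  assumes J0: "0 \<in> J" and Ja: "\<And>P Q. P \<in> J \<Longrightarrow> Q \<in> J \<Longrightarrow> P + Q \<in> J"
    and Jm: "\<And>P Q. P \<in> J \<Longrightarrow> Q \<in> S \<Longrightarrow> P * Q \<in> J" and D: "Discr \<in> S" and q: "q \<subseteq> J"
    and avg: "\<And>\<theta>. \<theta> \<in> TT \<Longrightarrow> avg \<theta> \<in> Kf S" and t: "t \<in> span q TT"
  shows "avg t \<in> Kf J"
  using t
proof induction
  case zero
  show ?case by (rule KfI[OF J0, of _ 0]) (simp add: avg_def)
next
  case (gen Q \<theta>)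
  have "(\<lambda>y. ev (spt y) Q * avg \<theta> y) \<in> Kf J"
    by (rule Kf_mult[OF Jm Kf_poly avg]) (use gen q in auto)
  then show ?case by (rule Kf_cong) (simp add: avg_def sum_distrib_left distrib_left)
next
  case (add s t)
  have "(\<lambda>y. avg s y + avg t y) \<in> Kf J"
    by (rule Kf_add[OF Ja Jm[OF _ D] add.IH])
  then show ?case by (rule Kf_cong) (simp add: avg_def sum.distrib)
next
  case (ext s t)
  show ?case
  proof (rule Kf_cong[OF ext.IH])
    fix y assume y: "y \<in> YR"
    show "avg t y = avg s y" unfolding avg_def
      by (intro sum.cong refl ext.hyps(2)[OF y] eps_square wmat_eps_Wset)
  qed
qed

text \<open>The colon ideal of the span by \<open>s\<close>. It carries along the invariant
  \<open>s\<close> by which relations hold only after multiplication.\<close>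

lemma fun_ideal_B: "fun_ideal B.TT {t. (\<lambda>y \<pi> \<epsilon>. ev (spt y) s * t y \<pi> \<epsilon>) \<in> span q B.TT}"
proof
  show "(\<lambda>y \<pi> \<epsilon>. r) \<in> B.TT" for r by (rule B.TT_const)
  show "s \<in> B.TT \<Longrightarrow> t \<in> B.TT \<Longrightarrow> (\<lambda>y \<pi> \<epsilon>. s y \<pi> \<epsilon> * t y \<pi> \<epsilon>) \<in> B.TT" for s t
    by (rule B.TT_mult)
  show "(\<lambda>y \<pi> \<epsilon>. 0) \<in> {t. (\<lambda>y \<pi> \<epsilon>. ev (spt y) s * t y \<pi> \<epsilon>) \<in> span q B.TT}"
    using span.zero by simp
  fix a b
  assume "b \<in> {t. (\<lambda>y \<pi> \<epsilon>. ev (spt y) s * t y \<pi> \<epsilon>) \<in> span q B.TT}"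
  then have b: "(\<lambda>y \<pi> \<epsilon>. ev (spt y) s * b y \<pi> \<epsilon>) \<in> span q B.TT" by (rule CollectD)
  show "(\<lambda>y \<pi> \<epsilon>. a y \<pi> \<epsilon> + b y \<pi> \<epsilon>) \<in> {t. (\<lambda>y \<pi> \<epsilon>. ev (spt y) s * t y \<pi> \<epsilon>) \<in> span q B.TT}"
    if a: "a \<in> {t. (\<lambda>y \<pi> \<epsilon>. ev (spt y) s * t y \<pi> \<epsilon>) \<in> span q B.TT}"
    by (rule CollectI, rule span.ext[OF span.add[OF CollectD[OF a] b]]) (rule distrib_left)
  show "(\<lambda>y \<pi> \<epsilon>. a y \<pi> \<epsilon> * b y \<pi> \<epsilon>) \<in> {t. (\<lambda>y \<pi> \<epsilon>. ev (spt y) s * t y \<pi> \<epsilon>) \<in> span q B.TT}"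
    if a: "a \<in> B.TT"
    by (rule CollectI, rule span.ext[OF span_mult[OF B.TT_mult a b]], assumption, assumption, rule mult.left_commute)
qed

lemma fun_ideal_T: "fun_ideal T.TT (span q T.TT)"
proof
  show "(\<lambda>y \<pi> \<epsilon>. r) \<in> T.TT" for r by (rule T.TT_const)
  show "s \<in> T.TT \<Longrightarrow> t \<in> T.TT \<Longrightarrow> (\<lambda>y \<pi> \<epsilon>. s y \<pi> \<epsilon> * t y \<pi> \<epsilon>) \<in> T.TT" for s t
    by (rule T.TT_mult)
  show "(\<lambda>y \<pi> \<epsilon>. 0) \<in> span q T.TT" by (rule span.zero)
  show "s \<in> span q T.TT \<Longrightarrow> t \<in> span q T.TT \<Longrightarrow> (\<lambda>y \<pi> \<epsilon>. s y \<pi> \<epsilon> + t y \<pi> \<epsilon>) \<in> span q T.TT" for s t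
    by (rule span.add)
  show "s \<in> T.TT \<Longrightarrow> t \<in> span q T.TT \<Longrightarrow> (\<lambda>y \<pi> \<epsilon>. s y \<pi> \<epsilon> * t y \<pi> \<epsilon>) \<in> span q T.TT" for s t
    by (rule span_mult) (rule B.TT_mult T.TT_mult)
qed

text \<open>Every \<open>h\<close> is nilpotent modulo the elementary symmetric functions of its translates.\<close>

lemma exists_invariant_notin:
  assumes p: "primeideal p RX" and h: "h \<notin> p" and D: "Discr \<notin> p"
  shows "\<exists>g k b n. rotation_matrix g \<and> k \<ge> 1 \<and> b \<in> Inv_alg \<and> b \<notin> p \<and>
    (\<forall>y\<in>YR. esym h g k (slp y) * ev (spt y) Discr ^ n = ev (spt y) b)"
proof (rule ccontr)
  assume contra: "\<not> ?thesis"
  interpret p: primeideal p RX by fact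
  interpret I: fun_ideal T.TT "span p T.TT" by (rule fun_ideal_T)
  have p_mult: "P * Q \<in> p" if "P \<in> p" for P Q using p.I_r_closed[OF that, of Q] by simp
  have p_prime: "P \<in> p \<or> Q \<in> p" if "P * Q \<in> p" for P Q using p.I_prime[of P Q] that by simp
  \<comment> \<open>Under the assumption to be refuted, each \<open>b\<close> that represents such
    an \<open>esym\<close> lies in \<open>p\<close>, and the power of \<open>Discr\<close> can be
    divided out inside \<open>T.TT\<close>.\<close>
  have esym: "(\<lambda>y \<pi> \<epsilon>. esym h g k (wslice \<pi> \<epsilon> y) * \<theta> y \<pi> \<epsilon>) \<in> span p T.TT"
    if g: "rotation_matrix g" "k \<ge> 1" and \<theta>: "\<theta> \<in> T.TT" for g k \<theta>
  proof -
    obtain b n where b: "b \<in> Inv_alg" "\<And>y. y \<in> YR \<Longrightarrow> esym h g k (slp y) * ev (spt y) Discr ^ n = ev (spt y) b"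
      by (rule esym_in_Inv_alg[of h g k], rule that)
    have "b \<in> p"
    proof (rule ccontr)
      assume nb: "b \<notin> p"
      have "\<exists>g k b n. rotation_matrix g \<and> k \<ge> 1 \<and> b \<in> Inv_alg \<and> b \<notin> p \<and>
        (\<forall>y\<in>YR. esym h g k (slp y) * ev (spt y) Discr ^ n = ev (spt y) b)"
        by (rule exI[of _ g], rule exI[of _ k], rule exI[of _ b], rule exI[of _ n]) (use nb g b in simp)
      with contra show False by contradiction
    qed
    have "(\<lambda>y. inverse (ev (spt y) Discr)) \<in> Kf UNIV" by (rule Kf_cong[OF T.K_inv]) (simp only: ev_spt_Discr)
    then have "(\<lambda>y \<pi> \<epsilon>. inverse (ev (spt y) Discr)) \<in> T.TT" by (rule T.TT_K)
    from T.TT_mult[OF I.R_power[OF this, of n] \<theta>] \<open>b \<in> p\<close>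
    have "(\<lambda>y \<pi> \<epsilon>. ev (spt y) b * (inverse (ev (spt y) Discr) ^ n * \<theta> y \<pi> \<epsilon>)) \<in> span p T.TT"
      by (intro span.gen)
    then show ?thesis
    proof (rule span.ext)
      fix y \<pi> \<epsilon> assume y: "y \<in> YR" and w: "\<pi> \<in> perms" "\<And>i. \<epsilon> i * \<epsilon> i = 1" "wmat \<pi> \<epsilon> \<in> Wset"
      have "esym h g k (wslice \<pi> \<epsilon> y) = esym h g k (slp y)"
        unfolding ract_wmat[OF w(1,2), symmetric] by (rule esym_Wset[OF w(3)])
      also have "\<dots> = ev (spt y) b * inverse (ev (spt y) Discr) ^ n"
        using b(2)[OF y, symmetric] ev_spt_Discr_nz[OF y] by (simp add: power_inverse)
      finally show "esym h g k (wslice \<pi> \<epsilon> y) * \<theta> y \<pi> \<epsilon> =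
        ev (spt y) b * (inverse (ev (spt y) Discr) ^ n * \<theta> y \<pi> \<epsilon>)" by simp
    qed
  qed
  \<comment> \<open>By \<open>esym_root\<close> at the identity of \<open>Wset\<close>, the power
    with exponent \<open>card Wset\<close> is a combination of the \<open>esym\<close> just placed
    in the span.\<close>
  have xrad: "(\<lambda>y \<pi> \<epsilon>. ev (ract g (wslice \<pi> \<epsilon> y)) h) \<in> I.rad" if g: "rotation_matrix g" for g
  proof -
    define n where "n = card Wset"
    have x: "xval h g (mat 1) s = ev (ract g s) h" for s by (simp add: xval_def ract_mat1)
    have "(\<lambda>y \<pi> \<epsilon>. \<Sum>k\<in>{1..n}. esym h g k (wslice \<pi> \<epsilon> y) *
        (- ((-1) ^ k) * ev (ract g (wslice \<pi> \<epsilon> y)) h ^ (n - k))) \<in> span p T.TT"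
      by (rule I.I_sum, simp, rule esym[OF g], simp, rule T.TT_mult, rule T.TT_const, rule I.R_power, rule TT_T_point)
    moreover have "(\<lambda>y \<pi> \<epsilon>. \<Sum>k\<in>{1..n}. esym h g k (wslice \<pi> \<epsilon> y) *
        (- ((-1) ^ k) * ev (ract g (wslice \<pi> \<epsilon> y)) h ^ (n - k))) =
        (\<lambda>y \<pi> \<epsilon>. ev (ract g (wslice \<pi> \<epsilon> y)) h ^ n)"
    proof (rule HOL.ext, rule HOL.ext, rule HOL.ext)
      fix y \<pi> \<epsilon>
      show "(\<Sum>k\<in>{1..n}. esym h g k (wslice \<pi> \<epsilon> y) *
        (- ((-1) ^ k) * ev (ract g (wslice \<pi> \<epsilon> y)) h ^ (n - k))) = ev (ract g (wslice \<pi> \<epsilon> y)) h ^ n"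
        using esym_root[OF mat1_Wset, of h g "wslice \<pi> \<epsilon> y"] unfolding x n_def by (rule sym)
    qed
    ultimately have "(\<lambda>y \<pi> \<epsilon>. ev (ract g (wslice \<pi> \<epsilon> y)) h ^ n) \<in> span p T.TT" by simp
    then show ?thesis unfolding I.rad_def using TT_T_point by (intro CollectI conjI exI)
  qed
  obtain r :: nat and \<gamma> c where int: "\<And>j. j < r \<Longrightarrow> rotation_matrix (\<gamma> j)" "\<And>j. j < r \<Longrightarrow> c j \<in> MF"
    "\<And>g x. rotation_matrix g \<Longrightarrow> ev (ract g x) h = (\<Sum>j<r. c j g * ev (ract (\<gamma> j) x) h)"
    by (rule interpolation[of h], rule that)
  \<comment> \<open>Interpolation at the rotation that carries the moved slice point to
    \<open>spt y\<close>: on the group this sum is the value of \<open>h\<close> at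
    \<open>spt y\<close>, and it is nilpotent because its summands are.\<close>
  have "(\<lambda>y \<pi> \<epsilon>. \<Sum>j\<in>{..<r}. c j (fst y ** transpose (wmat \<pi> \<epsilon>)) * ev (ract (\<gamma> j) (wslice \<pi> \<epsilon> y)) h) \<in> I.rad"
  proof (rule I.rad_sum[OF T.TT.add])
    show "finite {..<r}" by (rule finite_lessThan)
    fix j assume "j \<in> {..<r}"
    then have "j < r" by simp
    show "(\<lambda>y \<pi> \<epsilon>. c j (fst y ** transpose (wmat \<pi> \<epsilon>)) * ev (ract (\<gamma> j) (wslice \<pi> \<epsilon> y)) h) \<in> I.rad"
      by (rule I.rad_mult[OF TT_T_MF[OF int(2)[OF \<open>j < r\<close>]] xrad[OF int(1)[OF \<open>j < r\<close>]]])
  qed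
  then obtain N where N: "(\<lambda>y \<pi> \<epsilon>. (\<Sum>j<r. c j (fst y ** transpose (wmat \<pi> \<epsilon>)) *
    ev (ract (\<gamma> j) (wslice \<pi> \<epsilon> y)) h) ^ N) \<in> span p T.TT" unfolding I.rad_def by blast
  have "(\<lambda>y \<pi> \<epsilon>. ev (spt y) h ^ N) \<in> span p T.TT"
  proof (rule span.ext[OF N])
    fix y \<pi> \<epsilon> assume y: "y \<in> YR" and w: "\<pi> \<in> perms" "\<And>i. \<epsilon> i * \<epsilon> i = 1" "wmat \<pi> \<epsilon> \<in> Wset"
    let ?g = "fst y ** transpose (wmat \<pi> \<epsilon>)"
    have "rotation_matrix ?g"
      by (intro rotation_matrix_mult YR_rot y) (simp add: rotation_matrix_transpose Wset_rotation w)
    moreover have "ract ?g (wslice \<pi> \<epsilon> y) = spt y"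
      unfolding ract_wmat[OF w(1,2), symmetric] ract_ract spt_def
      by (simp add: rotation_matrixD[OF Wset_rotation[OF w(3)]] flip: matrix_mul_assoc)
    ultimately show "ev (spt y) h ^ N = (\<Sum>j<r. c j ?g * ev (ract (\<gamma> j) (wslice \<pi> \<epsilon> y)) h) ^ N"
      using int(3)[of ?g "wslice \<pi> \<epsilon> y"] by simp
  qed
  \<comment> \<open>The function is constant on the group, so its average is 24 times itself, while
    averaging the span leads to numerators in \<open>p\<close>. Hence
    \<open>h ^ N * Discr ^ m\<close> lies in \<open>p\<close>.\<close>
  then have "avg (\<lambda>y \<pi> \<epsilon>. ev (spt y) h ^ N) \<in> Kf p"
  proof (rule span_avg[rotated -1])
    show "0 \<in> p" using additive_subgroup.zero_closed[OF p.additive_subgroup_axioms] by simp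
    show "P + Q \<in> p" if "P \<in> p" "Q \<in> p" for P Q using additive_subgroup.a_closed[OF p.additive_subgroup_axioms that] by simp
    show "P * Q \<in> p" if "P \<in> p" "Q \<in> UNIV" for P Q using p_mult that by blast
  qed (auto intro: T.avg_in_K)
  then obtain P m where P: "P \<in> p"
    "\<And>y. y \<in> YR \<Longrightarrow> avg (\<lambda>y \<pi> \<epsilon>. ev (spt y) h ^ N) y * ev (spt y) Discr ^ m = ev (spt y) P" by (erule KfE)
  have "h ^ N * Discr ^ m = P * Const (1/24)"
  proof (rule spt_dense)
    fix y assume y: "y \<in> YR"
    have "avg (\<lambda>y \<pi> \<epsilon>. ev (spt y) h ^ N) y = 24 * ev (spt y) h ^ N" by (rule avg_const) simp
    then show "ev (spt y) (h ^ N * Discr ^ m) = ev (spt y) (P * Const (1/24))"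
      using P(2)[OF y] by simp
  qed
  then have "h ^ N * Discr ^ m \<in> p" using p_mult[OF P(1)] by simp
  moreover have pow: "Q ^ k \<in> p \<longrightarrow> Q \<in> p" for Q k
  proof (induction k)
    case 0
    show ?case using p.one_notin by simp
  next
    case (Suc k)
    then show ?case using p_prime[of Q "Q ^ k"] by auto
  qed
  ultimately show False using p_prime[of "h ^ N" "Discr ^ m"] h D by blast
qed

section \<open>From the extended ideal back to the invariants\<close>

inductive_set gen_ideal :: "real_poly set \<Rightarrow> real_poly set" for q where
  zero: "0 \<in> gen_ideal q"
| gen: "Q \<in> q \<Longrightarrow> Q * a \<in> gen_ideal q"
| add: "P \<in> gen_ideal q \<Longrightarrow> Q \<in> gen_ideal q \<Longrightarrow> P + Q \<in> gen_ideal q"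

definition real_invariant :: "real_poly \<Rightarrow> bool"
  where "real_invariant P \<longleftrightarrow> (\<forall>(g :: real^3^3) v A. rotation_matrix g \<longrightarrow> transpose A = A \<longrightarrow>
    ev (ract g (v, A)) P = ev (v, A) P)"

lemma wslice_invariant:
  assumes "real_invariant P" "rotation_matrix g" "y \<in> YR" "\<pi> \<in> perms" "\<And>i. \<epsilon> i * \<epsilon> i = 1" "wmat \<pi> \<epsilon> \<in> Wset"
  shows "ev (ract g (wslice \<pi> \<epsilon> y)) P = ev (spt y) P"
proof -
  have inv: "ev (ract h (slp y)) P = ev (slp y) P" if "rotation_matrix h" for h
    unfolding slp_def using assms(1) that diag_symmetric unfolding real_invariant_def by blast
  show ?thesis
    unfolding ract_wmat[OF assms(4,5), symmetric] ract_ract spt_def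
    using inv[OF rotation_matrix_mult[OF assms(2) Wset_rotation[OF assms(6)]]] inv[OF YR_rot[OF assms(3)]] by simp
qed

text \<open>At any translate an invariant generator has its value at \<open>spt y\<close>, and the
  cofactor becomes a function in \<open>B.TT\<close>.\<close>

lemma gen_ideal_span:
  assumes q: "\<And>Q. Q \<in> q \<Longrightarrow> real_invariant Q" and g: "rotation_matrix g" and P: "P \<in> gen_ideal q"
  shows "(\<lambda>y \<pi> \<epsilon>. ev (ract g (wslice \<pi> \<epsilon> y)) P) \<in> span q B.TT"
  using P
proof induction
  case zero
  show ?case using span.zero by simp
next
  case (gen Q a)
  show ?case
    by (rule span.ext[OF span.gen[OF gen TT_B_point[of g a]]]) (simp add: wslice_invariant[OF q[OF gen] g])
next
  case (add P Q)
  show ?case using span.add[OF add.IH] by simp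
qed

text \<open>The hypothesis on \<open>s * h ^ n\<close> makes every translate of \<open>h\<close>
  nilpotent modulo the colon ideal by \<open>s\<close>. Every monomial of \<open>esym\<close>
  contains a translate, so \<open>esym\<close> is nilpotent as well, and averaging returns to
  \<open>q\<close>. In \<open>lift_prime\<close> this contradicts the choice of \<open>s\<close> and
  \<open>b\<close> outside a prime.\<close>

lemma descend_to_invariants:
  assumes q0: "0 \<in> q" and qa: "\<And>P Q. P \<in> q \<Longrightarrow> Q \<in> q \<Longrightarrow> P + Q \<in> q"
    and qm: "\<And>P Q. P \<in> q \<Longrightarrow> Q \<in> Inv_alg \<Longrightarrow> P * Q \<in> q" and qi: "\<And>Q. Q \<in> q \<Longrightarrow> real_invariant Q"
    and s: "real_invariant s" and sh: "s * h ^ n \<in> gen_ideal q"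
    and g: "rotation_matrix g" "k \<ge> 1"
    and b: "\<And>y. y \<in> YR \<Longrightarrow> esym h g k (slp y) * ev (spt y) Discr ^ m = ev (spt y) b"
  shows "\<exists>N M. s * b ^ N * Discr ^ M \<in> q"
proof -
  interpret I: fun_ideal B.TT "{t. (\<lambda>y \<pi> \<epsilon>. ev (spt y) s * t y \<pi> \<epsilon>) \<in> span q B.TT}" by (rule fun_ideal_B)
  have x: "(\<lambda>y \<pi> \<epsilon>. xval h g \<sigma> (wslice \<pi> \<epsilon> y)) \<in> I.rad" if "\<sigma> \<in> Wset" for \<sigma>
  proof -
    have rot: "rotation_matrix (g ** \<sigma>)" by (intro rotation_matrix_mult g Wset_rotation that)
    have "(\<lambda>y \<pi> \<epsilon>. ev (spt y) s * xval h g \<sigma> (wslice \<pi> \<epsilon> y) ^ n) \<in> span q B.TT"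
      by (rule span.ext[OF gen_ideal_span[OF qi rot sh]])
        (simp_all add: xval_def ract_ract wslice_invariant[OF s rot])
    then show ?thesis unfolding I.rad_def using TT_B_xval by (intro CollectI conjI exI)
  qed
  have "(\<lambda>y \<pi> \<epsilon>. esym h g k (wslice \<pi> \<epsilon> y)) \<in> I.rad"
    unfolding esym_def
  proof (rule I.rad_sum[OF B.TT.add])
    show "finite {A. A \<subseteq> Wset \<and> card A = k}" by (rule finite_subsets_Wset)
    fix A assume "A \<in> {A. A \<subseteq> Wset \<and> card A = k}"
    then have A: "A \<subseteq> Wset" "card A = k" "finite A" using finite_subset[OF _ finite_Wset] by auto
    \<comment> \<open>The place where \<open>k\<close> being at least 1 counts: the empty product
      would be 1.\<close>
    then have "A \<noteq> {}" using g(2) by auto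
    then obtain \<sigma> where \<sigma>: "\<sigma> \<in> A" by blast
    have "(\<lambda>y \<pi> \<epsilon>. (\<Prod>\<sigma>\<in>A - {\<sigma>}. xval h g \<sigma> (wslice \<pi> \<epsilon> y)) * xval h g \<sigma> (wslice \<pi> \<epsilon> y)) \<in> I.rad"
      by (rule I.rad_mult, rule B.TT_prod, rule TT_B_xval, rule x) (use A \<sigma> in auto)
    moreover have "(\<Prod>\<sigma>\<in>A. xval h g \<sigma> x) = (\<Prod>\<sigma>\<in>A - {\<sigma>}. xval h g \<sigma> x) * xval h g \<sigma> x" for x
      unfolding prod.remove[OF A(3) \<sigma>] by (rule mult.commute)
    ultimately show "(\<lambda>y \<pi> \<epsilon>. \<Prod>\<sigma>\<in>A. xval h g \<sigma> (wslice \<pi> \<epsilon> y)) \<in> I.rad" by (simp only:)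
  qed
  then obtain N where N: "(\<lambda>y \<pi> \<epsilon>. ev (spt y) s * esym h g k (wslice \<pi> \<epsilon> y) ^ N) \<in> span q B.TT"
    by (auto simp: I.rad_def)
  define t where "t = (\<lambda>y \<pi> \<epsilon>. ev (spt y) s * esym h g k (wslice \<pi> \<epsilon> y) ^ N)"
  have "avg t \<in> Kf q"
    by (rule span_avg[OF q0 qa qm Discr_Inv_alg order_refl B.avg_in_K N[folded t_def]])
  then obtain P M where P: "P \<in> q" "\<And>y. y \<in> YR \<Longrightarrow> avg t y * ev (spt y) Discr ^ M = ev (spt y) P" by (erule KfE)
  have "s * b ^ N * Discr ^ M = P * (Discr ^ (m * N) * Const (1/24))"
  proof (rule spt_dense)
    fix y assume y: "y \<in> YR"
    have "avg t y = 24 * (ev (spt y) s * esym h g k (slp y) ^ N)"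
    proof (rule avg_const)
      fix \<pi> \<epsilon> assume w: "\<pi> \<in> perms" "\<And>i. \<epsilon> i * \<epsilon> i = 1" "wmat \<pi> \<epsilon> \<in> Wset"
      show "t y \<pi> \<epsilon> = ev (spt y) s * esym h g k (slp y) ^ N"
        unfolding t_def ract_wmat[OF w(1,2), symmetric] esym_Wset[OF w(3)] by (rule refl)
    qed
    then have "ev (spt y) P = 24 * (ev (spt y) s * esym h g k (slp y) ^ N) * ev (spt y) Discr ^ M"
      using P(2)[OF y] by simp
    moreover have "ev (spt y) b ^ N = esym h g k (slp y) ^ N * ev (spt y) Discr ^ (m * N)"
      unfolding b[OF y, symmetric] power_mult_distrib power_mult by (rule refl)
    ultimately show "ev (spt y) (s * b ^ N * Discr ^ M) = ev (spt y) (P * (Discr ^ (m * N) * Const (1/24)))"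
      by simp
  qed
  moreover have "P * (Discr ^ (m * N) * Const (1/24)) \<in> q"
    by (intro qm P Inv_alg.mult Inv_alg_power Discr_Inv_alg Inv_alg.const)
  ultimately show ?thesis by metis
qed

section \<open>Complex points\<close>

lemma SO3_iff: "g \<in> SO3 \<longleftrightarrow> rotation_matrix g" by (simp add: SO3_def)

lemma X_points_iff: "(v, A) \<in> X_points \<longleftrightarrow> transpose A = A" by (simp add: X_points_def)

lemma act_X_points: "x \<in> X_points \<Longrightarrow> act g x \<in> X_points"
  using ract_symmetric[of x g] by (cases x) (auto simp: X_points_def act_ract split_beta)

lemma Inv_alg_poly_invariants: "P \<in> Inv_alg \<Longrightarrow> P \<in> poly_invariants"
  unfolding poly_invariants_def using Inv_alg_invariant
  by (auto simp: SO3_iff X_points_def eval_at_ev act_ract)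

lemma poly_invariantsD: "P \<in> poly_invariants \<Longrightarrow> rotation_matrix g \<Longrightarrow> x \<in> X_points \<Longrightarrow> ev (ract g x) P = ev x P"
  by (auto simp: poly_invariants_def SO3_iff eval_at_ev act_ract)

lemma poly_invariants_real:
  assumes P: "P \<in> poly_invariants" shows "real_invariant P"
  unfolding real_invariant_def
proof (intro allI impI)
  fix g A :: "real^3^3" and v :: "real^3"
  assume g: "rotation_matrix g" and A: "transpose A = A"
  define cm where "cm M = (\<chi> i j. complex_of_real (M $ i $ j))" for M :: "real^3^3"
  define cv where "cv u = (\<chi> i. complex_of_real (u $ i))" for u :: "real^3"
  have mult: "cm (M ** N) = cm M ** cm N" "cm (transpose M) = transpose (cm M)" "cv (M *v u) = cm M *v cv u"
    for M N u by (simp_all add: cm_def cv_def vec_eq_iff matrix_matrix_mult_def transpose_def matrix_vector_mult_def)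
  have one: "cm (mat 1) = mat 1" by (auto simp: cm_def vec_eq_iff mat_def)
  have "det (cm g) = complex_of_real (det g)" by (simp add: det_3 cm_def)
  then have "rotation_matrix (cm g)"
    using g unfolding rotation_matrix_def orthogonal_matrix_def by (simp add: one flip: mult)
  moreover have "(cv v, cm A) \<in> X_points" using A by (simp add: X_points_def flip: mult)
  ultimately have "ev (ract (cm g) (cv v, cm A)) P = ev (cv v, cm A) P" using P poly_invariantsD by blast
  moreover have c: "cval c (cv u, cm M) = complex_of_real (cval c (u, M))" for c u M
    by (cases c) (simp_all add: cv_def cm_def)
  have "ev (cv u, cm M) P = complex_of_real (ev (u, M) P)" for u M
    unfolding c evl_of_real by (rule refl)
  ultimately show "ev (ract g (v, A)) P = ev (v, A) P"
    unfolding ract_def fst_conv snd_conv by (simp flip: mult)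
qed

lemma poly_invariants_power_Discr: "P \<in> poly_invariants \<Longrightarrow> \<exists>n. P * Discr ^ n \<in> Inv_alg"
  by (rule invariant_in_Inv_alg) (use poly_invariants_real in \<open>simp add: real_invariant_def\<close>)

lemma poly_invariants_closed:
  "Const r \<in> poly_invariants" "P \<in> poly_invariants \<Longrightarrow> Q \<in> poly_invariants \<Longrightarrow> P + Q \<in> poly_invariants"
  "P \<in> poly_invariants \<Longrightarrow> Q \<in> poly_invariants \<Longrightarrow> P * Q \<in> poly_invariants"
  "Discr \<in> poly_invariants" "P \<in> poly_invariants \<Longrightarrow> P ^ n \<in> poly_invariants"
  "P \<in> poly_invariants \<Longrightarrow> - P \<in> poly_invariants" "1 \<in> poly_invariants" "0 \<in> poly_invariants"
  using Inv_alg_poly_invariants[OF Discr_Inv_alg]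
  by (simp_all add: poly_invariants_def eval_at_ev)

lemma kernel_Spec: "{P. eval_at x P = 0} \<in> Spec RX"
proof -
  have "primeideal {P. ev x P = 0} RX"
  proof (rule primeidealI2)
    show "additive_subgroup {P. ev x P = 0} RX"
    proof (rule additive_subgroupI, rule group.subgroupI)
      show "group (add_monoid RX)"
        using cring_from_type_algebra cring.axioms(1) ring.is_abelian_group abelian_group.a_group by blast
      show "inv\<^bsub>add_monoid RX\<^esub> a \<in> {P. ev x P = 0}" if "a \<in> {P. ev x P = 0}" for a
      proof -
        interpret cring RX by (rule cring_from_type_algebra)
        have "\<ominus>\<^bsub>RX\<^esub> a = - a" by (rule minus_equality) simp_all
        then show ?thesis using that by (simp add: a_inv_def)
      qed
      show "a \<otimes>\<^bsub>add_monoid RX\<^esub> b \<in> {P. ev x P = 0}" if "a \<in> {P. ev x P = 0}" "b \<in> {P. ev x P = 0}" for a b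
        using that by simp
      show "{P. ev x P = 0} \<noteq> {}" using evl_zero by blast
    qed simp
    show "cring RX" by (rule cring_from_type_algebra)
    show "carrier RX \<noteq> {P. ev x P = 0}"
    proof
      assume "carrier RX = {P. ev x P = 0}"
      then have "(1 :: real_poly) \<in> {P. ev x P = 0}" by auto
      then show False by simp
    qed
  qed auto
  then show ?thesis by (simp add: Spec_def eval_at_ev)
qed

lemma points_of_X0_iff: "x \<in> points_of X0 \<longleftrightarrow> x \<in> X_points \<and> ev x Discr \<noteq> 0"
  using kernel_Spec[of x] by (simp add: points_of_def X0_def eval_at_ev)

lemma points_of_X0: "points_of X0 = {(v, A) \<in> X_points. card (eigenvalues A) = 3}"
proof -
  have "card (eigenvalues A) = 3 \<longleftrightarrow> ev (v, A) Discr \<noteq> 0" if A: "transpose A = A" for A :: "complex^3^3" and v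
  proof -
    obtain x y z where e: "x + y + z = trace A" "x * y + y * z + z * x = minors A" "x * y * z = det A"
      by (rule cubic_roots)
    have "det (mat t - A) = (t - x) * (t - y) * (t - z)" for t
      unfolding det_charmat e[symmetric] by (simp add: algebra_simps power2_eq_square power3_eq_cube)
    then have "eigenvalues A = {x, y, z}" unfolding eigenvalues_def eigenvector_iff by auto
    moreover have "ev (v, A) Discr = ((x - y) * (y - z) * (z - x))\<^sup>2"
      unfolding ev_Discr[OF A] e[symmetric] disc3_roots by (rule refl)
    ultimately show ?thesis by (auto simp: card_insert_if)
  qed
  then show ?thesis by (auto simp: points_of_X0_iff X_points_def)
qed

section \<open>Separation of orbits by the generating invariants\<close>

lemma slice_representative:
  assumes "x \<in> points_of X0"
  obtains g v l where "rotation_matrix g" "x = ract g (v, diag l)"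
    "l $ 1 \<noteq> l $ 2" "l $ 2 \<noteq> l $ 3" "l $ 3 \<noteq> l $ 1"
proof -
  obtain v A where x: "x = (v, A)" "transpose A = A" "ev (v, A) Discr \<noteq> 0"
    using assms by (cases x) (auto simp: points_of_X0_iff X_points_def)
  obtain g l where gl: "rotation_matrix g" "A = g ** diag l ** transpose g"
    "l $ 1 \<noteq> l $ 2" "l $ 2 \<noteq> l $ 3" "l $ 3 \<noteq> l $ 1"
    by (rule diagonalize_complex[OF x(2) x(3)[unfolded ev_Discr[OF x(2)]]])
  have "g *v (transpose g *v v) = v"
    unfolding matrix_vector_mul_assoc rotation_matrixD(2)[OF gl(1)] by simp
  then have "x = ract g (transpose g *v v, diag l)"
    unfolding x(1) ract_def fst_conv snd_conv gl(2)[symmetric] by simp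
  then show thesis using gl that by simp
qed

lemma vandermonde_zero:
  fixes a b c x y z :: "'a::field"
  assumes "a + b + c = 0" "x * a + y * b + z * c = 0" "x^2 * a + y^2 * b + z^2 * c = 0"
    and "x \<noteq> y" "y \<noteq> z" "z \<noteq> x"
  shows "a = 0" "b = 0" "c = 0"
proof -
  have "(x - y) * (x - z) * a = (x^2 * a + y^2 * b + z^2 * c) - (y + z) * (x * a + y * b + z * c) + y * z * (a + b + c)"
    "(y - x) * (y - z) * b = (x^2 * a + y^2 * b + z^2 * c) - (x + z) * (x * a + y * b + z * c) + x * z * (a + b + c)"
    "(z - x) * (z - y) * c = (x^2 * a + y^2 * b + z^2 * c) - (x + y) * (x * a + y * b + z * c) + x * y * (a + b + c)"
    by (simp_all add: algebra_simps power2_eq_square)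
  then show "a = 0" "b = 0" "c = 0" using assms by simp_all
qed

text \<open>Shows that three power sums determine the cubic with given roots; the factor 6 clears
  the denominators of Newton's identities.\<close>

lemma newton_cubic:
  fixes a b c t :: "'a::field_char_0"
  shows "6 * ((t - a) * (t - b) * (t - c)) = 6 * t^3 - 6 * (a + b + c) * t^2 +
    3 * ((a + b + c)^2 - (a^2 + b^2 + c^2)) * t
    - ((a + b + c)^3 - 3 * (a + b + c) * (a^2 + b^2 + c^2) + 2 * (a^3 + b^3 + c^3))"
  by (simp add: algebra_simps power2_eq_square power3_eq_cube)

text \<open>On the slice, equal traces give the same eigenvalues up to a permutation, equal moments
  give the same squares of the coordinates by Vandermonde, and \<open>dp\<close> controls the
  product of the remaining signs. Each correction is made by a signed permutation of determinant
  one.\<close>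

lemma orbit_separation:
  assumes x: "x \<in> points_of X0" and y: "y \<in> points_of X0" and eq: "\<And>P. P \<in> Inv_alg \<Longrightarrow> ev x P = ev y P"
  shows "\<exists>g. rotation_matrix g \<and> y = ract g x"
proof -
  obtain g v l where x': "rotation_matrix g" "x = ract g (v, diag l)"
    "l $ 1 \<noteq> l $ 2" "l $ 2 \<noteq> l $ 3" "l $ 3 \<noteq> l $ 1" by (rule slice_representative[OF x])
  obtain g' v' l' where y': "rotation_matrix g'" "y = ract g' (v', diag l')"
    "l' $ 1 \<noteq> l' $ 2" "l' $ 2 \<noteq> l' $ 3" "l' $ 3 \<noteq> l' $ 1" by (rule slice_representative[OF y])
  have eq': "ev (v, diag l) P = ev (v', diag l') P" if "P \<in> Inv_alg" for P
    using eq[OF that] unfolding x'(2) y'(2)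
    by (simp add: Inv_alg_invariant[OF that x'(1) diag_symmetric] Inv_alg_invariant[OF that y'(1) diag_symmetric])
  have tpe: "l $ 1 ^ n + l $ 2 ^ n + l $ 3 ^ n = l' $ 1 ^ n + l' $ 2 ^ n + l' $ 3 ^ n" if "n \<in> {1, 2, 3}" for n
    using eq'[OF Inv_alg.tp[OF that]] by (simp add: tp_diag sum_3)
  have t1: "l $ 1 + l $ 2 + l $ 3 = l' $ 1 + l' $ 2 + l' $ 3" using tpe[of 1] by simp
  have t2: "l $ 1 ^ 2 + l $ 2 ^ 2 + l $ 3 ^ 2 = l' $ 1 ^ 2 + l' $ 2 ^ 2 + l' $ 3 ^ 2" by (rule tpe) simp
  have t3: "l $ 1 ^ 3 + l $ 2 ^ 3 + l $ 3 ^ 3 = l' $ 1 ^ 3 + l' $ 2 ^ 3 + l' $ 3 ^ 3" by (rule tpe) simp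
  have poly: "(t - l $ 1) * (t - l $ 2) * (t - l $ 3) = (t - l' $ 1) * (t - l' $ 2) * (t - l' $ 3)" for t
  proof -
    have "6 * ((t - l $ 1) * (t - l $ 2) * (t - l $ 3)) = 6 * ((t - l' $ 1) * (t - l' $ 2) * (t - l' $ 3))"
      unfolding newton_cubic by (simp only: t1 t2 t3)
    then show ?thesis by simp
  qed
  have "(l' $ i - l $ 1) * (l' $ i - l $ 2) * (l' $ i - l $ 3) =
    (l' $ i - l' $ 1) * (l' $ i - l' $ 2) * (l' $ i - l' $ 3)" for i by (rule poly)
  moreover have "(l' $ i - l' $ 1) * (l' $ i - l' $ 2) * (l' $ i - l' $ 3) = 0" for i
    using exhaust_3[of i] by auto
  ultimately have "(l' $ i - l $ 1) * (l' $ i - l $ 2) * (l' $ i - l $ 3) = 0" for i by (simp only:)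
  then have cases: "l' $ i = l $ 1 \<or> l' $ i = l $ 2 \<or> l' $ i = l $ 3" for i by simp
  have "\<exists>j. l' $ i = l $ j" for i using cases[of i] by (elim disjE) (rule exI, assumption)+
  then have "\<exists>\<pi>. \<forall>i. l' $ i = l $ \<pi> i" by (intro choice allI)
  then obtain \<pi> where \<pi>': "\<forall>i. l' $ i = l $ \<pi> i" by (rule exE)
  then have \<pi>: "l' $ i = l $ \<pi> i" for i by simp
  have dist': "l' $ i \<noteq> l' $ j" if "i \<noteq> j" for i j
    using y'(3-5) that exhaust_3[of i] exhaust_3[of j] by auto
  have "inj \<pi>"
  proof (rule injI)
    fix i j assume "\<pi> i = \<pi> j"
    then have "l' $ i = l' $ j" by (simp only: \<pi>)
    then show "i = j" using dist'[of i j] by auto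
  qed
  then have "bij \<pi>" using endo_inj_surj[of UNIV \<pi>] by (simp add: bij_def)
  then have perm: "\<pi> \<in> perms" unfolding perms_def by (intro CollectI bij_imp_permutes) simp_all
  \<comment> \<open>One sign compensates the sign of the permutation, so that the matrix is a
    rotation; the other signs are settled below.\<close>
  define \<epsilon>0 :: "3 \<Rightarrow> complex" where "\<epsilon>0 i = (if i = 3 then of_int (sign \<pi>) else 1)" for i
  have e0: "\<epsilon>0 i * \<epsilon>0 i = 1" for i by (simp add: \<epsilon>0_def sign_def)
  have r0: "rotation_matrix (wmat \<pi> \<epsilon>0)"
    by (rule wmat_rotation[OF perm e0]) (simp add: prod_3 \<epsilon>0_def)
  define u where "u = (\<chi> i. \<epsilon>0 i * v $ \<pi> i)"
  have u: "ract (wmat \<pi> \<epsilon>0) (v, diag l) = (u, diag l')"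
    unfolding ract_wmat_diag[OF perm e0] u_def \<pi>[symmetric] vec_lambda_eta by (rule refl)
  have eq'': "ev (u, diag l') P = ev (v', diag l') P" if "P \<in> Inv_alg" for P
    unfolding u[symmetric] using Inv_alg_invariant[OF that r0 diag_symmetric] eq'[OF that] by simp
  have ppe: "l' $ 1 ^ n * (u $ 1 * u $ 1 - v' $ 1 * v' $ 1) + l' $ 2 ^ n * (u $ 2 * u $ 2 - v' $ 2 * v' $ 2)
    + l' $ 3 ^ n * (u $ 3 * u $ 3 - v' $ 3 * v' $ 3) = 0" if "n \<in> {0, 1, 2}" for n
    using eq''[OF Inv_alg.pp[OF that]] by (simp add: pp_diag sum_3 algebra_simps)
  define d where "d i = u $ i * u $ i - v' $ i * v' $ i" for i
  have d: "d 1 + d 2 + d 3 = 0" "l' $ 1 * d 1 + l' $ 2 * d 2 + l' $ 3 * d 3 = 0"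
    "l' $ 1 ^ 2 * d 1 + l' $ 2 ^ 2 * d 2 + l' $ 3 ^ 2 * d 3 = 0"
    unfolding d_def using ppe[of 0] ppe[of 1] ppe[of 2] by simp_all
  have "d 1 = 0" "d 2 = 0" "d 3 = 0" using vandermonde_zero[OF d y'(3-5)] by blast+
  then have "d i = 0" for i using exhaust_3[of i] by auto
  then have sq: "u $ i * u $ i = v' $ i * v' $ i" for i by (simp add: d_def)
  have ex: "\<exists>e. e * e = 1 \<and> v' $ i = e * u $ i" for i
  proof -
    have "(v' $ i - u $ i) * (v' $ i + u $ i) = 0" using sq[of i] by (simp add: algebra_simps)
    then have "v' $ i = u $ i \<or> v' $ i = - u $ i" by (auto simp: add_eq_0_iff)
    then show ?thesis
    proof
      assume "v' $ i = u $ i"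
      then show ?thesis by (intro exI[of _ 1]) simp
    next
      assume "v' $ i = - u $ i"
      then show ?thesis by (intro exI[of _ "-1"]) simp
    qed
  qed
  have "\<exists>\<delta>. \<forall>i. \<delta> i * \<delta> i = 1 \<and> v' $ i = \<delta> i * u $ i" by (rule choice) (use ex in simp)
  then obtain \<delta> where "\<forall>i. \<delta> i * \<delta> i = 1 \<and> v' $ i = \<delta> i * u $ i" by (rule exE)
  then have \<delta>: "\<delta> i * \<delta> i = 1" "v' $ i = \<delta> i * u $ i" for i by simp_all
  have "(l' $ 2 - l' $ 1) * (l' $ 3 - l' $ 1) * (l' $ 3 - l' $ 2) \<noteq> 0" using y'(3-5) by simp
  then have "u $ 1 * u $ 2 * u $ 3 = v' $ 1 * v' $ 2 * v' $ 3"
    using eq''[OF Inv_alg.dp] by (simp add: dp_diag)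
  then have dprod: "(\<delta> 1 * \<delta> 2 * \<delta> 3 - 1) * (u $ 1 * u $ 2 * u $ 3) = 0"
    unfolding \<delta>(2)[of 1] \<delta>(2)[of 2] \<delta>(2)[of 3] by (simp add: algebra_simps)
  have pm: "\<delta> 1 * \<delta> 2 * \<delta> 3 = 1 \<or> \<delta> 1 * \<delta> 2 * \<delta> 3 = - 1"
  proof -
    have "(\<delta> 1 * \<delta> 2 * \<delta> 3) * (\<delta> 1 * \<delta> 2 * \<delta> 3) = (\<delta> 1 * \<delta> 1) * (\<delta> 2 * \<delta> 2) * (\<delta> 3 * \<delta> 3)" by (simp only: mult_ac)
    then show ?thesis using \<delta>(1) by (simp add: square_eq_1_iff)
  qed
  \<comment> \<open>If the product of the signs is -1, then \<open>dprod\<close> forces some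
    coordinate to be zero, and its sign may be flipped freely.\<close>
  have "\<exists>\<epsilon>. (\<forall>i. \<epsilon> i * \<epsilon> i = 1) \<and> \<epsilon> 1 * \<epsilon> 2 * \<epsilon> 3 = 1 \<and> (\<forall>i. v' $ i = \<epsilon> i * u $ i)"
  proof (cases "\<delta> 1 * \<delta> 2 * \<delta> 3 = 1")
    case True
    then show ?thesis using \<delta> by (intro exI[of _ \<delta>]) simp
  next
    case False
    then have m: "\<delta> 1 * \<delta> 2 * \<delta> 3 = - 1" and "u $ 1 * u $ 2 * u $ 3 = 0" using pm dprod by auto
    then have "u $ 1 = 0 \<or> u $ 2 = 0 \<or> u $ 3 = 0" by simp
    then obtain k where k: "u $ k = 0" by blast
    have "(\<delta>(k := - \<delta> k)) 1 * (\<delta>(k := - \<delta> k)) 2 * (\<delta>(k := - \<delta> k)) 3 = 1"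
      using exhaust_3[of k] m by auto
    then show ?thesis using \<delta> k by (intro exI[of _ "\<delta>(k := - \<delta> k)"]) auto
  qed
  then obtain \<epsilon> where "\<forall>i. \<epsilon> i * \<epsilon> i = 1" "\<epsilon> 1 * \<epsilon> 2 * \<epsilon> 3 = 1" "\<forall>i. v' $ i = \<epsilon> i * u $ i"
    by (elim exE conjE)
  then have \<epsilon>: "\<epsilon> i * \<epsilon> i = 1" "\<epsilon> 1 * \<epsilon> 2 * \<epsilon> 3 = 1" "v' $ i = \<epsilon> i * u $ i" for i by simp_all
  have id: "id \<in> perms" by (simp add: perms_def permutes_id)
  have r1: "rotation_matrix (wmat id \<epsilon>)"
    by (rule wmat_rotation[OF id \<epsilon>(1)]) (simp add: prod_3 sign_id \<epsilon>(2))
  have w1: "ract (wmat id \<epsilon>) (u, diag l') = (v', diag l')"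
    unfolding ract_wmat_diag[OF id \<epsilon>(1)] by (simp add: vec_eq_iff \<epsilon>(3))
  have "ract (transpose g) x = (v, diag l)"
    unfolding x'(2) ract_ract rotation_matrixD(1)[OF x'(1)] by (rule ract_mat1)
  then have "y = ract g' (ract (wmat id \<epsilon>) (ract (wmat \<pi> \<epsilon>0) (ract (transpose g) x)))"
    by (simp add: u w1 y'(2))
  then have "y = ract (g' ** (wmat id \<epsilon> ** (wmat \<pi> \<epsilon>0 ** transpose g))) x" by (simp only: ract_ract)
  moreover have "rotation_matrix (g' ** (wmat id \<epsilon> ** (wmat \<pi> \<epsilon>0 ** transpose g)))"
    by (intro rotation_matrix_mult y'(1) r1 r0) (simp add: rotation_matrix_transpose x'(1))
  ultimately show ?thesis by blast
qed


text \<open>Cayley and Hamilton as an identity of polynomials, written with constants, sums,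
  differences and products only: in \<open>points_exist\<close> it is read inside a set closed under
  just these operations.\<close>

lemma pp_recursion: "pp (n + 3) = tp 1 * pp (n + 2) + Const (-1/2) * (tp 1 * tp 1 - tp 2) * pp (n + 1) +
  Const (1/6) * (tp 1 * tp 1 * tp 1 - Const 3 * tp 1 * tp 2 + Const 2 * tp 3) * pp n"
proof (rule spt_dense)
  fix y assume y: "y \<in> YR"
  define a b c where abc: "a = lamf y 1" "b = lamf y 2" "c = lamf y 3"
  define p q r where pqr: "p = vecf y 1 * vecf y 1" "q = vecf y 2 * vecf y 2" "r = vecf y 3 * vecf y 3"
  have t: "ev (spt y) (tp 1) = a + b + c" "ev (spt y) (tp 2) = a^2 + b^2 + c^2"
    "ev (spt y) (tp 3) = a^3 + b^3 + c^3"
    unfolding abc ev_spt_tp[OF y] by (simp_all add: sum_3)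
  have P: "ev (spt y) (pp k) = a ^ k * p + b ^ k * q + c ^ k * r" for k
    unfolding abc pqr ev_spt_pp[OF y] by (simp add: sum_3)
  define E1 where "E1 = a + b + c"
  define E2 where "E2 = - (a * b + b * c + c * a)"
  define E3 where "E3 = a * b * c"
  have q2: "(a + b + c) * (a + b + c) - (a^2 + b^2 + c^2) = 2 * (a * b + b * c + c * a)"
    and q3: "(a + b + c) * (a + b + c) * (a + b + c) - 3 * (a + b + c) * (a^2 + b^2 + c^2) + 2 * (a^3 + b^3 + c^3) = 6 * (a * b * c)"
    by (simp_all add: power2_eq_square power3_eq_cube algebra_simps)
  have E: "ev (spt y) (Const (-1/2) * (tp 1 * tp 1 - tp 2)) = E2"
    "ev (spt y) (Const (1/6) * (tp 1 * tp 1 * tp 1 - Const 3 * tp 1 * tp 2 + Const 2 * tp 3)) = E3"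
    unfolding evl_add evl_mult evl_diff evl_Const t of_real_eq_id id_apply q2 q3 E2_def E3_def by simp_all
  have cubic: "x ^ (n + 3) = E1 * x ^ (n + 2) + E2 * x ^ (n + 1) + E3 * x ^ n" if "x = a \<or> x = b \<or> x = c" for x
  proof -
    have "(x - a) * ((x - b) * (x - c)) * x ^ n = 0" using that by auto
    then show ?thesis unfolding E1_def E2_def E3_def
      by (simp add: algebra_simps power_add power2_eq_square power3_eq_cube)
  qed
  have "ev (spt y) (pp (n + 3)) = E1 * ev (spt y) (pp (n + 2)) + E2 * ev (spt y) (pp (n + 1)) + E3 * ev (spt y) (pp n)"
    unfolding P cubic[of a, OF disjI1[OF refl]] cubic[of b, OF disjI2[OF disjI1[OF refl]]]
      cubic[of c, OF disjI2[OF disjI2[OF refl]]]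
    by (simp only: distrib_left distrib_right mult.assoc add_ac)
  then show "ev (spt y) (pp (n + 3)) = ev (spt y) (tp 1 * pp (n + 2) + Const (-1/2) * (tp 1 * tp 1 - tp 2) * pp (n + 1) +
    Const (1/6) * (tp 1 * tp 1 * tp 1 - Const 3 * tp 1 * tp 2 + Const 2 * tp 3) * pp n)"
    by (subst evl_add, subst evl_add, subst evl_mult, subst evl_mult, subst evl_mult, subst E, subst E, subst t) (simp only: E1_def)
qed

text \<open>A Gram determinant: \<open>M ** transpose M\<close> has the moments as entries. This
  relation fixes the value of \<open>dp\<close> up to sign once traces and moments are
  given.\<close>

lemma dp_square: "dp * dp = det (\<chi> i j. pp (pos i + pos j))"
proof (rule spt_dense)
  fix y assume y: "y \<in> YR"
  define M :: "real^3^3" where "M = (\<chi> i k. lamf y k ^ pos i * vecf y k)"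
  have "ev (spt y) (det (\<chi> i j. pp (pos i + pos j))) = det (M ** transpose M)"
    unfolding evl_det
    by (simp add: M_def matrix_matrix_mult_def transpose_def ev_spt_pp[OF y] power_add mult_ac)
  also have "\<dots> = det M * det M" by (simp add: det_mul)
  also have "det M = ev (spt y) dp"
    unfolding ev_spt_dp[OF y] by (simp add: M_def det_3 pos_def power2_eq_square algebra_simps)
  finally show "ev (spt y) (dp * dp) = ev (spt y) (det (\<chi> i j. pp (pos i + pos j)))" by simp
qed

text \<open>The point is built on the slice: eigenvalues as roots of the cubic prescribed by the
  traces, squares of the coordinates from the moments, and a global sign from \<open>dp\<close>.
  That \<open>Discr\<close> has nonzero image makes the eigenvalues distinct, so the Vandermonde
  system is solvable.\<close>

lemma points_exist:
  assumes c: "\<And>r. \<psi> (Const r) = complex_of_real r"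
    and a: "\<And>P Q. P \<in> poly_invariants \<Longrightarrow> Q \<in> poly_invariants \<Longrightarrow> \<psi> (P + Q) = \<psi> P + \<psi> Q"
    and m: "\<And>P Q. P \<in> poly_invariants \<Longrightarrow> Q \<in> poly_invariants \<Longrightarrow> \<psi> (P * Q) = \<psi> P * \<psi> Q"
    and D: "\<psi> Discr \<noteq> 0"
  shows "\<exists>x\<in>points_of X0. \<forall>P\<in>poly_invariants. ev x P = \<psi> P"
proof -
  have inv: "tp n \<in> poly_invariants" "pp k \<in> poly_invariants" "dp \<in> poly_invariants"
    if "n \<in> {1, 2, 3}" "k \<in> {0, 1, 2}" for n k
    using that by (blast intro: Inv_alg_poly_invariants Inv_alg.intros)+
  obtain l1 l2 l3 where e: "l1 + l2 + l3 = \<psi> (tp 1)" "l1 * l2 + l2 * l3 + l3 * l1 = (\<psi> (tp 1) ^ 2 - \<psi> (tp 2)) / 2"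
    "l1 * l2 * l3 = (\<psi> (tp 1) ^ 3 - 3 * \<psi> (tp 1) * \<psi> (tp 2) + 2 * \<psi> (tp 3)) / 6"
    by (rule cubic_roots)
  define l where "l = (vector [l1, l2, l3] :: complex^3)"
  \<comment> \<open>The invariants on which evaluation at \<open>x\<close> agrees with
    \<open>\<psi>\<close>. It is a subalgebra, so membership is propagated from generators through
    polynomial identities.\<close>
  define S where "S x = {P \<in> poly_invariants. ev x P = \<psi> P}" for x
  have S: "Const r \<in> S x" "P \<in> S x \<Longrightarrow> Q \<in> S x \<Longrightarrow> P + Q \<in> S x"
    "P \<in> S x \<Longrightarrow> Q \<in> S x \<Longrightarrow> P * Q \<in> S x" for r P Q x
    by (simp_all add: S_def c a m poly_invariants_closed)
  have tpS: "tp n \<in> S (v, diag l)" if n: "n \<in> {1, 2, 3}" for n v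
  proof -
    have p1: "l1 + l2 + l3 = \<psi> (tp 1)" by (rule e)
    have "l1^2 + l2^2 + l3^2 = (l1 + l2 + l3)^2 - 2 * (l1 * l2 + l2 * l3 + l3 * l1)"
      by (simp add: power2_eq_square algebra_simps)
    then have p2: "l1^2 + l2^2 + l3^2 = \<psi> (tp 2)" unfolding e by simp
    have "2 * (l1^3 + l2^3 + l3^3) = 6 * (l1 * l2 * l3) - (l1 + l2 + l3)^3 + 3 * (l1 + l2 + l3) * (l1^2 + l2^2 + l3^2)"
      by (simp add: power2_eq_square power3_eq_cube algebra_simps)
    moreover have "6 * (l1 * l2 * l3) = \<psi> (tp 1) ^ 3 - 3 * \<psi> (tp 1) * \<psi> (tp 2) + 2 * \<psi> (tp 3)" unfolding e(3) by simp
    ultimately have "2 * (l1^3 + l2^3 + l3^3) = 2 * \<psi> (tp 3)" unfolding e(1) p2 by simp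
    then have p3: "l1^3 + l2^3 + l3^3 = \<psi> (tp 3)" unfolding mult_cancel_left by simp
    have "ev (v, diag l) (tp n) = l1 ^ n + l2 ^ n + l3 ^ n" by (simp add: tp_diag sum_3 l_def)
    then show ?thesis using n p1 p2 p3 inv(1) by (auto simp: S_def)
  qed
  have DS: "Discr \<in> S (v, diag l)" for v
    by (rule Discr_in_subalgebra) (simp_all add: S tpS)
  then have Dnz: "ev (v, diag l) Discr \<noteq> 0" for v using D by (simp add: S_def)
  have dist: "l $ 1 \<noteq> l $ 2" "l $ 2 \<noteq> l $ 3" "l $ 3 \<noteq> l $ 1" using Dnz[of 0] unfolding Discr_diag by auto
  define V :: "complex^3^3" where "V = (\<chi> i k. l $ k ^ pos i)"
  have "det V = (l $ 2 - l $ 1) * (l $ 3 - l $ 1) * (l $ 3 - l $ 2)"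
    by (simp add: V_def det_3 pos_def power2_eq_square algebra_simps)
  then have "det V \<noteq> 0" using dist by simp
  then have "invertible V" by (simp add: invertible_det_nz)
  then obtain U where U: "V ** U = mat 1" unfolding invertible_def by auto
  \<comment> \<open>The prospective squares of the coordinates of \<open>v\<close>: the solution of
    the Vandermonde system whose right side consists of the three prescribed moments.\<close>
  define w where "w = U *v (\<chi> i. \<psi> (pp (pos i)))"
  have "V *v w = (\<chi> i. \<psi> (pp (pos i)))" by (simp add: w_def matrix_vector_mul_assoc U)
  then have "(V *v w) $ i = \<psi> (pp (pos i))" for i by simp
  then have w: "(\<Sum>k\<in>UNIV. l $ k ^ pos i * w $ k) = \<psi> (pp (pos i))" for i
    by (simp add: matrix_vector_mult_def V_def)
  define v where "v = (\<chi> k. csqrt (w $ k))"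
  have sq: "csqrt z * csqrt z = z" for z by (metis power2_csqrt power2_eq_square)
  have ppS: "pp n \<in> S (u, diag l)" if n: "n \<in> {0, 1, 2}" and u: "u = v \<or> u = - v" for n u
  proof -
    have "u $ k * u $ k = w $ k" for k using u by (auto simp: v_def sq)
    then have pd: "ev (u, diag l) (pp n) = (\<Sum>k\<in>UNIV. l $ k ^ n * w $ k)" unfolding pp_diag by simp
    obtain i where "n = pos i" using n by (auto simp: pos_def intro: that[of 1] that[of 2] that[of 3])
    then have "ev (u, diag l) (pp n) = \<psi> (pp n)" using pd w[of i] by simp
    then show ?thesis using inv(2)[OF _ n, of 1] by (simp add: S_def)
  qed
  have Sm: "- P \<in> S x" if "P \<in> S x" for P x
  proof -
    have "Const (-1) * P \<in> S x" by (intro S that)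
    moreover have "Const (-1) * P = - P" by (rule real_poly_eqI) simp
    ultimately show ?thesis by simp
  qed
  have Sd: "P - Q \<in> S x" if "P \<in> S x" "Q \<in> S x" for P Q x
    using S(2)[OF that(1) Sm[OF that(2)]] by simp
  have rec: "pp (n + 3) \<in> S (v, diag l)" if "pp n \<in> S (v, diag l)" "pp (n + 1) \<in> S (v, diag l)" "pp (n + 2) \<in> S (v, diag l)" for n
    unfolding pp_recursion by (intro S Sd that tpS) simp_all
  have p012: "pp 0 \<in> S (v, diag l)" "pp 1 \<in> S (v, diag l)" "pp 2 \<in> S (v, diag l)" by (rule ppS; simp)+
  have p3: "pp 3 \<in> S (v, diag l)" by (rule rec[of 0, unfolded add_0, OF p012])
  have n: "(1::nat) + 1 = 2" "(1::nat) + 2 = 3" "(1::nat) + 3 = 4" by simp_all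
  have p4: "pp 4 \<in> S (v, diag l)" by (rule rec[of 1, unfolded n, OF p012(2,3) p3])
  have p5: "pp (pos i + pos j) \<in> S (v, diag l)" for i j
  proof -
    have "pos i + pos j \<in> {0, 1, 2, 3, 4}" by (simp add: pos_def)
    then show ?thesis using p012 p3 p4 by auto
  qed
  have "dp * dp \<in> S (v, diag l)"
    unfolding dp_square det_3 vec_lambda_beta by (intro S Sd p5)
  then have "ev (v, diag l) dp * ev (v, diag l) dp = \<psi> dp * \<psi> dp"
    using m inv(3)[of 1 0] by (simp add: S_def)
  then have pm: "ev (v, diag l) dp = \<psi> dp \<or> ev (v, diag l) dp = - \<psi> dp" by (simp add: square_eq_iff)
  have neg: "ev (- v, diag l) dp = - ev (v, diag l) dp" by (simp add: dp_diag)
  \<comment> \<open>Passing from \<open>v\<close> to \<open>- v\<close> changes the sign of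
    \<open>dp\<close>, which is of odd degree in \<open>v\<close>, and leaves traces and moments
    alone.\<close>
  have "\<exists>u. (u = v \<or> u = - v) \<and> ev (u, diag l) dp = \<psi> dp"
    using pm
  proof
    assume "ev (v, diag l) dp = \<psi> dp"
    then show ?thesis by (intro exI[of _ v]) simp
  next
    assume "ev (v, diag l) dp = - \<psi> dp"
    then show ?thesis unfolding neg[symmetric] by (intro exI[of _ "- v"]) (simp add: neg)
  qed
  then obtain u where u: "u = v \<or> u = - v" "ev (u, diag l) dp = \<psi> dp" by (elim exE conjE)
  let ?x = "(u, diag l)"
  have alg: "P \<in> S ?x" if "P \<in> Inv_alg" for P
    using that
  proof induction
    case dp
    show ?case using u(2) inv(3)[of 1 0] by (simp add: S_def)
  qed (simp_all add: S tpS ppS[OF _ u(1)])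
  \<comment> \<open>A power of \<open>Discr\<close> carries an arbitrary invariant into the
    generated algebra; both sides give \<open>Discr\<close> the same nonzero value, so it
    cancels.\<close>
  have "ev ?x P = \<psi> P" if P: "P \<in> poly_invariants" for P
  proof -
    obtain n where n: "P * Discr ^ n \<in> Inv_alg" using poly_invariants_power_Discr[OF P] by blast
    have "\<psi> (Discr ^ n) = \<psi> Discr ^ n" for n
      by (induction n) (use c[of 1] in \<open>simp_all add: m poly_invariants_closed\<close>)
    then have "ev ?x P * ev ?x Discr ^ n = \<psi> P * \<psi> Discr ^ n"
      using alg[OF n] by (simp add: S_def m P poly_invariants_closed)
    moreover have "ev ?x Discr = \<psi> Discr" using DS[of u] by (simp add: S_def)
    ultimately show ?thesis using D by simp
  qed
  moreover have "?x \<in> points_of X0"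
    unfolding points_of_X0_iff using Dnz[of u] by (simp add: X_points_def diag_symmetric)
  ultimately show ?thesis by blast
qed

section \<open>The ring of invariant sections\<close>

global_interpretation RX: domain_ring RX
  by (rule domain_ring.intro[OF domain_RX])

lemma RX_pow: "P [^]\<^bsub>RX\<^esub> (n::nat) = P ^ n"
  by (induction n) (simp_all add: mult.commute)

lemma Spec_RX:
  assumes "p \<in> Spec RX"
  shows "0 \<in> p" "1 \<notin> p" "P \<in> p \<Longrightarrow> Q \<in> p \<Longrightarrow> P + Q \<in> p" "P \<in> p \<Longrightarrow> P * Q \<in> p"
    "P * Q \<in> p \<longleftrightarrow> P \<in> p \<or> Q \<in> p" "P ^ n \<in> p \<Longrightarrow> P \<in> p"
proof -
  interpret p: primeideal p RX using assms by (simp add: Spec_def)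
  show "0 \<in> p" using additive_subgroup.zero_closed[OF p.additive_subgroup_axioms] by simp
  show one: "1 \<notin> p" using p.one_notin by simp
  show "P \<in> p \<Longrightarrow> Q \<in> p \<Longrightarrow> P + Q \<in> p"
    using additive_subgroup.a_closed[OF p.additive_subgroup_axioms] by simp
  have l: "P * Q \<in> p" if "P \<in> p" for P Q using p.I_r_closed[OF that, of Q] by simp
  then show "P \<in> p \<Longrightarrow> P * Q \<in> p" .
  show iff: "P * Q \<in> p \<longleftrightarrow> P \<in> p \<or> Q \<in> p" for P Q
    using p.I_prime[of P Q] l[of P Q] l[of Q P] by (auto simp: mult.commute)
  show "P ^ n \<in> p \<Longrightarrow> P \<in> p" by (induction n) (use one iff in auto)
qed

lemma X0_Spec: "p \<in> X0 \<Longrightarrow> p \<in> Spec RX" and X0_Discr: "p \<in> X0 \<Longrightarrow> Discr ^ n \<notin> p"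
  using Spec_RX(6) by (auto simp: X0_def)

lemma openin_X0: "openin (zariski RX) X0"
  unfolding X0_def by (rule RX.openin_basic) simp

lemma zero_in_X0: "{0} \<in> X0"
  using RX.zero_in_Spec Discr_nz by (simp add: X0_def)

text \<open>The fraction \<open>P / Discr ^ n\<close> as a section over \<open>X0\<close>. All
  elements of the invariant ring take this form by \<open>carrier_BB\<close>.\<close>

definition bet :: "real_poly \<Rightarrow> nat \<Rightarrow> real_poly local_section"
  where "bet P n = frac_section RX X0 P (Discr ^ n)"

lemma bet_apply: "p \<in> X0 \<Longrightarrow> bet P n p = frac RX p P (Discr ^ n)"
  by (simp add: bet_def frac_section_def)

lemma bet_ext: "p \<notin> X0 \<Longrightarrow> bet P n p = undefined"
  by (simp add: bet_def frac_section_def)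

lemma frac_RX_iff:
  assumes "p \<in> Spec RX" "f \<notin> p" "g \<notin> p"
  shows "frac RX p a f = frac RX p b g \<longleftrightarrow> a * g = b * f"
  using RX.frac_eq_iff[of p a f b g] assms by simp

lemma bet_eq_iff: "bet P n = bet Q m \<longleftrightarrow> P * Discr ^ m = Q * Discr ^ n"
proof
  assume "bet P n = bet Q m"
  then have "bet P n {0} = bet Q m {0}" by simp
  then show "P * Discr ^ m = Q * Discr ^ n"
    using X0_Discr[OF zero_in_X0] by (simp add: bet_apply[OF zero_in_X0] frac_RX_iff[OF X0_Spec[OF zero_in_X0]])
next
  assume eq: "P * Discr ^ m = Q * Discr ^ n"
  show "bet P n = bet Q m"
  proof (rule HOL.ext)
    fix p show "bet P n p = bet Q m p"
      using eq X0_Discr[of p] by (cases "p \<in> X0") (simp_all add: bet_apply bet_ext frac_RX_iff X0_Spec)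
  qed
qed

lemma section_value_frac:
  assumes "s {P. eval_at x P = 0} = frac RX {P. eval_at x P = 0} a f" "ev x f \<noteq> 0"
  shows "section_value s x = ev x a / ev x f"
proof -
  let ?k = "{P. eval_at x P = 0}"
  have S: "?k \<in> Spec RX" by (rule kernel_Spec)
  have f: "f \<in> carrier RX - ?k" using assms(2) by (simp add: eval_at_ev)
  have mem: "(a, f) \<in> frac RX ?k a f" using RX.frac_mem[OF S _ f] by simp
  have "ev x b / ev x t = ev x a / ev x f" if "(b, t) \<in> frac RX ?k a f" for b t
  proof -
    have "t \<notin> ?k" "a * t = b * f" using that RX.frac_eq[OF S _ f, of a] by auto
    then have t: "ev x t \<noteq> 0" and eq: "a * t = b * f" by (simp_all add: eval_at_ev)
    have "ev x (a * t) = ev x (b * f)" by (simp only: eq)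
    then show ?thesis using assms(2) t by (simp add: frac_eq_eq)
  qed
  then have sub: "(\<lambda>(a, f). eval_at x a / eval_at x f) ` frac RX ?k a f \<subseteq> {ev x a / ev x f}"
    by (auto simp: eval_at_ev)
  have "ev x a / ev x f \<in> (\<lambda>(a, f). eval_at x a / eval_at x f) ` frac RX ?k a f"
    by (rule image_eqI[OF _ mem]) (simp add: eval_at_ev)
  with sub have "(\<lambda>(a, f). eval_at x a / eval_at x f) ` frac RX ?k a f = {ev x a / ev x f}"
    by (intro equalityI) simp_all
  then show ?thesis unfolding section_value_def assms(1) by simp
qed

lemma section_value_bet:
  assumes "x \<in> points_of X0"
  shows "section_value (bet P n) x = ev x P / ev x Discr ^ n"
proof -
  have "{P. eval_at x P = 0} \<in> X0" using assms unfolding points_of_def by (rule CollectE) (rule conjunct2)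
  then have "bet P n {P. eval_at x P = 0} = frac RX {P. eval_at x P = 0} P (Discr ^ n)" by (rule bet_apply)
  moreover have "ev x (Discr ^ n) \<noteq> 0" using assms by (simp add: points_of_X0_iff)
  ultimately show ?thesis using section_value_frac[of "bet P n" x P "Discr ^ n"] by simp
qed

lemma ract_points_X0: "rotation_matrix g \<Longrightarrow> x \<in> points_of X0 \<Longrightarrow> ract g x \<in> points_of X0"
  using act_X_points[of x g] poly_invariantsD[OF poly_invariants_closed(4), of g x]
  by (simp add: points_of_X0_iff act_ract)

text \<open>Both sides of the invariance equation are polynomial along the line joining \<open>x\<close> to a point where
  \<open>Q\<close> does not vanish.\<close>

lemma invariant_dense:
  assumes Q: "Q \<noteq> 0" and inv: "\<And>g x. rotation_matrix g \<Longrightarrow> x \<in> X_points \<Longrightarrow> ev x Q \<noteq> 0 \<Longrightarrow> ev (ract g x) a = ev x a"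
  shows "a \<in> poly_invariants"
  unfolding poly_invariants_def
proof (intro CollectI ballI)
  fix g :: "complex^3^3" and x :: point
  assume "g \<in> SO3" and x: "x \<in> X_points"
  then have g: "rotation_matrix g" by (simp add: SO3_iff)
  obtain f :: "coord \<Rightarrow> real" where f: "evl f Q \<noteq> 0" using real_poly_zero Q by blast
  obtain v0 A0 where x0: "transpose A0 = A0" "\<And>c. cval c (v0, A0) = complex_of_real (f c)"
    using coords_surj[of "\<lambda>c. complex_of_real (f c)"] by metis
  obtain v A where vA: "x = (v, A)" "transpose A = A" using x by (cases x) (auto simp: X_points_def)
  have Q0: "ev (v0, A0) Q \<noteq> 0" using f by (simp add: x0(2) evl_of_real)
  define L where "L t = ((\<chi> i. v0 $ i + t * (v $ i - v0 $ i)), A0 + (\<chi> i j. t * (A $ i $ j - A0 $ i $ j)))" for t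
  have At: "A $ i $ j = A $ j $ i" "A0 $ i $ j = A0 $ j $ i" for i j
    using arg_cong[OF vA(2), of "\<lambda>M. M $ j $ i"] arg_cong[OF x0(1), of "\<lambda>M. M $ j $ i"] by (simp_all add: transpose_def)
  have LX: "L t \<in> X_points" for t
    unfolding L_def X_points_iff by (simp add: vec_eq_iff transpose_def At[of _ "_ :: 3"])
  have cL: "cval c (L t) = cval c (v0, A0) + t * (cval c x - cval c (v0, A0))" for c t
    by (cases c) (simp_all add: L_def vA)
  have cgL: "cval c (ract g (L t)) = cval c (ract g (v0, A0)) + t * (cval c (ract g x) - cval c (ract g (v0, A0)))" for c t
  proof -
    have 1: "(g *v (\<chi> i. v0 $ i + t * (v $ i - v0 $ i))) $ i = (g *v v0) $ i + t * ((g *v v) $ i - (g *v v0) $ i)" for i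
      by (simp add: matrix_vector_mult_def sum_3 algebra_simps)
    have 2: "(g ** (A0 + (\<chi> i j. t * (A $ i $ j - A0 $ i $ j))) ** transpose g) $ i $ j =
      (g ** A0 ** transpose g) $ i $ j + t * ((g ** A ** transpose g) $ i $ j - (g ** A0 ** transpose g) $ i $ j)" for i j
      by (simp add: matrix_matrix_mult_def sum_3 algebra_simps)
    show ?thesis by (cases c) (simp_all add: ract_def L_def vA 1 2)
  qed
  obtain q where q: "\<forall>t. evl (\<lambda>c. cval c (v0, A0) + t * (cval c x - cval c (v0, A0))) Q = poly q t"
    using evl_line[of "\<lambda>c. cval c (v0, A0)" "\<lambda>c. cval c x" Q] by (rule exE)
  obtain r where r: "\<forall>t. evl (\<lambda>c. cval c (v0, A0) + t * (cval c x - cval c (v0, A0))) a = poly r t"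
    using evl_line[of "\<lambda>c. cval c (v0, A0)" "\<lambda>c. cval c x" a] by (rule exE)
  obtain r' where r': "\<forall>t. evl (\<lambda>c. cval c (ract g (v0, A0)) + t * (cval c (ract g x) - cval c (ract g (v0, A0)))) a = poly r' t"
    using evl_line[of "\<lambda>c. cval c (ract g (v0, A0))" "\<lambda>c. cval c (ract g x)" a] by (rule exE)
  have qr: "ev (L t) Q = poly q t" "ev (L t) a = poly r t" "ev (ract g (L t)) a = poly r' t" for t
    unfolding cL cgL using q r r' by simp_all
  have "poly (q * (r' - r)) t = 0" for t
    using inv[OF g LX[of t]] qr[of t] by auto
  then have "q * (r' - r) = 0" using poly_all_0_iff_0 by blast
  moreover have "poly q 0 \<noteq> 0" using Q0 qr(1)[of 0] by (simp add: L_def zero_vec_def[symmetric] vec_eq_iff)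
  then have "q \<noteq> 0" by auto
  ultimately have "r' = r" by simp
  then have "ev (ract g (L 1)) a = ev (L 1) a" unfolding qr by simp
  moreover have "L 1 = x" by (simp add: L_def vA vec_eq_iff)
  ultimately show "eval_at (act g x) a = eval_at x a" by (simp add: eval_at_ev act_ract)
qed

abbreviation BB :: "real_poly local_section ring" where "BB \<equiv> invariant_ring X0"

text \<open>\<open>X0\<close> is the basic open set of \<open>Discr\<close>, so a section is one
  fraction \<open>a / Discr ^ n\<close>. As \<open>Discr\<close> is invariant, invariance of the
  values passes to \<open>a\<close> off the zeros of \<open>Discr\<close>, and everywhere by
  \<open>invariant_dense\<close>.\<close>

lemma carrier_BB: "carrier BB = {bet P n | P n. P \<in> poly_invariants}"
proof (intro equalityI subsetI)
  fix s assume "s \<in> carrier BB"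
  then have s: "s \<in> sections RX X0" "\<And>g x. rotation_matrix g \<Longrightarrow> x \<in> points_of X0 \<Longrightarrow> section_value s (ract g x) = section_value s x"
    by (auto simp: invariant_ring_def SO3_iff act_ract)
  obtain a n where a: "\<And>p. p \<in> X0 \<Longrightarrow> Discr \<notin> p \<Longrightarrow> s p = frac RX p a (Discr [^]\<^bsub>RX\<^esub> (n::nat))"
    by (rule RX.section_on_basic[OF openin_X0 s(1), of Discr]) (auto simp: X0_def)
  have "s = bet a n"
  proof (rule HOL.ext)
    fix p show "s p = bet a n p"
      using a[of p] s(1) by (cases "p \<in> X0") (auto simp: bet_apply bet_ext RX_pow X0_def sections_def PiE_def extensional_def)
  qed
  moreover have "a \<in> poly_invariants"
  proof (rule invariant_dense[OF Discr_nz])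
    fix g :: "complex^3^3" and x assume gx: "rotation_matrix g" "x \<in> X_points" "ev x Discr \<noteq> 0"
    then have x: "x \<in> points_of X0" by (simp add: points_of_X0_iff)
    have "ev (ract g x) Discr = ev x Discr" using poly_invariantsD[OF poly_invariants_closed(4) gx(1,2)] .
    then show "ev (ract g x) a = ev x a"
      using s(2)[OF gx(1) x] gx(3) unfolding \<open>s = bet a n\<close>
      by (simp add: section_value_bet x ract_points_X0[OF gx(1) x])
  qed
  ultimately show "s \<in> {bet P n | P n. P \<in> poly_invariants}" by blast
next
  fix s assume "s \<in> {bet P n | P n. P \<in> poly_invariants}"
  then obtain P n where P: "s = bet P n" "P \<in> poly_invariants" by blast
  have "s \<in> sections RX X0" unfolding P bet_def
    by (rule RX.frac_section_in_sections[OF openin_X0]) (use X0_Discr in auto)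
  moreover have "section_value s (act g x) = section_value s x" if "g \<in> SO3" "x \<in> points_of X0" for g x
  proof -
    have g: "rotation_matrix g" and x: "x \<in> X_points" using that by (simp_all add: SO3_iff points_of_X0_iff)
    show ?thesis unfolding P(1) act_ract
      using poly_invariantsD[OF P(2) g x] poly_invariantsD[OF poly_invariants_closed(4) g x]
      by (simp add: section_value_bet that ract_points_X0[OF g])
  qed
  ultimately show "s \<in> carrier BB" by (simp add: invariant_ring_def)
qed

lemma bet_in_BB: "P \<in> poly_invariants \<Longrightarrow> bet P n \<in> carrier BB"
  by (auto simp: carrier_BB)

lemma BB_E:
  assumes "b \<in> carrier BB" obtains P n where "P \<in> poly_invariants" "b = bet P n"
  using assms by (auto simp: carrier_BB)

lemma BB_mult: "bet P n \<otimes>\<^bsub>BB\<^esub> bet Q m = bet (P * Q) (n + m)"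
proof (rule HOL.ext)
  fix p show "(bet P n \<otimes>\<^bsub>BB\<^esub> bet Q m) p = bet (P * Q) (n + m) p"
    using RX.stalk_mult[of p P "Discr ^ n" Q "Discr ^ m"] X0_Discr[of p] X0_Spec[of p]
    by (cases "p \<in> X0") (simp_all add: invariant_ring_def section_ring_def bet_apply bet_ext power_add)
qed

lemma BB_add: "bet P n \<oplus>\<^bsub>BB\<^esub> bet Q m = bet (P * Discr ^ m + Q * Discr ^ n) (n + m)"
proof (rule HOL.ext)
  fix p show "(bet P n \<oplus>\<^bsub>BB\<^esub> bet Q m) p = bet (P * Discr ^ m + Q * Discr ^ n) (n + m) p"
    using RX.stalk_add[of p P "Discr ^ n" Q "Discr ^ m"] X0_Discr[of p] X0_Spec[of p]
    by (cases "p \<in> X0") (simp_all add: invariant_ring_def section_ring_def bet_apply bet_ext power_add)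
qed

lemma BB_one: "\<one>\<^bsub>BB\<^esub> = bet 1 0" and BB_zero: "\<zero>\<^bsub>BB\<^esub> = bet 0 0"
  by (auto simp: invariant_ring_def section_ring_def bet_def frac_section_def RX.stalk_one RX.stalk_zero fun_eq_iff)

lemma BB_uminus: "P \<in> poly_invariants \<Longrightarrow> bet (- P) n \<oplus>\<^bsub>BB\<^esub> bet P n = \<zero>\<^bsub>BB\<^esub>"
  by (simp add: BB_add BB_zero bet_eq_iff)

lemma bet_add_closed: "P \<in> poly_invariants \<Longrightarrow> Q \<in> poly_invariants \<Longrightarrow> P * Discr ^ m + Q * Discr ^ n \<in> poly_invariants"
  by (intro poly_invariants_closed)

lemma cring_BB: "cring BB"
proof (rule cringI)
  show "abelian_group BB"
  proof (rule abelian_groupI)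
    show "\<zero>\<^bsub>BB\<^esub> \<in> carrier BB" unfolding BB_zero by (intro bet_in_BB poly_invariants_closed)
    fix x assume "x \<in> carrier BB"
    then obtain P n where e: "P \<in> poly_invariants" "x = bet P n" by (auto simp: carrier_BB)
    show "\<zero>\<^bsub>BB\<^esub> \<oplus>\<^bsub>BB\<^esub> x = x" unfolding e BB_zero BB_add bet_eq_iff by simp
    show "\<exists>y\<in>carrier BB. y \<oplus>\<^bsub>BB\<^esub> x = \<zero>\<^bsub>BB\<^esub>"
      unfolding e by (rule bexI[of _ "bet (- P) n"]) (simp_all add: BB_uminus e bet_in_BB poly_invariants_closed)
    fix y assume "y \<in> carrier BB"
    then obtain Q m where e': "Q \<in> poly_invariants" "y = bet Q m" by (auto simp: carrier_BB)
    show "x \<oplus>\<^bsub>BB\<^esub> y \<in> carrier BB" unfolding e e' BB_add by (intro bet_in_BB bet_add_closed e e')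
    show "x \<oplus>\<^bsub>BB\<^esub> y = y \<oplus>\<^bsub>BB\<^esub> x"
      unfolding e e' BB_add bet_eq_iff by (simp add: algebra_simps power_add)
    fix z assume "z \<in> carrier BB"
    then obtain R k where e'': "R \<in> poly_invariants" "z = bet R k" by (auto simp: carrier_BB)
    show "x \<oplus>\<^bsub>BB\<^esub> y \<oplus>\<^bsub>BB\<^esub> z = x \<oplus>\<^bsub>BB\<^esub> (y \<oplus>\<^bsub>BB\<^esub> z)"
      unfolding e e' e'' BB_add bet_eq_iff by (simp add: algebra_simps power_add)
  qed
  show "comm_monoid BB"
  proof (rule comm_monoidI)
    show "\<one>\<^bsub>BB\<^esub> \<in> carrier BB" unfolding BB_one by (intro bet_in_BB poly_invariants_closed)
    fix x assume "x \<in> carrier BB"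
    then obtain P n where e: "P \<in> poly_invariants" "x = bet P n" by (auto simp: carrier_BB)
    show "\<one>\<^bsub>BB\<^esub> \<otimes>\<^bsub>BB\<^esub> x = x" unfolding e BB_one BB_mult by simp
    fix y assume "y \<in> carrier BB"
    then obtain Q m where e': "Q \<in> poly_invariants" "y = bet Q m" by (auto simp: carrier_BB)
    show "x \<otimes>\<^bsub>BB\<^esub> y \<in> carrier BB" unfolding e e' BB_mult by (intro bet_in_BB poly_invariants_closed e e')
    show "x \<otimes>\<^bsub>BB\<^esub> y = y \<otimes>\<^bsub>BB\<^esub> x" unfolding e e' BB_mult by (simp add: mult.commute add.commute)
    fix z assume "z \<in> carrier BB"
    then obtain R k where e'': "R \<in> poly_invariants" "z = bet R k" by (auto simp: carrier_BB)
    show "x \<otimes>\<^bsub>BB\<^esub> y \<otimes>\<^bsub>BB\<^esub> z = x \<otimes>\<^bsub>BB\<^esub> (y \<otimes>\<^bsub>BB\<^esub> z)" unfolding e e' e'' BB_mult by (simp add: mult.assoc add.assoc)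
  qed
  fix x y z assume "x \<in> carrier BB" "y \<in> carrier BB" "z \<in> carrier BB"
  then obtain P n Q m R k where e: "P \<in> poly_invariants" "x = bet P n" "Q \<in> poly_invariants" "y = bet Q m"
    "R \<in> poly_invariants" "z = bet R k" by (auto simp: carrier_BB)
  show "(x \<oplus>\<^bsub>BB\<^esub> y) \<otimes>\<^bsub>BB\<^esub> z = x \<otimes>\<^bsub>BB\<^esub> z \<oplus>\<^bsub>BB\<^esub> y \<otimes>\<^bsub>BB\<^esub> z"
    unfolding e BB_add BB_mult bet_eq_iff by (simp add: algebra_simps power_add)
qed

lemma domain_BB: "domain BB"
proof (rule domain.intro[OF cring_BB], rule domain_axioms.intro)
  show "\<one>\<^bsub>BB\<^esub> \<noteq> \<zero>\<^bsub>BB\<^esub>" unfolding BB_one BB_zero bet_eq_iff by simp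
  fix a b assume ab: "a \<otimes>\<^bsub>BB\<^esub> b = \<zero>\<^bsub>BB\<^esub>" "a \<in> carrier BB" "b \<in> carrier BB"
  then obtain P n Q m where e: "a = bet P n" "b = bet Q m" by (auto simp: carrier_BB)
  have "P * Q = 0" using ab(1) unfolding e BB_mult BB_zero bet_eq_iff by simp
  then have "P = 0 \<or> Q = 0" by (rule real_poly_no_zero_divisors)
  then show "a = \<zero>\<^bsub>BB\<^esub> \<or> b = \<zero>\<^bsub>BB\<^esub>" unfolding e BB_zero bet_eq_iff by auto
qed

lemma const_section_bet: "const_section X0 r = bet (Const r) 0"
  by (simp add: const_section_def bet_def)

text \<open>For an invariant \<open>P\<close> some \<open>P * Discr ^ k\<close> lies in
  \<open>Inv_alg\<close>, so the generators of that algebra and the inverse \<open>bet 1 1\<close>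
  of \<open>Discr\<close> suffice.\<close>

lemma affine_real_variety_BB: "affine_real_variety BB (const_section X0)"
proof -
  interpret cring BB by (rule cring_BB)
  have "const_section X0 \<in> ring_hom (ring_of_type_algebra :: real ring) BB"
    by (rule ring_hom_memI)
      (simp_all add: const_section_bet bet_in_BB poly_invariants_closed BB_add BB_mult BB_one ring_of_type_algebra_def
        Const_add Const_mult)
  then have ra: "real_algebra BB (const_section X0)" by (simp add: real_algebra_def cring_BB)
  define S where "S = (\<lambda>P. bet P 0) ` {tp 1, tp 2, tp 3, pp 0, pp 1, pp 2, dp} \<union> {bet 1 1}"
  have S: "finite S" "S \<subseteq> carrier BB"
    unfolding S_def by (auto intro!: bet_in_BB poly_invariants_closed Inv_alg_poly_invariants Inv_alg.intros)
  let ?G = "generate_ring BB (S \<union> range (const_section X0))"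
  have sub: "S \<union> range (const_section X0) \<subseteq> carrier BB"
    using S(2) by (auto simp: const_section_bet bet_in_BB poly_invariants_closed)
  have alg: "bet P 0 \<in> ?G" if "P \<in> Inv_alg" for P
    using that
  proof induction
    case (const r)
    show ?case by (rule generate_ring.incl) (simp add: const_section_bet[symmetric])
  next
    case (tp n)
    then show ?case by (intro generate_ring.incl) (auto simp: S_def)
  next
    case (pp n)
    then show ?case by (intro generate_ring.incl) (auto simp: S_def)
  next
    case dp
    show ?case by (intro generate_ring.incl) (auto simp: S_def)
  next
    case (add P Q)
    show ?case using generate_ring.eng_add[OF add.IH] by (simp add: BB_add)
  next
    case (mult P Q)
    show ?case using generate_ring.eng_mult[OF mult.IH] by (simp add: BB_mult)
  qed
  have inv: "bet 1 n \<in> ?G" for n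
  proof (induction n)
    case 0
    show ?case using generate_ring.one[of BB] by (simp add: BB_one)
  next
    case (Suc n)
    have "bet 1 1 \<in> ?G" by (intro generate_ring.incl) (simp add: S_def)
    from generate_ring.eng_mult[OF this Suc] show ?case by (simp add: BB_mult)
  qed
  have "?G = carrier BB"
  proof (intro equalityI subsetI)
    show "b \<in> carrier BB" if "b \<in> ?G" for b using generate_ring_in_carrier[OF sub that] .
    fix b assume "b \<in> carrier BB"
    then obtain P n where b: "P \<in> poly_invariants" "b = bet P n" by (rule BB_E)
    obtain k where k: "P * Discr ^ k \<in> Inv_alg" using poly_invariants_power_Discr[OF b(1)] by (rule exE)
    have "b = bet (P * Discr ^ k) 0 \<otimes>\<^bsub>BB\<^esub> bet 1 (n + k)"
      unfolding b BB_mult bet_eq_iff by (simp add: power_add mult_ac)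
    then show "b \<in> ?G" using generate_ring.eng_mult[OF alg[OF k] inv] by simp
  qed
  then show ?thesis unfolding affine_real_variety_def using ra domain_BB S by blast
qed

section \<open>The quotient morphism on points\<close>

global_interpretation BBd: domain_ring BB
  by (rule domain_ring.intro[OF domain_BB])

abbreviation FF :: "real_poly set \<Rightarrow> real_poly local_section set"
  where "FF \<equiv> to_Spec RX BB (\<lambda>s. s)"

text \<open>Membership is read off the numerator because \<open>Discr\<close> lies outside
  \<open>p\<close>; thus the quotient map contracts \<open>p\<close> to the invariants.\<close>

lemma FF_bet:
  assumes p: "p \<in> X0" and P: "P \<in> poly_invariants"
  shows "bet P n \<in> FF p \<longleftrightarrow> P \<in> p"
  using RX.stalk_max_iff[OF X0_Spec[OF p], of P "Discr ^ n"] X0_Discr[OF p]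
  by (simp add: to_Spec_def bet_in_BB P bet_apply p)

lemma FF_sub: "FF p \<subseteq> carrier BB"
  by (auto simp: to_Spec_def)

lemma FF_E:
  assumes "p \<in> X0" "b \<in> FF p"
  obtains P n where "P \<in> poly_invariants" "b = bet P n" "P \<in> p"
proof -
  have "b \<in> carrier BB" using assms(2) FF_sub by blast
  then obtain P n where e: "P \<in> poly_invariants" "b = bet P n" by (rule BB_E)
  with assms have "P \<in> p" by (simp add: FF_bet)
  with e that show ?thesis by blast
qed

lemma FF_Spec:
  assumes p: "p \<in> X0"
  shows "FF p \<in> Spec BB"
proof -
  note S = Spec_RX[OF X0_Spec[OF p]]
  have mult: "a \<otimes>\<^bsub>BB\<^esub> x \<in> FF p" if a0: "a \<in> FF p" and x0: "x \<in> carrier BB" for a x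
  proof -
    obtain P n where a: "P \<in> poly_invariants" "a = bet P n" "P \<in> p" by (rule FF_E[OF p a0])
    obtain Q m where x: "Q \<in> poly_invariants" "x = bet Q m" by (rule BB_E[OF x0])
    show ?thesis using a x S(4) by (simp add: BB_mult FF_bet p poly_invariants_closed)
  qed
  have "primeideal (FF p) BB"
  proof (rule primeidealI2)
    show "additive_subgroup (FF p) BB"
    proof (rule additive_subgroupI, rule group.subgroupI)
      show "group (add_monoid BB)" by (rule BBd.a_group)
      show "FF p \<subseteq> carrier (add_monoid BB)" using FF_sub by simp
      show "FF p \<noteq> {}" using FF_bet[OF p poly_invariants_closed(8), of 0] S(1) by blast
      fix a assume "a \<in> FF p"
      then obtain P n where a: "P \<in> poly_invariants" "a = bet P n" "P \<in> p" by (rule FF_E[OF p])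
      have "\<ominus>\<^bsub>BB\<^esub> a = bet (- P) n" unfolding a(2)
        by (rule BBd.minus_equality[OF BB_uminus]) (simp_all add: a bet_in_BB poly_invariants_closed)
      then show "inv\<^bsub>add_monoid BB\<^esub> a \<in> FF p"
        using a S(4)[of P "- 1"] by (simp add: a_inv_def FF_bet p poly_invariants_closed)
      fix b assume "b \<in> FF p"
      then obtain Q m where b: "Q \<in> poly_invariants" "b = bet Q m" "Q \<in> p" by (rule FF_E[OF p])
      have "P * Discr ^ m + Q * Discr ^ n \<in> p" using a b by (intro S(3,4))
      then show "a \<otimes>\<^bsub>add_monoid BB\<^esub> b \<in> FF p"
        by (simp add: a b BB_add FF_bet p bet_add_closed)
    qed
    show "cring BB" by (rule cring_BB)
    show "a \<otimes>\<^bsub>BB\<^esub> x \<in> FF p" if "a \<in> FF p" "x \<in> carrier BB" for a x using that by (rule mult)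
    show "x \<otimes>\<^bsub>BB\<^esub> a \<in> FF p" if "a \<in> FF p" "x \<in> carrier BB" for a x
    proof -
      have "a \<in> carrier BB" using that FF_sub by blast
      then show ?thesis using mult[OF that] BBd.m_comm[of x a] that by simp
    qed
    show "carrier BB \<noteq> FF p"
      using bet_in_BB[OF poly_invariants_closed(7), of 0] FF_bet[OF p poly_invariants_closed(7), of 0] S(2) by blast
    fix a b assume a: "a \<in> carrier BB" and b: "b \<in> carrier BB" and ab: "a \<otimes>\<^bsub>BB\<^esub> b \<in> FF p"
    obtain P n where a: "P \<in> poly_invariants" "a = bet P n" by (rule BB_E[OF a])
    obtain Q m where b: "Q \<in> poly_invariants" "b = bet Q m" by (rule BB_E[OF b])
    have "P * Q \<in> p" using ab by (simp add: a b BB_mult FF_bet p poly_invariants_closed)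
    then show "a \<in> FF p \<or> b \<in> FF p" using S(5)[of P Q] by (simp add: a b FF_bet p)
  qed
  then show ?thesis by (simp add: Spec_def)
qed

text \<open>\<open>Discr\<close> is a unit, so a prime is known through the numerators
  \<open>bet P 0\<close> it contains; these rules confine later arguments to numerators.\<close>

lemma Spec_BB:
  assumes q: "q \<in> Spec BB"
  shows "bet 0 0 \<in> q" "bet 1 0 \<notin> q"
    "bet P 0 \<in> q \<Longrightarrow> bet Q 0 \<in> q \<Longrightarrow> bet (P + Q) 0 \<in> q"
    "P \<in> poly_invariants \<Longrightarrow> Q \<in> poly_invariants \<Longrightarrow> bet (P * Q) 0 \<in> q \<longleftrightarrow> bet P 0 \<in> q \<or> bet Q 0 \<in> q"
    "P \<in> poly_invariants \<Longrightarrow> bet P n \<in> q \<longleftrightarrow> bet P 0 \<in> q"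
    "P \<in> poly_invariants \<Longrightarrow> bet P 0 \<notin> q \<Longrightarrow> bet (P ^ n) 0 \<notin> q"
    "bet Discr 0 \<notin> q" "q \<subseteq> carrier BB"
proof -
  interpret p: primeideal q BB using q by (simp add: Spec_def)
  show "bet 0 0 \<in> q" using additive_subgroup.zero_closed[OF p.additive_subgroup_axioms] by (simp add: BB_zero)
  show one: "bet 1 0 \<notin> q" using p.one_notin by (simp add: BB_one)
  show "bet P 0 \<in> q \<Longrightarrow> bet Q 0 \<in> q \<Longrightarrow> bet (P + Q) 0 \<in> q"
    using additive_subgroup.a_closed[OF p.additive_subgroup_axioms, of "bet P 0" "bet Q 0"] by (simp add: BB_add)
  have r: "bet (P * Q) (n + m) \<in> q" if "bet P n \<in> q" "Q \<in> poly_invariants" for P Q n m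
    using p.I_r_closed[OF that(1) bet_in_BB[OF that(2), of m]] by (simp add: BB_mult)
  have prod: "bet (P * Q) 0 \<in> q \<longleftrightarrow> bet P 0 \<in> q \<or> bet Q 0 \<in> q"
    if "P \<in> poly_invariants" "Q \<in> poly_invariants" for P Q
    using r[of P 0 Q 0] r[of Q 0 P 0] p.I_prime[of "bet P 0" "bet Q 0"] that
    by (auto simp: BB_mult bet_in_BB mult.commute)
  then show "P \<in> poly_invariants \<Longrightarrow> Q \<in> poly_invariants \<Longrightarrow> bet (P * Q) 0 \<in> q \<longleftrightarrow> bet P 0 \<in> q \<or> bet Q 0 \<in> q" .
  show "bet P n \<in> q \<longleftrightarrow> bet P 0 \<in> q" if P: "P \<in> poly_invariants"
  proof
    assume "bet P n \<in> q"
    then have "bet (P * Discr ^ n) (n + 0) \<in> q" by (rule r) (intro poly_invariants_closed)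
    moreover have "bet (P * Discr ^ n) (n + 0) = bet P 0" by (simp add: bet_eq_iff)
    ultimately show "bet P 0 \<in> q" by simp
  next
    assume "bet P 0 \<in> q"
    then have "bet (P * 1) (0 + n) \<in> q" by (rule r) (intro poly_invariants_closed)
    then show "bet P n \<in> q" by simp
  qed
  show "bet (P ^ n) 0 \<notin> q" if "P \<in> poly_invariants" "bet P 0 \<notin> q"
    by (induction n) (use that one prod in \<open>simp_all add: poly_invariants_closed\<close>)
  show "bet Discr 0 \<notin> q"
  proof
    assume "bet Discr 0 \<in> q"
    then have "bet (Discr * 1) (0 + 1) \<in> q" by (rule r) (intro poly_invariants_closed)
    moreover have "bet (Discr * 1) (0 + 1) = bet 1 0" by (simp add: bet_eq_iff)
    ultimately show False using one by simp
  qed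
  show "q \<subseteq> carrier BB" using additive_subgroup.a_subset[OF p.additive_subgroup_axioms] .
qed

lemma FF_eqI:
  assumes q: "q \<in> Spec BB" and p: "p \<in> X0"
    and eq: "\<And>P. P \<in> poly_invariants \<Longrightarrow> P \<in> p \<longleftrightarrow> bet P 0 \<in> q"
  shows "FF p = q"
proof -
  have "b \<in> FF p \<longleftrightarrow> b \<in> q" if b: "b \<in> carrier BB" for b
  proof -
    obtain P n where b: "P \<in> poly_invariants" "b = bet P n" by (rule BB_E[OF b])
    then show ?thesis using Spec_BB(5)[OF q b(1), of n] eq[OF b(1)] by (simp add: FF_bet p)
  qed
  then show ?thesis using FF_sub[of p] Spec_BB(8)[OF q] by blast
qed

lemma gen_ideal_mult:
  assumes "P \<in> gen_ideal q" shows "P * a \<in> gen_ideal q"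
  using assms by induction (auto simp: distrib_right mult.assoc intro: gen_ideal.intros)

lemma ideal_gen_ideal: "ideal (gen_ideal q) RX"
proof (rule idealI)
  show "ring RX" by (rule RX.ring_axioms)
  show "subgroup (gen_ideal q) (add_monoid RX)"
  proof (rule group.subgroupI)
    show "group (add_monoid RX)" by (rule RX.a_group)
    show "gen_ideal q \<subseteq> carrier (add_monoid RX)" by simp
    show "gen_ideal q \<noteq> {}" using gen_ideal.zero by blast
    fix a assume a: "a \<in> gen_ideal q"
    have "\<ominus>\<^bsub>RX\<^esub> a = - a" by (rule RX.minus_equality) simp_all
    then show "inv\<^bsub>add_monoid RX\<^esub> a \<in> gen_ideal q"
      using gen_ideal_mult[OF a, of "- 1"] unfolding a_inv_def by simp
    fix b assume "b \<in> gen_ideal q"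
    then show "a \<otimes>\<^bsub>add_monoid RX\<^esub> b \<in> gen_ideal q" using gen_ideal.add[OF a] by simp
  qed
  fix a x assume a: "a \<in> gen_ideal q"
  show "x \<otimes>\<^bsub>RX\<^esub> a \<in> gen_ideal q" "a \<otimes>\<^bsub>RX\<^esub> x \<in> gen_ideal q"
    using gen_ideal_mult[OF a, of x] by (simp_all add: mult.commute)
qed

text \<open>Prime avoidance for the extension of \<open>q\<close>. Were it to contain
  \<open>s * h ^ n\<close> with \<open>s\<close> outside \<open>q\<close>, then
  \<open>descend_to_invariants\<close> would put \<open>s\<close> times powers of \<open>b\<close>
  and \<open>Discr\<close> into \<open>q\<close>, although none of the three factors lies in
  \<open>q\<close>.\<close>

lemma lift_prime:
  assumes q: "q \<in> Spec BB" and b: "b \<in> Inv_alg" "bet b 0 \<notin> q" and g: "rotation_matrix g" "k \<ge> 1"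
    and e: "\<And>y. y \<in> YR \<Longrightarrow> esym h g k (slp y) * ev (spt y) Discr ^ m = ev (spt y) b"
  shows "\<exists>p\<in>X0. FF p = q \<and> h \<notin> p"
proof -
  note S = Spec_BB[OF q]
  define q' where "q' = {P \<in> poly_invariants. bet P 0 \<in> q}"
  \<comment> \<open>Avoiding the factors \<open>s\<close> makes the contraction no larger than
    \<open>q\<close>; avoiding the powers of \<open>h\<close> keeps the lift in the basic open set
    of \<open>h\<close>.\<close>
  define M where "M = {s * h ^ n | s n. s \<in> poly_invariants \<and> s \<notin> q'}"
  have MI: "s * h ^ n \<in> M" if "s \<in> poly_invariants" "bet s 0 \<notin> q" for s n
    unfolding M_def using that by (intro CollectI exI[of _ s] exI[of _ n] conjI) (simp_all add: q'_def)
  have b': "b \<in> poly_invariants" by (rule Inv_alg_poly_invariants[OF b(1)])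
  have "\<exists>p. primeideal p RX \<and> gen_ideal q' \<subseteq> p \<and> p \<inter> M = {}"
  proof (rule RX.prime_avoidance[OF ideal_gen_ideal])
    show "M \<subseteq> carrier RX" by simp
    show "\<one>\<^bsub>RX\<^esub> \<in> M" using MI[OF poly_invariants_closed(7) S(2), of 0] by simp
    show "u \<otimes>\<^bsub>RX\<^esub> v \<in> M" if u: "u \<in> M" and v: "v \<in> M" for u v
    proof -
      obtain s n where s: "u = s * h ^ n" "s \<in> poly_invariants" "s \<notin> q'" using u unfolding M_def by (elim CollectE exE conjE) (rule that)
      obtain t l where t: "v = t * h ^ l" "t \<in> poly_invariants" "t \<notin> q'" using v unfolding M_def by (elim CollectE exE conjE) (rule that)
      have "s * t * h ^ (n + l) \<in> M"
        by (rule MI) (use s(2,3) t(2,3) S(4)[OF s(2) t(2)] in \<open>simp_all add: q'_def poly_invariants_closed\<close>)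
      moreover have "u \<otimes>\<^bsub>RX\<^esub> v = s * t * h ^ (n + l)" unfolding s(1) t(1) by (simp add: power_add mult_ac)
      ultimately show ?thesis by simp
    qed
    show "gen_ideal q' \<inter> M = {}"
    proof (rule ccontr)
      assume "gen_ideal q' \<inter> M \<noteq> {}"
      then obtain s n where s: "s \<in> poly_invariants" "s \<notin> q'" "s * h ^ n \<in> gen_ideal q'"
        unfolding M_def by blast
      have "\<exists>N M. s * b ^ N * Discr ^ M \<in> q'"
      proof (rule descend_to_invariants[OF _ _ _ _ _ s(3) g e])
        show "0 \<in> q'" using S(1) by (simp add: q'_def poly_invariants_closed)
        show "P + Q \<in> q'" if "P \<in> q'" "Q \<in> q'" for P Q
          using that S(3) by (simp add: q'_def poly_invariants_closed)
        show "P * Q \<in> q'" if "P \<in> q'" "Q \<in> Inv_alg" for P Q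
          using that Inv_alg_poly_invariants[OF that(2)] S(4)[of P Q] by (simp add: q'_def poly_invariants_closed)
        show "real_invariant Q" if "Q \<in> q'" for Q using that by (simp add: q'_def poly_invariants_real)
        show "real_invariant s" by (rule poly_invariants_real[OF s(1)])
      qed
      then obtain N K where "bet (s * b ^ N * Discr ^ K) 0 \<in> q" by (auto simp: q'_def)
      moreover have "s * b ^ N \<in> poly_invariants" "b ^ N \<in> poly_invariants" "Discr ^ K \<in> poly_invariants"
        by (intro poly_invariants_closed s b')+
      moreover have "bet s 0 \<notin> q" using s(1,2) by (simp add: q'_def)
      ultimately show False
        using S(4)[of "s * b ^ N" "Discr ^ K"] S(4)[OF s(1), of "b ^ N"] S(6)[OF b' b(2), of N]
          S(6)[OF poly_invariants_closed(4) S(7), of K] by blast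
    qed
  qed
  then obtain p where p: "primeideal p RX" "gen_ideal q' \<subseteq> p" "p \<inter> M = {}" by blast
  have notin: "s \<notin> p" if "s \<in> poly_invariants" "bet s 0 \<notin> q" for s
    using MI[OF that, of 0] p(3) by auto
  have pX: "p \<in> X0" using p(1) notin[OF poly_invariants_closed(4) S(7)] by (simp add: X0_def Spec_def)
  have "h \<notin> p" using MI[OF poly_invariants_closed(7) S(2), of 1] p(3) by auto
  moreover have "FF p = q"
  proof (rule FF_eqI[OF q pX])
    fix P assume P: "P \<in> poly_invariants"
    have "P \<in> p" if "bet P 0 \<in> q"
      using p(2) gen_ideal.gen[of P q' 1] that P by (auto simp: q'_def)
    then show "P \<in> p \<longleftrightarrow> bet P 0 \<in> q" using notin[OF P] by blast
  qed
  ultimately show ?thesis using pX by blast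
qed

text \<open>The case \<open>h = 1\<close>, \<open>k = 1\<close> of \<open>lift_prime\<close>: the
  first elementary symmetric function is the number of one-element subsets of \<open>Wset\<close>, a
  nonzero constant and hence outside every prime.\<close>

lemma FF_surj:
  assumes q: "q \<in> Spec BB"
  shows "\<exists>p\<in>X0. FF p = q"
proof -
  note S = Spec_BB[OF q]
  define c where "c = real (card {A. A \<subseteq> Wset \<and> card A = 1})"
  have "{mat 1} \<in> {A. A \<subseteq> Wset \<and> card A = 1}" using mat1_Wset by simp
  then have c: "c \<noteq> 0" using finite_subsets_Wset[of 1] unfolding c_def by (simp only: of_nat_eq_0_iff card_eq_0_iff) blast
  have "Const c * Const (1 / c) = 1" using c by (simp flip: Const_mult)
  then have cq: "bet (Const c) 0 \<notin> q" using S(2) S(4)[of "Const c" "Const (1 / c)"] by (simp add: poly_invariants_closed)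
  have "\<exists>p\<in>X0. FF p = q \<and> 1 \<notin> p"
  proof (rule lift_prime[OF q Inv_alg.const cq, of "mat 1" 1 1 0])
    show "rotation_matrix (mat 1 :: real^3^3)" by (simp add: rotation_matrix_def orthogonal_matrix_id)
    fix y
    show "esym 1 (mat 1) 1 (slp y) * ev (spt y) Discr ^ 0 = ev (spt y) (Const c)"
      by (simp add: esym_def xval_def c_def)
  qed simp
  then show ?thesis by blast
qed

text \<open>For \<open>p\<close> in a basic open set of \<open>f\<close> inside \<open>U\<close>,
  \<open>exists_invariant_notin\<close> supplies an invariant \<open>b\<close> outside
  \<open>p\<close>. Every prime of the invariants avoiding \<open>b\<close> lifts by
  \<open>lift_prime\<close> to one avoiding \<open>f\<close>, hence into \<open>U\<close>.\<close>

lemma open_map_FF: "open_map (subtopology (zariski RX) X0) (zariski BB) FF"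
  unfolding open_map_def
proof (intro allI impI)
  fix U assume "openin (subtopology (zariski RX) X0) U"
  then have U: "openin (zariski RX) U" "U \<subseteq> X0" using openin_X0 by (simp_all add: openin_open_subtopology)
  \<comment> \<open>Collects the basic open sets contained in the image, so that openness means that
    they cover it.\<close>
  define I where "I = {bet b 0 | b. b \<in> poly_invariants \<and> (\<forall>q\<in>Spec BB. bet b 0 \<notin> q \<longrightarrow> q \<in> FF ` U)}"
  have "FF ` U = {q \<in> Spec BB. \<not> I \<subseteq> q}"
  proof (intro equalityI subsetI)
    fix q assume "q \<in> FF ` U"
    then obtain p where p: "p \<in> U" "q = FF p" by blast
    then have pX: "p \<in> X0" using U by blast
    obtain f where f: "f \<notin> p" "{r \<in> Spec RX. f \<notin> r} \<subseteq> U"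
      using RX.open_basic_subset[OF U(1) p(1)] by (elim bexE conjE) (rule that)
    have "primeideal p RX" "Discr \<notin> p" using pX by (simp_all add: X0_def Spec_def)
    from exists_invariant_notin[OF this(1) f(1) this(2)]
    obtain g k b n where b: "rotation_matrix g" "k \<ge> 1" "b \<in> Inv_alg" "b \<notin> p"
      "\<And>y. y \<in> YR \<Longrightarrow> esym f g k (slp y) * ev (spt y) Discr ^ n = ev (spt y) b"
      by (elim exE conjE) (rule that, assumption, assumption, assumption, assumption, erule (1) bspec)
    have b': "b \<in> poly_invariants" by (rule Inv_alg_poly_invariants[OF b(3)])
    have "q' \<in> FF ` U" if q': "q' \<in> Spec BB" "bet b 0 \<notin> q'" for q'
    proof -
      have "\<exists>p\<in>X0. FF p = q' \<and> f \<notin> p"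
        by (rule lift_prime[OF q'(1) b(3) q'(2) b(1,2)]) (erule b(5))
      then obtain p' where p': "p' \<in> X0" "FF p' = q'" "f \<notin> p'" by (elim bexE conjE) (rule that)
      then have "p' \<in> {r \<in> Spec RX. f \<notin> r}" using X0_Spec[OF p'(1)] by simp
      then have "p' \<in> U" by (rule subsetD[OF f(2)])
      then show ?thesis unfolding p'(2)[symmetric] by (rule imageI)
    qed
    then have "bet b 0 \<in> I"
      unfolding I_def by (intro CollectI exI[of _ b] conjI refl b' ballI impI)
    moreover have "bet b 0 \<notin> FF p" using b(4) by (simp add: FF_bet pX b')
    ultimately show "q \<in> {q \<in> Spec BB. \<not> I \<subseteq> q}" unfolding p(2) using FF_Spec[OF pX] by blast
  next
    fix q assume "q \<in> {q \<in> Spec BB. \<not> I \<subseteq> q}"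
    then obtain x where x: "q \<in> Spec BB" "x \<in> I" "x \<notin> q" by blast
    obtain b where b: "x = bet b 0" "\<forall>q\<in>Spec BB. bet b 0 \<notin> q \<longrightarrow> q \<in> FF ` U"
      using x(2) unfolding I_def by (elim CollectE exE conjE) (rule that)
    show "q \<in> FF ` U" by (rule bspec[OF b(2) x(1), rule_format, OF x(3)[unfolded b(1)]])
  qed
  note image = this
  have sub: "I \<subseteq> carrier BB"
  proof
    fix x assume "x \<in> I"
    then obtain b where "x = bet b 0" "b \<in> poly_invariants"
      unfolding I_def by (elim CollectE exE conjE) (rule that)
    then show "x \<in> carrier BB" by (simp add: bet_in_BB)
  qed
  show "openin (zariski BB) (FF ` U)"
    unfolding openin_zariski zariski_open_def by (intro exI[of _ I] conjI sub image)
qed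

text \<open>The zero ideal lies in \<open>X0\<close>, as \<open>Discr\<close> is nonzero, and in
  every nonempty open set.\<close>

lemma closure_X0: "zariski RX closure_of X0 = Spec RX"
proof -
  have top: "topspace (zariski RX) = Spec RX"
  proof (rule equalityI)
    show "topspace (zariski RX) \<subseteq> Spec RX" by (rule RX.open_subset_Spec[OF openin_topspace])
    have "{p \<in> Spec RX. 1 \<notin> p} = Spec RX" using Spec_RX(2) by blast
    then have "openin (zariski RX) (Spec RX)" using RX.openin_basic[of 1] by simp
    then show "Spec RX \<subseteq> topspace (zariski RX)" by (rule openin_subset)
  qed
  have "{0} \<in> T" if "p \<in> T" "openin (zariski RX) T" for p T
    using RX.zero_in_open[OF that(2,1)] by simp
  then have dense: "p \<in> zariski RX closure_of X0" if "p \<in> Spec RX" for p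
    unfolding in_closure_of top using that zero_in_X0 by (intro conjI allI impI) (assumption, erule conjE, rule exI[of _ "{0}"], simp)
  show ?thesis
  proof (rule equalityI)
    show "zariski RX closure_of X0 \<subseteq> Spec RX"
      using closure_of_subset_topspace[of "zariski RX" X0] unfolding top .
    show "Spec RX \<subseteq> zariski RX closure_of X0" by (rule subsetI) (rule dense)
  qed
qed

section \<open>The bijection between orbits and complex points of the quotient\<close>

lemma orbit_X0:
  assumes x: "x \<in> points_of X0"
  shows "orbit x = {z \<in> points_of X0. \<forall>P\<in>Inv_alg. ev z P = ev x P}"
proof (intro equalityI subsetI)
  fix z assume "z \<in> orbit x"
  then obtain g where g: "rotation_matrix g" "z = ract g x" by (auto simp: orbit_def SO3_iff act_ract)
  have "x \<in> X_points" using x by (simp add: points_of_X0_iff)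
  then have "ev (ract g x) P = ev x P" if "P \<in> Inv_alg" for P
    using poly_invariantsD[OF Inv_alg_poly_invariants[OF that] g(1)] by simp
  then show "z \<in> {z \<in> points_of X0. \<forall>P\<in>Inv_alg. ev z P = ev x P}"
    unfolding g(2) using ract_points_X0[OF g(1) x] by simp
next
  fix z assume "z \<in> {z \<in> points_of X0. \<forall>P\<in>Inv_alg. ev z P = ev x P}"
  then have z: "z \<in> points_of X0" "\<And>P. P \<in> Inv_alg \<Longrightarrow> ev x P = ev z P" by simp_all
  obtain g where "rotation_matrix g" "z = ract g x" using orbit_separation[OF x z] by blast
  then show "z \<in> orbit x" by (auto simp: orbit_def SO3_iff act_ract)
qed

abbreviation qp :: "point \<Rightarrow> real_poly local_section \<Rightarrow> complex"
  where "qp \<equiv> quotient_point BB (\<lambda>s. s)"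

lemma qp_bet: "x \<in> points_of X0 \<Longrightarrow> P \<in> poly_invariants \<Longrightarrow> qp x (bet P n) = ev x P / ev x Discr ^ n"
  by (simp add: quotient_point_def bet_in_BB section_value_bet)

lemma qp_act: "g \<in> SO3 \<Longrightarrow> x \<in> points_of X0 \<Longrightarrow> qp (act g x) = qp x"
  unfolding quotient_point_def by (rule restrict_ext) (simp add: invariant_ring_def)

lemma qp_complex_points:
  assumes x: "x \<in> points_of X0"
  shows "qp x \<in> complex_points BB (const_section X0)"
proof -
  have D: "ev x Discr \<noteq> 0" using x by (simp add: points_of_X0_iff)
  have frac_add: "(u * d ^ m + w * d ^ n) / d ^ (n + m) = u / d ^ n + w / d ^ m" if "d \<noteq> 0" for u w d :: complex and n m
    using that by (simp add: add_divide_distrib power_add)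
  have "qp x \<in> ring_hom BB (ring_of_type_algebra :: complex ring)"
  proof (rule ring_hom_memI)
    show "qp x a \<in> carrier (ring_of_type_algebra :: complex ring)" for a by (simp add: ring_of_type_algebra_def)
    show "qp x \<one>\<^bsub>BB\<^esub> = \<one>\<^bsub>ring_of_type_algebra :: complex ring\<^esub>"
      by (simp add: BB_one qp_bet x poly_invariants_closed ring_of_type_algebra_def)
    fix a b assume a: "a \<in> carrier BB" and b: "b \<in> carrier BB"
    obtain P n where a: "P \<in> poly_invariants" "a = bet P n" by (rule BB_E[OF a])
    obtain Q m where b: "Q \<in> poly_invariants" "b = bet Q m" by (rule BB_E[OF b])
    show "qp x (a \<otimes>\<^bsub>BB\<^esub> b) = qp x a \<otimes>\<^bsub>ring_of_type_algebra :: complex ring\<^esub> qp x b"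
      by (simp add: a b BB_mult qp_bet x poly_invariants_closed ring_of_type_algebra_def power_add)
    show "qp x (a \<oplus>\<^bsub>BB\<^esub> b) = qp x a \<oplus>\<^bsub>ring_of_type_algebra :: complex ring\<^esub> qp x b"
      using frac_add[OF D, of "ev x P" m "ev x Q" n]
      by (simp only: a b BB_add qp_bet[OF x] bet_add_closed ring_of_type_algebra_def ring.simps evl_add evl_mult evl_power)
  qed
  moreover have "qp x \<in> extensional (carrier BB)" by (simp add: quotient_point_def)
  moreover have "qp x (const_section X0 r) = complex_of_real r" for r
    by (simp add: const_section_bet qp_bet x poly_invariants_closed)
  ultimately show ?thesis unfolding complex_points_def by (intro CollectI conjI IntI allI)
qed

lemma complex_points_qp:
  assumes "\<psi> \<in> complex_points BB (const_section X0)"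
  shows "\<exists>x\<in>points_of X0. qp x = \<psi>"
proof -
  have h: "\<psi> \<in> ring_hom BB (ring_of_type_algebra :: complex ring)" and ex: "\<psi> \<in> extensional (carrier BB)"
    and c: "\<And>r. \<psi> (bet (Const r) 0) = complex_of_real r"
    using assms by (simp_all add: complex_points_def const_section_bet)
  have m: "\<psi> (bet (P * Q) (n + k)) = \<psi> (bet P n) * \<psi> (bet Q k)"
    if "P \<in> poly_invariants" "Q \<in> poly_invariants" for P Q n k
    using ring_hom_mult[OF h bet_in_BB[OF that(1), of n] bet_in_BB[OF that(2), of k]]
    by (simp add: BB_mult ring_of_type_algebra_def)
  have a: "\<psi> (bet (P + Q) 0) = \<psi> (bet P 0) + \<psi> (bet Q 0)"
    if "P \<in> poly_invariants" "Q \<in> poly_invariants" for P Q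
    using ring_hom_add[OF h bet_in_BB[OF that(1), of 0] bet_in_BB[OF that(2), of 0]]
    by (simp add: BB_add ring_of_type_algebra_def)
  have "bet (Discr * 1) (0 + 1) = \<one>\<^bsub>BB\<^esub>" by (simp add: BB_one bet_eq_iff)
  then have "\<psi> (bet Discr 0) * \<psi> (bet 1 1) = 1"
    using ring_hom_one[OF h] m[OF poly_invariants_closed(4,7), of 0 1] by (simp add: ring_of_type_algebra_def)
  then have D: "\<psi> (bet Discr 0) \<noteq> 0" by auto
  have m0: "\<psi> (bet (P * Q) 0) = \<psi> (bet P 0) * \<psi> (bet Q 0)"
    if "P \<in> poly_invariants" "Q \<in> poly_invariants" for P Q
    using m[OF that, of 0 0] by (simp only: add_0)
  have "\<exists>x\<in>points_of X0. \<forall>P\<in>poly_invariants. ev x P = \<psi> (bet P 0)"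
    by (rule points_exist) (fact c, erule (1) a, erule (1) m0, rule D)
  then obtain x where x: "x \<in> points_of X0" "\<And>P. P \<in> poly_invariants \<Longrightarrow> ev x P = \<psi> (bet P 0)"
    by (elim bexE) (rule that, assumption, erule (1) bspec)
  have "qp x = \<psi>"
  proof (rule extensionalityI[OF _ ex])
    show "qp x \<in> extensional (carrier BB)" by (simp add: quotient_point_def)
    fix b assume "b \<in> carrier BB"
    then obtain P n where b: "P \<in> poly_invariants" "b = bet P n" by (rule BB_E)
    have Dn: "Discr ^ n \<in> poly_invariants" by (intro poly_invariants_closed)
    have "bet (P * Discr ^ n) (n + 0) = bet P 0" by (simp add: bet_eq_iff)
    then have "\<psi> (bet P 0) = \<psi> (bet P n) * \<psi> (bet (Discr ^ n) 0)" using m[OF b(1) Dn, of n 0] by simp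
    moreover have "\<psi> (bet (Discr ^ n) 0) = ev x Discr ^ n" using x(2)[OF Dn] by simp
    moreover have "ev x Discr \<noteq> 0" using x(1) by (simp add: points_of_X0_iff)
    ultimately show "qp x b = \<psi> b"
      unfolding b(2) qp_bet[OF x(1) b(1)] x(2)[OF b(1)] by (simp only: nonzero_mult_div_cancel_right power_not_zero not_False_eq_True)
  qed
  then show ?thesis using x(1) by blast
qed

lemma bij_orbits: "bij_betw (\<lambda>S. the_elem (qp ` S)) (orbit ` points_of X0) (complex_points BB (const_section X0))"
proof -
  have el: "the_elem (qp ` orbit x) = qp x" if x: "x \<in> points_of X0" for x
  proof -
    have "x \<in> orbit x" using x by (simp add: orbit_X0)
    then have i1: "qp x \<in> qp ` orbit x" by (rule imageI)
    have i2: "qp ` orbit x \<subseteq> {qp x}"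
      unfolding orbit_def image_image by (rule image_subsetI) (simp only: qp_act[OF _ x] singleton_iff)
    have "qp ` orbit x = {qp x}"
      by (rule equalityI[OF i2]) (simp only: insert_subset i1 empty_subsetI simp_thms)
    then show ?thesis by (simp only: the_elem_eq)
  qed
  have inj: "orbit x = orbit y" if x: "x \<in> points_of X0" and y: "y \<in> points_of X0" and eq: "qp x = qp y" for x y
  proof -
    have e: "ev x P = ev y P" if "P \<in> Inv_alg" for P
      using qp_bet[OF x Inv_alg_poly_invariants[OF that], of 0] qp_bet[OF y Inv_alg_poly_invariants[OF that], of 0] eq by simp
    show ?thesis unfolding orbit_X0[OF x] orbit_X0[OF y]
      by (intro Collect_cong conj_cong refl ball_cong) (simp only: e)
  qed
  show ?thesis
  proof (rule bij_betw_imageI)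
    show "inj_on (\<lambda>S. the_elem (qp ` S)) (orbit ` points_of X0)"
    proof (rule inj_onI)
      fix S T assume S: "S \<in> orbit ` points_of X0" and T: "T \<in> orbit ` points_of X0"
        and eq: "the_elem (qp ` S) = the_elem (qp ` T)"
      obtain x where x: "S = orbit x" "x \<in> points_of X0" using S by (elim imageE) (rule that)
      obtain y where y: "T = orbit y" "y \<in> points_of X0" using T by (elim imageE) (rule that)
      have "qp x = qp y" using eq unfolding x(1) y(1) el[OF x(2)] el[OF y(2)] .
      then show "S = T" unfolding x(1) y(1) by (rule inj[OF x(2) y(2)])
    qed
    show "(\<lambda>S. the_elem (qp ` S)) ` orbit ` points_of X0 = complex_points BB (const_section X0)"
    proof (intro equalityI subsetI)
      fix \<psi> assume "\<psi> \<in> (\<lambda>S. the_elem (qp ` S)) ` orbit ` points_of X0"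
      then obtain S where S: "\<psi> = the_elem (qp ` S)" "S \<in> orbit ` points_of X0" by (rule imageE) (rule that)
      obtain x where x: "S = orbit x" "x \<in> points_of X0" using S(2) by (elim imageE) (rule that)
      show "\<psi> \<in> complex_points BB (const_section X0)"
        unfolding S(1) x(1) el[OF x(2)] by (rule qp_complex_points[OF x(2)])
    next
      fix \<psi> assume "\<psi> \<in> complex_points BB (const_section X0)"
      from complex_points_qp[OF this] obtain x where x: "x \<in> points_of X0" "qp x = \<psi>" by (elim bexE) (rule that)
      have "\<psi> = the_elem (qp ` orbit x)" unfolding el[OF x(1)] by (rule x(2)[symmetric])
      then show "\<psi> \<in> (\<lambda>S. the_elem (qp ` S)) ` orbit ` points_of X0"
        by (rule image_eqI[OF _ imageI[OF x(1)]])
    qed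
  qed
qed

section \<open>Pulling back sections\<close>

abbreviation WW :: "real_poly local_section set set \<Rightarrow> real_poly set set"
  where "WW \<equiv> to_Spec_vimage RX BB X0 (\<lambda>s. s)"

abbreviation PB :: "real_poly local_section set set \<Rightarrow> real_poly local_section local_section \<Rightarrow> real_poly local_section"
  where "PB \<equiv> pullback RX BB X0 (\<lambda>s. s)"

lemma WW_iff: "p \<in> WW V \<longleftrightarrow> p \<in> X0 \<and> FF p \<in> V"
  by (simp add: to_Spec_vimage_def)

lemma frac_BB_iff:
  assumes "q \<in> Spec BB" "P \<in> poly_invariants" "Q \<in> poly_invariants" "bet Q 0 \<notin> q"
    "P' \<in> poly_invariants" "Q' \<in> poly_invariants" "bet Q' 0 \<notin> q"
  shows "frac BB q (bet P 0) (bet Q 0) = frac BB q (bet P' 0) (bet Q' 0) \<longleftrightarrow> P * Q' = P' * Q"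
  using BBd.frac_eq_iff[OF assms(1), of "bet P 0" "bet Q 0" "bet P' 0" "bet Q' 0"] assms
  by (simp add: bet_in_BB BB_mult bet_eq_iff)

text \<open>Powers of \<open>Discr\<close> are cleared once, with the same \<open>P\<close> and
  \<open>Q\<close> for all primes, so that a local representation on an open set stays a single
  fraction.\<close>

lemma frac_BB_clear:
  assumes q: "q \<in> Spec BB" and a: "a \<in> carrier BB" and f: "f \<in> carrier BB"
  shows "\<exists>P\<in>poly_invariants. \<exists>Q\<in>poly_invariants. \<forall>q\<in>Spec BB. f \<notin> q \<longrightarrow>
    bet Q 0 \<notin> q \<and> frac BB q a f = frac BB q (bet P 0) (bet Q 0)"
proof -
  obtain P n where a': "P \<in> poly_invariants" "a = bet P n" by (rule BB_E[OF a])
  obtain Q m where f': "Q \<in> poly_invariants" "f = bet Q m" by (rule BB_E[OF f])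
  have D: "Discr ^ k \<in> poly_invariants" for k by (intro poly_invariants_closed)
  have PD: "P * Discr ^ m \<in> poly_invariants" and QD: "Q * Discr ^ n \<in> poly_invariants"
    by (intro poly_invariants_closed a' f')+
  have "bet (Q * Discr ^ n) 0 \<notin> r \<and> frac BB r a f = frac BB r (bet (P * Discr ^ m) 0) (bet (Q * Discr ^ n) 0)"
    if r: "r \<in> Spec BB" "f \<notin> r" for r
  proof -
    note S = Spec_BB[OF r(1)]
    have "bet Q 0 \<notin> r" using r(2) S(5)[OF f'(1), of m] unfolding f' by simp
    then have *: "bet (Q * Discr ^ n) 0 \<notin> r"
      using S(4)[OF f'(1) D[of n]] S(6)[OF poly_invariants_closed(4) S(7), of n] by simp
    have "a \<otimes>\<^bsub>BB\<^esub> bet (Q * Discr ^ n) 0 = bet (P * Discr ^ m) 0 \<otimes>\<^bsub>BB\<^esub> f"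
      unfolding a' f' BB_mult bet_eq_iff by (simp add: mult_ac)
    with * show ?thesis
      using BBd.frac_eq_iff[OF r(1) a, of f "bet (P * Discr ^ m) 0" "bet (Q * Discr ^ n) 0"] f r(2)
      by (simp add: bet_in_BB PD QD)
  qed
  with PD QD show ?thesis by blast
qed

lemma stalk_BB_E:
  assumes "q \<in> Spec BB" "x \<in> carrier (stalk BB q)"
  obtains P Q where "P \<in> poly_invariants" "Q \<in> poly_invariants" "bet Q 0 \<notin> q" "x = frac BB q (bet P 0) (bet Q 0)"
proof -
  obtain a f where af: "a \<in> carrier BB" "f \<in> carrier BB - q" "x = frac BB q a f"
    by (rule BBd.stalk_elem[OF assms(2)])
  then have f: "f \<in> carrier BB" "f \<notin> q" by simp_all
  obtain P Q where "P \<in> poly_invariants" "Q \<in> poly_invariants"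
    "\<forall>q\<in>Spec BB. f \<notin> q \<longrightarrow> bet Q 0 \<notin> q \<and> frac BB q a f = frac BB q (bet P 0) (bet Q 0)"
    using frac_BB_clear[OF assms(1) af(1) f(1)] by (elim bexE)
  then show ?thesis using assms(1) f(2) af(3) that[of P Q] by simp
qed

text \<open>Whatever representative of the germ is chosen, the powers of \<open>Discr\<close> cancel
  and \<open>P / Q\<close> remains. Hence pulling back means reading a fraction of invariants as a
  fraction of polynomials.\<close>

lemma PB_apply:
  assumes p: "p \<in> X0" "FF p \<in> V" and P: "P \<in> poly_invariants" and Q: "Q \<in> poly_invariants" "Q \<notin> p"
    and t: "t (FF p) = frac BB (FF p) (bet P 0) (bet Q 0)"
  shows "PB V t p = frac RX p P Q"
proof -
  note Sp = X0_Spec[OF p(1)] and D = X0_Discr[OF p(1)]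
  have Qc: "bet Q 0 \<in> carrier BB - FF p" using Q by (simp add: bet_in_BB FF_bet p)
  have "(\<Union>(b, c)\<in>frac BB (FF p) (bet P 0) (bet Q 0). b p \<otimes>\<^bsub>stalk RX p\<^esub> inv\<^bsub>stalk RX p\<^esub> c p) = frac RX p P Q"
  proof (rule BBd.UN_frac_const[OF FF_Spec[OF p(1)] bet_in_BB[OF P] Qc])
    fix b c assume b: "b \<in> carrier BB" and c: "c \<in> carrier BB - FF p"
      and e: "bet P 0 \<otimes>\<^bsub>BB\<^esub> c = b \<otimes>\<^bsub>BB\<^esub> bet Q 0"
    obtain P' n where b': "P' \<in> poly_invariants" "b = bet P' n" by (rule BB_E[OF b])
    have "c \<in> carrier BB" using c by simp
    then obtain Q' m where c': "Q' \<in> poly_invariants" "c = bet Q' m" by (rule BB_E)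
    have Q': "Q' \<notin> p" using c unfolding c' by (simp add: FF_bet p c')
    have eq: "P * Q' * Discr ^ n = P' * Q * Discr ^ m" using e unfolding b' c' BB_mult bet_eq_iff by simp
    have "b p \<otimes>\<^bsub>stalk RX p\<^esub> inv\<^bsub>stalk RX p\<^esub> c p = frac RX p (P' * Discr ^ m) (Discr ^ n * Q')"
      using RX.stalk_inv[OF Sp, of Q' "Discr ^ m"] RX.stalk_mult[OF Sp, of P' "Discr ^ n" "Discr ^ m" Q'] D Q'
      by (simp add: b' c' bet_apply p)
    also have "\<dots> = frac RX p P Q"
    proof (subst frac_RX_iff[OF Sp])
      show "Discr ^ n * Q' \<notin> p" using Spec_RX(5)[OF Sp] D Q' by blast
      show "Q \<notin> p" by (rule Q(2))
      show "P' * Discr ^ m * Q = P * (Discr ^ n * Q')" using eq by (simp only: mult_ac)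
    qed
    finally show "b p \<otimes>\<^bsub>stalk RX p\<^esub> inv\<^bsub>stalk RX p\<^esub> c p = frac RX p P Q" .
  qed
  then show ?thesis using p by (simp add: pullback_def WW_iff t)
qed

lemma PB_ext: "p \<notin> WW V \<Longrightarrow> PB V t p = undefined"
  by (simp add: pullback_def)

lemma FF_basic:
  assumes V: "openin (zariski BB) V" and q: "q \<in> V"
  shows "\<exists>P\<in>poly_invariants. bet P 0 \<notin> q \<and> (\<forall>r\<in>Spec BB. bet P 0 \<notin> r \<longrightarrow> r \<in> V)"
proof -
  have S: "V \<subseteq> Spec BB" by (rule BBd.open_subset_Spec[OF V])
  obtain f where f: "f \<in> carrier BB" "f \<notin> q" "{r \<in> Spec BB. f \<notin> r} \<subseteq> V"
    using BBd.open_basic_subset[OF V q] by blast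
  obtain P n where P: "P \<in> poly_invariants" "f = bet P n" by (rule BB_E[OF f(1)])
  have "f \<in> r \<longleftrightarrow> bet P 0 \<in> r" if "r \<in> Spec BB" for r unfolding P(2) by (rule Spec_BB(5)[OF that P(1)])
  then show ?thesis using f(2,3) q S P(1) by blast
qed

lemma openin_WW:
  assumes V: "openin (zariski BB) V"
  shows "openin (zariski RX) (WW V)"
proof (subst openin_subopen, rule ballI)
  fix p assume "p \<in> WW V"
  then have p: "p \<in> X0" "FF p \<in> V" by (simp_all add: WW_iff)
  obtain P where P: "P \<in> poly_invariants" "bet P 0 \<notin> FF p" "\<And>r. r \<in> Spec BB \<Longrightarrow> bet P 0 \<notin> r \<Longrightarrow> r \<in> V"
    using FF_basic[OF V p(2)] by blast
  let ?N = "{r \<in> Spec RX. P * Discr \<notin> r}"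
  have "?N \<subseteq> WW V"
  proof
    fix r assume "r \<in> ?N"
    then have r: "r \<in> Spec RX" "P \<notin> r" "Discr \<notin> r" using Spec_RX(5)[of r P Discr] by auto
    then have "r \<in> X0" by (simp add: X0_def)
    with r(2) show "r \<in> WW V" by (simp add: WW_iff P FF_Spec FF_bet)
  qed
  moreover have "P * Discr \<notin> p"
    using P(1,2) p X0_Discr[OF p(1), of 1] Spec_RX(5)[OF X0_Spec[OF p(1)], of P Discr] by (simp add: FF_bet)
  then have "p \<in> ?N" using X0_Spec[OF p(1)] by simp
  moreover have "openin (zariski RX) ?N" by (rule RX.openin_basic) simp
  ultimately show "\<exists>T. openin (zariski RX) T \<and> p \<in> T \<and> T \<subseteq> WW V" by blast
qed

lemma section_BB_E:
  assumes t: "t \<in> sections BB V" and p: "p \<in> X0" "FF p \<in> V"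
  obtains P Q where "P \<in> poly_invariants" "Q \<in> poly_invariants" "Q \<notin> p" "t (FF p) = frac BB (FF p) (bet P 0) (bet Q 0)"
proof -
  have "t (FF p) \<in> carrier (stalk BB (FF p))" using t p(2) by (auto simp: sections_def)
  then obtain P Q where "P \<in> poly_invariants" "Q \<in> poly_invariants" "bet Q 0 \<notin> FF p"
    "t (FF p) = frac BB (FF p) (bet P 0) (bet Q 0)" by (rule stalk_BB_E[OF FF_Spec[OF p(1)]])
  then show ?thesis using that[of P Q] p(1) by (simp add: FF_bet)
qed

text \<open>The same invariants vanish at a point and at its rotations, so both lie over the same
  prime.\<close>

lemma FF_kernel_act:
  assumes g: "rotation_matrix g" and x: "x \<in> X_points" "ev x Discr \<noteq> 0"
  shows "{P. eval_at (ract g x) P = 0} \<in> X0" "FF {P. eval_at (ract g x) P = 0} = FF {P. eval_at x P = 0}"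
proof -
  have x0: "x \<in> points_of X0" using x by (simp add: points_of_X0_iff)
  then have k: "{P. eval_at x P = 0} \<in> X0" by (simp add: points_of_def)
  show k': "{P. eval_at (ract g x) P = 0} \<in> X0" using ract_points_X0[OF g x0] by (simp add: points_of_def)
  show "FF {P. eval_at (ract g x) P = 0} = FF {P. eval_at x P = 0}"
  proof (rule FF_eqI[OF FF_Spec[OF k] k'])
    fix P assume P: "P \<in> poly_invariants"
    show "P \<in> {P. eval_at (ract g x) P = 0} \<longleftrightarrow> bet P 0 \<in> FF {P. eval_at x P = 0}"
      unfolding FF_bet[OF k P] using poly_invariantsD[OF P g x(1)] by (simp add: eval_at_ev)
  qed
qed

lemma points_of_WW:
  "x \<in> points_of (WW V) \<longleftrightarrow> x \<in> X_points \<and> ev x Discr \<noteq> 0 \<and> FF {P. eval_at x P = 0} \<in> V"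
  using points_of_X0_iff[of x] by (auto simp: points_of_def WW_iff)

text \<open>A local fraction of invariants downstairs stays a local fraction upstairs, on the
  preimage of its domain; its values are invariant because numerator and denominator are.\<close>

lemma PB_closed:
  assumes V: "openin (zariski BB) V" and t: "t \<in> sections BB V"
  shows "PB V t \<in> carrier (invariant_ring (WW V))"
proof -
  have stalk: "PB V t p \<in> carrier (stalk RX p)" if pW: "p \<in> WW V" for p
  proof -
    have p: "p \<in> X0" "FF p \<in> V" using pW by (simp_all add: WW_iff)
    obtain P Q where PQ: "P \<in> poly_invariants" "Q \<in> poly_invariants" "Q \<notin> p" "t (FF p) = frac BB (FF p) (bet P 0) (bet Q 0)"
      by (rule section_BB_E[OF t p])
    show ?thesis unfolding PB_apply[where t = t, OF p PQ] by (rule RX.frac_in_stalk) (simp_all add: PQ)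
  qed
  have loc: "\<exists>N. openin (zariski RX) N \<and> p \<in> N \<and> N \<subseteq> WW V \<and>
      (\<exists>a\<in>carrier RX. \<exists>f\<in>carrier RX. \<forall>q\<in>N. f \<notin> q \<and> PB V t q = frac RX q a f)" if pW: "p \<in> WW V" for p
  proof -
    have p: "p \<in> X0" "FF p \<in> V" using pW by (simp_all add: WW_iff)
    have "\<forall>q\<in>V. \<exists>N. openin (zariski BB) N \<and> q \<in> N \<and> N \<subseteq> V \<and>
         (\<exists>a\<in>carrier BB. \<exists>f\<in>carrier BB. \<forall>q\<in>N. f \<notin> q \<and> t q = frac BB q a f)" using t by (simp add: sections_def)
    from bspec[OF this p(2)] obtain N a f where N: "openin (zariski BB) N" "FF p \<in> N" "N \<subseteq> V"
      and af: "a \<in> carrier BB" "f \<in> carrier BB" "\<forall>q\<in>N. f \<notin> q \<and> t q = frac BB q a f" by blast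
    obtain P Q where PQ: "P \<in> poly_invariants" "Q \<in> poly_invariants"
      "\<forall>q\<in>Spec BB. f \<notin> q \<longrightarrow> bet Q 0 \<notin> q \<and> frac BB q a f = frac BB q (bet P 0) (bet Q 0)"
      using frac_BB_clear[OF FF_Spec[OF p(1)] af(1,2)] by (elim bexE)
    have "Q \<notin> r \<and> PB V t r = frac RX r P Q" if rN: "r \<in> WW N" for r
    proof -
      have r: "r \<in> X0" "FF r \<in> N" using rN by (simp_all add: WW_iff)
      have 1: "f \<notin> FF r" "t (FF r) = frac BB (FF r) a f" using bspec[OF af(3) r(2)] by simp_all
      have 2: "bet Q 0 \<notin> FF r" "t (FF r) = frac BB (FF r) (bet P 0) (bet Q 0)"
        using bspec[OF PQ(3) FF_Spec[OF r(1)]] 1 by simp_all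
      have "Q \<notin> r" using 2(1) by (simp add: FF_bet r PQ)
      moreover have "FF r \<in> V" using r(2) N(3) by blast
      ultimately show ?thesis using PB_apply[where t = t, OF r(1) _ PQ(1,2) _ 2(2)] by simp
    qed
    then have PBN: "\<forall>r\<in>WW N. Q \<notin> r \<and> PB V t r = frac RX r P Q" by (rule ballI)
    have NV: "WW N \<subseteq> WW V" using N(3) by (auto simp: WW_iff)
    have pN: "p \<in> WW N" using p N(2) by (simp add: WW_iff)
    show ?thesis
      by (rule exI[of _ "WW N"], intro conjI, rule openin_WW[OF N(1)], rule pN, rule NV,
          rule bexI[of _ P], rule bexI[of _ Q], rule PBN) simp_all
  qed
  have pie: "PB V t \<in> (\<Pi>\<^sub>E p\<in>WW V. carrier (stalk RX p))"
    by (rule PiE_I[OF stalk PB_ext])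
  have "PB V t \<in> sections RX (WW V)" unfolding sections_def by (intro CollectI conjI ballI pie loc)
  moreover have "section_value (PB V t) (act g x) = section_value (PB V t) x"
    if gx: "g \<in> SO3" "x \<in> points_of (WW V)" for g x
  proof -
    let ?k = "{P. eval_at x P = 0}" and ?l = "{P. eval_at (ract g x) P = 0}"
    have g: "rotation_matrix g" and x: "x \<in> X_points" "ev x Discr \<noteq> 0" "FF ?k \<in> V"
      using gx by (simp_all add: SO3_iff points_of_WW)
    have "x \<in> points_of X0" using x(1,2) by (simp add: points_of_X0_iff)
    then have k: "?k \<in> X0" by (simp add: points_of_def)
    note l = FF_kernel_act[OF g x(1,2)]
    obtain P Q where PQ: "P \<in> poly_invariants" "Q \<in> poly_invariants" "Q \<notin> ?k" "t (FF ?k) = frac BB (FF ?k) (bet P 0) (bet Q 0)"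
      by (rule section_BB_E[OF t k x(3)])
    have inv: "ev (ract g x) P = ev x P" "ev (ract g x) Q = ev x Q"
      by (rule poly_invariantsD[OF _ g x(1)], fact PQ)+
    have Q0: "ev x Q \<noteq> 0" using PQ(3) by (simp add: eval_at_ev)
    then have Ql: "Q \<notin> ?l" by (simp add: eval_at_ev inv)
    have "PB V t ?k = frac RX ?k P Q" by (rule PB_apply[where t = t, OF k x(3) PQ])
    then have 1: "section_value (PB V t) x = ev x P / ev x Q" using Q0 by (rule section_value_frac)
    have "PB V t ?l = frac RX ?l P Q"
      by (rule PB_apply[where t = t, OF l(1) _ PQ(1,2) Ql]) (use l(2) x(3) PQ(4) in simp_all)
    then have "section_value (PB V t) (ract g x) = ev (ract g x) P / ev (ract g x) Q"
      by (rule section_value_frac) (simp add: inv Q0)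
    then show ?thesis by (simp add: 1 inv act_ract)
  qed
  ultimately show ?thesis by (simp add: invariant_ring_def)
qed

lemma invariant_ring_ops:
  "s \<otimes>\<^bsub>invariant_ring W\<^esub> t = (\<lambda>p\<in>W. s p \<otimes>\<^bsub>stalk RX p\<^esub> t p)"
  "s \<oplus>\<^bsub>invariant_ring W\<^esub> t = (\<lambda>p\<in>W. s p \<oplus>\<^bsub>stalk RX p\<^esub> t p)"
  "\<one>\<^bsub>invariant_ring W\<^esub> = (\<lambda>p\<in>W. \<one>\<^bsub>stalk RX p\<^esub>)"
  by (simp_all add: invariant_ring_def section_ring_def)

lemma PB_ring_hom:
  assumes V: "openin (zariski BB) V"
  shows "PB V \<in> ring_hom (section_ring BB V) (invariant_ring (WW V))"
proof (rule ring_hom_memI)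
  fix t assume "t \<in> carrier (section_ring BB V)"
  then have t: "t \<in> sections BB V" by (simp add: section_ring_def)
  show "PB V t \<in> carrier (invariant_ring (WW V))" by (rule PB_closed[OF V t])
  fix u assume "u \<in> carrier (section_ring BB V)"
  then have u: "u \<in> sections BB V" by (simp add: section_ring_def)
  have "PB V (t \<otimes>\<^bsub>section_ring BB V\<^esub> u) p = (PB V t \<otimes>\<^bsub>invariant_ring (WW V)\<^esub> PB V u) p \<and>
    PB V (t \<oplus>\<^bsub>section_ring BB V\<^esub> u) p = (PB V t \<oplus>\<^bsub>invariant_ring (WW V)\<^esub> PB V u) p" for p
  proof (cases "p \<in> WW V")
    case True
    then have p: "p \<in> X0" "FF p \<in> V" by (simp_all add: WW_iff)
    note Sp = X0_Spec[OF p(1)] and Sq = FF_Spec[OF p(1)]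
    obtain P Q where PQ: "P \<in> poly_invariants" "Q \<in> poly_invariants" "Q \<notin> p" "t (FF p) = frac BB (FF p) (bet P 0) (bet Q 0)"
      by (rule section_BB_E[OF t p])
    obtain P' Q' where PQ': "P' \<in> poly_invariants" "Q' \<in> poly_invariants" "Q' \<notin> p" "u (FF p) = frac BB (FF p) (bet P' 0) (bet Q' 0)"
      by (rule section_BB_E[OF u p])
    have QQ: "Q * Q' \<notin> p" using PQ PQ' Spec_RX(5)[OF Sp, of Q Q'] by simp
    have c: "bet Q 0 \<in> carrier BB - FF p" "bet Q' 0 \<in> carrier BB - FF p"
      using PQ PQ' p by (simp_all add: bet_in_BB FF_bet)
    have inv: "P * P' \<in> poly_invariants" "Q * Q' \<in> poly_invariants" "P * Q' + P' * Q \<in> poly_invariants"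
      by (intro poly_invariants_closed PQ PQ')+
    have tu: "(t \<otimes>\<^bsub>section_ring BB V\<^esub> u) (FF p) = frac BB (FF p) (bet (P * P') 0) (bet (Q * Q') 0)"
      using BBd.stalk_mult[OF Sq bet_in_BB[OF PQ(1)] c(1) bet_in_BB[OF PQ'(1)] c(2)] p(2)
      by (simp add: section_ring_def PQ PQ' BB_mult)
    have tu': "(t \<oplus>\<^bsub>section_ring BB V\<^esub> u) (FF p) = frac BB (FF p) (bet (P * Q' + P' * Q) 0) (bet (Q * Q') 0)"
      using BBd.stalk_add[OF Sq bet_in_BB[OF PQ(1)] c(1) bet_in_BB[OF PQ'(1)] c(2)] p(2)
      by (simp add: section_ring_def PQ PQ' BB_mult BB_add)
    show ?thesis
      using RX.stalk_mult[OF Sp, of P Q P' Q'] RX.stalk_add[OF Sp, of P Q P' Q'] PQ(3) PQ'(3) True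
      unfolding PB_apply[where t = "t \<otimes>\<^bsub>section_ring BB V\<^esub> u", OF p inv(1,2) QQ tu] PB_apply[where t = "t \<oplus>\<^bsub>section_ring BB V\<^esub> u", OF p inv(3,2) QQ tu']
      by (simp add: invariant_ring_ops PB_apply[where t = t, OF p PQ] PB_apply[where t = u, OF p PQ'])
  next
    case False
    then show ?thesis by (simp add: invariant_ring_ops PB_ext)
  qed
  then show "PB V (t \<otimes>\<^bsub>section_ring BB V\<^esub> u) = PB V t \<otimes>\<^bsub>invariant_ring (WW V)\<^esub> PB V u"
    "PB V (t \<oplus>\<^bsub>section_ring BB V\<^esub> u) = PB V t \<oplus>\<^bsub>invariant_ring (WW V)\<^esub> PB V u"
    by (intro HOL.ext, blast)+
next
  have "PB V \<one>\<^bsub>section_ring BB V\<^esub> p = \<one>\<^bsub>invariant_ring (WW V)\<^esub> p" for p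
  proof (cases "p \<in> WW V")
    case True
    then have p: "p \<in> X0" "FF p \<in> V" by (simp_all add: WW_iff)
    note one = poly_invariants_closed(7)
    have "\<one>\<^bsub>section_ring BB V\<^esub> (FF p) = frac BB (FF p) (bet 1 0) (bet 1 0)"
      using p(2) by (simp add: section_ring_def BBd.stalk_one flip: BB_one)
    from PB_apply[where t = "\<one>\<^bsub>section_ring BB V\<^esub>", OF p one one Spec_RX(2)[OF X0_Spec[OF p(1)]] this]
    show ?thesis using True by (simp add: invariant_ring_ops RX.stalk_one)
  next
    case False
    then show ?thesis by (simp add: invariant_ring_ops PB_ext)
  qed
  then show "PB V \<one>\<^bsub>section_ring BB V\<^esub> = \<one>\<^bsub>invariant_ring (WW V)\<^esub>" by (rule HOL.ext)
qed

text \<open>By \<open>FF_surj\<close> each germ downstairs can be compared at a prime above it,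
  where equality of fractions is the same equation between polynomials.\<close>

lemma PB_inj:
  assumes V: "openin (zariski BB) V" and t: "t \<in> sections BB V" and u: "u \<in> sections BB V" and eq: "PB V t = PB V u"
  shows "t = u"
proof (rule HOL.ext)
  fix q
  show "t q = u q"
  proof (cases "q \<in> V")
    case True
    then have q: "q \<in> Spec BB" using BBd.open_subset_Spec[OF V] by blast
    obtain p where p: "p \<in> X0" "FF p = q" using FF_surj[OF q] by blast
    have qV: "FF p \<in> V" using True p by simp
    obtain P Q where PQ: "P \<in> poly_invariants" "Q \<in> poly_invariants" "Q \<notin> p" "t (FF p) = frac BB (FF p) (bet P 0) (bet Q 0)"
      by (rule section_BB_E[OF t p(1) qV])
    obtain P' Q' where PQ': "P' \<in> poly_invariants" "Q' \<in> poly_invariants" "Q' \<notin> p" "u (FF p) = frac BB (FF p) (bet P' 0) (bet Q' 0)"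
      by (rule section_BB_E[OF u p(1) qV])
    have "frac RX p P Q = frac RX p P' Q'"
      using PB_apply[where t = t, OF p(1) qV PQ] PB_apply[where t = u, OF p(1) qV PQ'] eq by simp
    then have "P * Q' = P' * Q" using frac_RX_iff[OF X0_Spec[OF p(1)] PQ(3) PQ'(3)] by simp
    then have "t (FF p) = u (FF p)" unfolding PQ(4) PQ'(4)
      by (subst frac_BB_iff[OF FF_Spec[OF p(1)] PQ(1,2) _ PQ'(1,2)]) (simp_all add: FF_bet p(1) PQ PQ')
    then show ?thesis by (simp add: p(2))
  next
    case False
    then show ?thesis using t u by (auto simp: sections_def PiE_def extensional_def)
  qed
qed

text \<open>Near \<open>q\<close> choose an invariant \<open>P\<close> whose basic open set lies in
  \<open>V\<close>. Over it \<open>s\<close> is one fraction with denominator a power of the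
  invariant \<open>P * Discr\<close>, so its numerator is invariant by
  \<open>invariant_dense\<close> and the fraction descends. The local descents then have to be
  glued.\<close>

lemma PB_surj:
  assumes V: "openin (zariski BB) V" and s: "s \<in> carrier (invariant_ring (WW V))"
  shows "\<exists>t\<in>sections BB V. PB V t = s"
proof -
  have sec: "s \<in> sections RX (WW V)"
    and sinv: "\<And>g x. rotation_matrix g \<Longrightarrow> x \<in> points_of (WW V) \<Longrightarrow> section_value s (ract g x) = section_value s x"
    using s by (simp_all add: invariant_ring_def SO3_iff act_ract)
  have VS: "V \<subseteq> Spec BB" by (rule BBd.open_subset_Spec[OF V])
  \<comment> \<open>Bundles a descent of \<open>s\<close> near \<open>q\<close>: an invariant
    fraction \<open>a / G\<close> and an open set \<open>N\<close> on which it is valid. One choice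
    for each \<open>q\<close> then provides all three.\<close>
  define good where "good q a G N \<longleftrightarrow> a \<in> poly_invariants \<and> G \<in> poly_invariants \<and> openin (zariski BB) N \<and>
    q \<in> N \<and> N \<subseteq> V \<and> (\<forall>r\<in>N. bet G 0 \<notin> r) \<and> (\<forall>p\<in>X0. FF p \<in> N \<longrightarrow> s p = frac RX p a G)" for q a G N
  have "\<exists>a G N. good q a G N" if q: "q \<in> V" for q
  proof -
    have qS: "q \<in> Spec BB" using q VS by blast
    obtain P where P: "P \<in> poly_invariants" "bet P 0 \<notin> q" "\<And>r. r \<in> Spec BB \<Longrightarrow> bet P 0 \<notin> r \<Longrightarrow> r \<in> V"
      using FF_basic[OF V q] by blast
    let ?g = "P * Discr"
    have sub: "{r \<in> Spec RX. ?g \<notin> r} \<subseteq> WW V"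
    proof
      fix r assume "r \<in> {r \<in> Spec RX. ?g \<notin> r}"
      then have r: "r \<in> Spec RX" "P \<notin> r" "Discr \<notin> r" using Spec_RX(5)[of r P Discr] by auto
      then have "r \<in> X0" by (simp add: X0_def)
      with r(2) show "r \<in> WW V" by (simp add: WW_iff P FF_Spec FF_bet)
    qed
    obtain a n where a: "\<And>p. p \<in> WW V \<Longrightarrow> ?g \<notin> p \<Longrightarrow> s p = frac RX p a (?g [^]\<^bsub>RX\<^esub> (n::nat))"
      by (rule RX.section_on_basic[OF openin_WW[OF V] sec _ sub]) simp_all
    have gI: "?g \<in> poly_invariants" by (intro poly_invariants_closed P)
    have "P \<noteq> 0" using P(2) Spec_BB(1)[OF qS] by auto
    then have "?g \<noteq> 0" using Discr_nz real_poly_no_zero_divisors by blast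
    then have "a \<in> poly_invariants"
    proof (rule invariant_dense)
      fix g :: "complex^3^3" and x assume g: "rotation_matrix g" and x: "x \<in> X_points" "ev x ?g \<noteq> 0"
      let ?k = "{P. eval_at x P = 0}" and ?l = "{P. eval_at (ract g x) P = 0}"
      have D: "ev x Discr \<noteq> 0" using x(2) by auto
      have kW: "?k \<in> WW V" by (rule subsetD[OF sub]) (use x(2) kernel_Spec in \<open>simp add: eval_at_ev\<close>)
      note gi = poly_invariantsD[OF gI g x(1)]
      have lW: "?l \<in> WW V" by (rule subsetD[OF sub]) (use x(2) gi kernel_Spec[of "ract g x"] in \<open>simp add: eval_at_ev\<close>)
      have xl: "ev (ract g x) ?g \<noteq> 0" unfolding gi by (rule x(2))
      have xW: "x \<in> points_of (WW V)" using kW x(1) by (simp add: points_of_def)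
      have "s ?k = frac RX ?k a (?g ^ n)" using a[OF kW] x(2) by (simp add: eval_at_ev RX_pow)
      then have 1: "section_value s x = ev x a / ev x (?g ^ n)" by (rule section_value_frac) (use x(2) in simp)
      have "s ?l = frac RX ?l a (?g ^ n)" using a[OF lW] xl by (simp add: eval_at_ev RX_pow)
      then have 2: "section_value s (ract g x) = ev (ract g x) a / ev (ract g x) (?g ^ n)"
        by (rule section_value_frac) (use xl in simp)
      have 3: "ev (ract g x) (?g ^ n) = ev x (?g ^ n)"
        by (rule poly_invariantsD[OF poly_invariants_closed(5)[OF gI] g x(1)])
      have "ev (ract g x) a / ev x (?g ^ n) = ev x a / ev x (?g ^ n)"
        using sinv[OF g xW] unfolding 1 2 3 .
      then have "ev x (?g ^ n) = 0 \<or> ev (ract g x) a = ev x a" by (rule iffD1[OF divide_cancel_right])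
      moreover have "ev x (?g ^ n) \<noteq> 0" using x(2) by simp
      ultimately show "ev (ract g x) a = ev x a" by blast
    qed
    note aI = this
    have gn: "bet (?g ^ n) 0 \<notin> r" if "r \<in> Spec BB" "bet P 0 \<notin> r" for r
    proof -
      have "bet ?g 0 \<notin> r"
        using Spec_BB(4)[OF that(1) P(1) poly_invariants_closed(4)] Spec_BB(7)[OF that(1)] that(2) by blast
      then show ?thesis by (rule Spec_BB(6)[OF that(1) gI])
    qed
    let ?N = "{r \<in> Spec BB. bet P 0 \<notin> r}"
    have sp: "s p = frac RX p a (?g ^ n)" if pX: "p \<in> X0" and pN: "FF p \<in> ?N" for p
    proof -
      have "P \<notin> p" using pN by (simp add: FF_bet pX P(1))
      then have "?g \<notin> p" using Spec_RX(5)[OF X0_Spec[OF pX], of P Discr] X0_Discr[OF pX, of 1] by simp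
      moreover have "p \<in> WW V" using pX pN P(3) by (simp add: WW_iff)
      ultimately show ?thesis using a[of p] by (simp add: RX_pow)
    qed
    have "good q a (?g ^ n) ?N"
      unfolding good_def
    proof (intro conjI ballI impI subsetI)
      show "a \<in> poly_invariants" by (rule aI)
      show "?g ^ n \<in> poly_invariants" by (rule poly_invariants_closed(5)[OF gI])
      show "openin (zariski BB) ?N" by (rule BBd.openin_basic[OF bet_in_BB[OF P(1)]])
      show "q \<in> ?N" using qS P(2) by simp
      show "r \<in> V" if "r \<in> ?N" for r using that P(3) by simp
      show "bet (?g ^ n) 0 \<notin> r" if "r \<in> ?N" for r using that gn by simp
      show "s p = frac RX p a (?g ^ n)" if "p \<in> X0" "FF p \<in> ?N" for p using that by (rule sp)
    qed
    then show ?thesis by (intro exI)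
  qed
  note ex = this
  have "\<forall>q\<in>V. \<exists>T. good q (fst T) (fst (snd T)) (snd (snd T))"
  proof
    fix q assume "q \<in> V"
    from ex[OF this] obtain a G N where "good q a G N" by (elim exE) (rule that)
    then show "\<exists>T. good q (fst T) (fst (snd T)) (snd (snd T))" by (intro exI[of _ "(a, G, N)"]) simp
  qed
  from bchoice[OF this] obtain F where F: "\<forall>q\<in>V. good q (fst (F q)) (fst (snd (F q))) (snd (snd (F q)))"
    by (elim exE) (rule that)
  define a G N where "a q = fst (F q)" and "G q = fst (snd (F q))" and "N q = snd (snd (F q))" for q
  have good: "good q (a q) (G q) (N q)" if "q \<in> V" for q
    using bspec[OF F that] unfolding a_def G_def N_def .
  define t where "t = (\<lambda>q\<in>V. frac BB q (bet (a q) 0) (bet (G q) 0))"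
  have G: "a q \<in> poly_invariants" "G q \<in> poly_invariants" "openin (zariski BB) (N q)" "q \<in> N q" "N q \<subseteq> V"
    "r \<in> N q \<Longrightarrow> bet (G q) 0 \<notin> r" "p \<in> X0 \<Longrightarrow> FF p \<in> N q \<Longrightarrow> s p = frac RX p (a q) (G q)" if "q \<in> V" for q r p
    using good[OF that] unfolding good_def by simp_all
  \<comment> \<open>The chosen fractions agree: by \<open>FF_surj\<close> some \<open>p\<close> lies
    over \<open>r\<close>, both fractions give \<open>s p\<close> there, and the resulting equation
    between polynomials is the equality of germs downstairs.\<close>
  have loc: "t r = frac BB r (bet (a q) 0) (bet (G q) 0)" if q: "q \<in> V" and rN: "r \<in> N q" for q r
  proof -
    have r: "r \<in> V" using G(5)[OF q] rN by blast
    then have rS: "r \<in> Spec BB" using VS by blast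
    obtain p where p: "p \<in> X0" "FF p = r" using FF_surj[OF rS] by blast
    have b: "bet (G q) 0 \<notin> r" "bet (G r) 0 \<notin> r" using G(6)[OF q rN] G(6)[OF r G(4)[OF r]] by simp_all
    then have "G q \<notin> p" "G r \<notin> p"
      using FF_bet[OF p(1) G(2)[OF q], of 0] FF_bet[OF p(1) G(2)[OF r], of 0] p(2) by simp_all
    moreover have "frac RX p (a r) (G r) = frac RX p (a q) (G q)"
      using G(7)[OF q p(1)] G(7)[OF r p(1)] rN G(4)[OF r] p(2) by simp
    ultimately have "a r * G q = a q * G r" using frac_RX_iff[OF X0_Spec[OF p(1)], of "G r" "G q"] by simp
    then have "frac BB r (bet (a r) 0) (bet (G r) 0) = frac BB r (bet (a q) 0) (bet (G q) 0)"
      using frac_BB_iff[OF rS G(1,2)[OF r] b(2) G(1,2)[OF q] b(1)] by simp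
    then show ?thesis using r by (simp add: t_def)
  qed
  have "t \<in> sections BB V" unfolding sections_def
  proof (intro CollectI conjI ballI)
    have "t q \<in> carrier (stalk BB q)" if q: "q \<in> V" for q
    proof -
      have "bet (G q) 0 \<in> carrier BB - q" using G(6)[OF q G(4)[OF q]] bet_in_BB[OF G(2)[OF q]] by simp
      then show ?thesis using BBd.frac_in_stalk[OF bet_in_BB[OF G(1)[OF q]]] q by (simp add: t_def)
    qed
    then show "t \<in> (\<Pi>\<^sub>E q\<in>V. carrier (stalk BB q))" by (intro PiE_I) (simp_all add: t_def)
    fix q assume q: "q \<in> V"
    have tt: "\<forall>r\<in>N q. bet (G q) 0 \<notin> r \<and> t r = frac BB r (bet (a q) 0) (bet (G q) 0)"
      using G(6)[OF q] loc[OF q] by simp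
    show "\<exists>N. openin (zariski BB) N \<and> q \<in> N \<and> N \<subseteq> V \<and>
         (\<exists>a\<in>carrier BB. \<exists>f\<in>carrier BB. \<forall>q\<in>N. f \<notin> q \<and> t q = frac BB q a f)"
      by (rule exI[of _ "N q"], intro conjI, rule G(3)[OF q], rule G(4)[OF q], rule G(5)[OF q],
          rule bexI[of _ "bet (a q) 0"], rule bexI[of _ "bet (G q) 0"], rule tt,
          rule bet_in_BB[OF G(2)[OF q]], rule bet_in_BB[OF G(1)[OF q]])
  qed
  moreover have "PB V t = s"
  proof (rule HOL.ext)
    fix p show "PB V t p = s p"
    proof (cases "p \<in> WW V")
      case True
      then have p: "p \<in> X0" "FF p \<in> V" by (simp_all add: WW_iff)
      have "G (FF p) \<notin> p" using FF_bet[OF p(1) G(2)[OF p(2)], of 0] G(6)[OF p(2) G(4)[OF p(2)]] by simp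
      then have "PB V t p = frac RX p (a (FF p)) (G (FF p))"
        by (rule PB_apply[where t = t, OF p G(1,2)[OF p(2)]]) (simp add: t_def p(2))
      also have "\<dots> = s p" using G(7)[OF p(2) p(1) G(4)[OF p(2)]] by simp
      finally show ?thesis .
    next
      case False
      then show ?thesis using sec by (auto simp: PB_ext sections_def PiE_def extensional_def)
    qed
  qed
  ultimately show ?thesis by blast
qed

lemma PB_ring_iso:
  assumes V: "openin (zariski BB) V"
  shows "PB V \<in> ring_iso (section_ring BB V) (invariant_ring (WW V))"
  unfolding ring_iso_def
proof (intro CollectI conjI)
  show "PB V \<in> ring_hom (section_ring BB V) (invariant_ring (WW V))" by (rule PB_ring_hom[OF V])
  have c: "carrier (section_ring BB V) = sections BB V" by (simp add: section_ring_def)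
  show "bij_betw (PB V) (carrier (section_ring BB V)) (carrier (invariant_ring (WW V)))"
    unfolding c
  proof (rule bij_betw_imageI)
    show "inj_on (PB V) (sections BB V)" by (rule inj_onI) (rule PB_inj[OF V])
    show "PB V ` sections BB V = carrier (invariant_ring (WW V))"
      using PB_closed[OF V] PB_surj[OF V] by blast
  qed
qed

lemma G_stable_X0: "G_stable X0"
  by (simp add: G_stable_def SO3_iff act_ract ract_points_X0)

lemma geometric_quotient_X0: "geometric_quotient X0 BB (const_section X0) (\<lambda>s. s)"
  unfolding geometric_quotient_def
proof (intro conjI ballI allI impI)
  show "(\<lambda>s. s) \<in> ring_hom BB (section_ring RX X0)"
    by (simp add: ring_hom_def invariant_ring_def section_ring_def)
qed (rule openin_X0 G_stable_X0 affine_real_variety_BB refl open_map_FF qp_act bij_orbits PB_ring_iso; assumption?)+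

theorem theorem5p6:
  shows "Discr \<in> poly_invariants
    \<and> points_of X0 = {(v, A) \<in> X_points. card (eigenvalues A) = 3}
    \<and> carrier (invariant_ring X0) = {frac_section RX X0 P (Discr ^ n) | P n. P \<in> poly_invariants}
    \<and> geometric_quotient X0 (invariant_ring X0) (const_section X0) (\<lambda>s. s)
    \<and> geometric_rational_quotient X0 (invariant_ring X0) (const_section X0) (\<lambda>s. s)"
  unfolding geometric_rational_quotient_def
  using poly_invariants_closed(4) points_of_X0 carrier_BB[unfolded bet_def] geometric_quotient_X0
    openin_X0 closure_X0 G_stable_X0 by (intro conjI)

end
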